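(* Let $k\ge 2$ and let $F$ be an edge-critical generalized theta graph. Then for all sufficiently large $n$: \begin{enumerate} \item for every integer $r$ with $3\le r\le k+1$, \[\mathrm{ex}(n,K_r,kF)=\binom{k-1}{r}+\binom{k-1}{r-1}(n-k+1)+\binom{k-1}{r-2}\left\lfloor \frac{(n-k+1)^2}{4}\right\rfloor;\] \item for every integer $r\ge k+2$, $\mathrm{ex}(n,K_r,kF)=o(n^2)$. \end{enumerate}
   Context: All graphs are finite and simple. For graphs $T$ and $F$, $\mathrm{ex}(n,T,F)$ denotes the maximum possible number of copies of $T$ in an $n$-vertex graph containing no copy of $F$ as a subgraph. $kF$ denotes the disjoint union of $k$ copies of $F$, and $K_r$ is the complete graph on $r$ vertices. For integers $m\ge 2$ and $p_1,\ldots,p_m\ge1$, the generalized theta graph $\Theta(p_1,\ldots,p_m)$ is the simple graph consisting of two end vertices joined by $m$ internally vertex-disjoint paths of lengths $p_1,\ldots,p_m$. A graph is edge-critical if it has an edge whose deletion reduces its chromatic number; a generalized theta graph is edge-critical exactly when one of its paths has length of parity different from the lengths of all other paths. *)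

theory Defs
  imports Complex_Main "HOL-Library.Landau_Symbols"
begin

text \<open>A graph is a pair of a vertex set and a set of edges, each edge being a two-element set.\<close>

type_synonym 'a sgraph = "'a set \<times> 'a set set"

abbreviation verts :: "'a sgraph \<Rightarrow> 'a set" where "verts G \<equiv> fst G"
abbreviation edges :: "'a sgraph \<Rightarrow> 'a set set" where "edges G \<equiv> snd G"

definition simple_graph :: "'a sgraph \<Rightarrow> bool" where
  "simple_graph G \<longleftrightarrow> finite (verts G) \<and> (\<forall>e\<in>edges G. e \<subseteq> verts G \<and> card e = 2)"

definition subgraph :: "'a sgraph \<Rightarrow> 'a sgraph \<Rightarrow> bool" where
  "subgraph H G \<longleftrightarrow> simple_graph H \<and> verts H \<subseteq> verts G \<and> edges H \<subseteq> edges G"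

definition graph_iso :: "'a sgraph \<Rightarrow> 'b sgraph \<Rightarrow> bool" where
  "graph_iso G H \<longleftrightarrow>
     (\<exists>f. bij_betw f (verts G) (verts H) \<and> edges H = (\<lambda>e. f ` e) ` edges G)"

definition copies :: "'b sgraph \<Rightarrow> 'a sgraph \<Rightarrow> 'a sgraph set" where
  "copies T G = {H. subgraph H G \<and> graph_iso T H}"

text \<open>Every finite graph is isomorphic to one on natural numbers, so it suffices to let \<open>G\<close>
  range over graphs with vertices in \<^typ>\<open>nat\<close>. If \<open>F\<close> has an edge, the maximum is taken
  over a nonempty finite set; see \<open>gen_turan_set\<close> below.\<close>

definition gen_turan :: "nat \<Rightarrow> 'b sgraph \<Rightarrow> 'c sgraph \<Rightarrow> nat" where
  "gen_turan n T F =
     Max {card (copies T G) | G :: nat sgraph.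
            simple_graph G \<and> card (verts G) = n \<and> copies F G = {}}"

definition complete_graph :: "nat \<Rightarrow> nat sgraph" where
  "complete_graph r = ({..<r}, {e. e \<subseteq> {..<r} \<and> card e = 2})"

definition disjoint_copies :: "nat \<Rightarrow> 'a sgraph \<Rightarrow> (nat \<times> 'a) sgraph" where
  "disjoint_copies k F =
     ({..<k} \<times> verts F, {Pair i ` e | i e. i < k \<and> e \<in> edges F})"

definition proper_colouring :: "'a sgraph \<Rightarrow> nat \<Rightarrow> ('a \<Rightarrow> nat) \<Rightarrow> bool" where
  "proper_colouring G c col \<longleftrightarrow>
     (\<forall>v\<in>verts G. col v < c) \<and>
     (\<forall>u v. {u, v} \<in> edges G \<longrightarrow> col u \<noteq> col v)"

definition chromatic_number :: "'a sgraph \<Rightarrow> nat" where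
  "chromatic_number G = (LEAST c. \<exists>col. proper_colouring G c col)"

definition delete_edge :: "'a sgraph \<Rightarrow> 'a set \<Rightarrow> 'a sgraph" where
  "delete_edge G e = (verts G, edges G - {e})"

definition edge_critical :: "'a sgraph \<Rightarrow> bool" where
  "edge_critical G \<longleftrightarrow>
     (\<exists>e\<in>edges G. chromatic_number (delete_edge G e) < chromatic_number G)"

datatype theta_vertex = Source | Sink | Inner nat nat

text \<open>\<open>theta_path ps i j\<close> is the vertex at distance \<open>j\<close> from \<^term>\<open>Source\<close> along the
  \<open>i\<close>-th path, whose length is \<^term>\<open>ps ! i\<close>.\<close>

definition theta_path :: "nat list \<Rightarrow> nat \<Rightarrow> nat \<Rightarrow> theta_vertex" where
  "theta_path ps i j =
     (if j = 0 then Source else if j = ps ! i then Sink else Inner i j)"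

definition theta_graph :: "nat list \<Rightarrow> theta_vertex sgraph" where
  "theta_graph ps =
     ({theta_path ps i j | i j. i < length ps \<and> j \<le> ps ! i},
      {{theta_path ps i j, theta_path ps i (Suc j)} | i j. i < length ps \<and> j < ps ! i})"

text \<open>The paths must be distinct in a simple graph, so at most one of them is a single edge.
  Without this restriction, the edge sets in \<^const>\<open>theta_graph\<close> would merge parallel edges.\<close>

definition theta_lengths :: "nat list \<Rightarrow> bool" where
  "theta_lengths ps \<longleftrightarrow>
     2 \<le> length ps \<and> (\<forall>p\<in>set ps. 1 \<le> p) \<and> count_list ps 1 \<le> 1"

definition generalized_theta :: "'a sgraph \<Rightarrow> bool" where
  "generalized_theta F \<longleftrightarrow> (\<exists>ps. theta_lengths ps \<and> graph_iso (theta_graph ps) F)"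

lemma gen_turan_set:
  fixes T :: "'b sgraph" and F :: "'c sgraph"
  assumes "edges F \<noteq> {}"
  shows "finite {card (copies T G) | G :: nat sgraph.
            simple_graph G \<and> card (verts G) = n \<and> copies F G = {}}" (is "finite ?S")
    and "{card (copies T G) | G :: nat sgraph.
            simple_graph G \<and> card (verts G) = n \<and> copies F G = {}} \<noteq> {}"
proof -
  have "card (copies T G) \<le> 2 ^ n * 2 ^ (2 ^ n)"
    if G: "simple_graph G" "card (verts G) = n" for G :: "nat sgraph"
  proof -
    have fin: "finite (verts G)" using G by (simp add: simple_graph_def)
    have "copies T G \<subseteq> Pow (verts G) \<times> Pow (Pow (verts G))"
    proof
      fix H assume "H \<in> copies T G"
      then have H: "simple_graph H" "verts H \<subseteq> verts G"
        by (auto simp: copies_def subgraph_def)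
      then have "edges H \<subseteq> Pow (verts G)"
        unfolding simple_graph_def by blast
      with H show "H \<in> Pow (verts G) \<times> Pow (Pow (verts G))"
        by (cases H) simp
    qed
    then have "card (copies T G) \<le> card (Pow (verts G) \<times> Pow (Pow (verts G)))"
      using fin by (intro card_mono) auto
    then show ?thesis using fin G by (simp add: card_cartesian_product card_Pow)
  qed
  then have "?S \<subseteq> {..2 ^ n * 2 ^ (2 ^ n)}" by auto
  then show "finite ?S" using finite_subset by blast
  have "copies F ({..<n}, {}) = {}"
    using assms by (auto simp: copies_def subgraph_def graph_iso_def)
  then have "card (copies T ({..<n}, {})) \<in> ?S"
    by (intro CollectI exI[of _ "({..<n}, {})"]) (simp add: simple_graph_def)
  then show "?S \<noteq> {}" by blast
qed

end

theory Submission
  imports Defs "HOL-Library.FuncSet"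
begin

text \<open>
  In a graph on \<open>n\<close> vertices without \<open>k\<close> disjoint copies of \<open>F\<close>, call a vertex big if its neighbourhood spans at least
  \<open>\<epsilon> n\<^sup>2\<close> edges. A theta graph minus its source is a tree, so a big vertex is the source of a copy of
  \<open>F\<close> that avoids any bounded set; hence there are at most \<open>k - 1\<close> big vertices, and if there are
  exactly \<open>k - 1\<close> then deleting them leaves an \<open>F\<close>-free graph. Deleting also a bounded set \<open>U\<close> that
  meets every copy of \<open>F\<close>, and using that \<open>F\<close>-free graphs have \<open>o(n\<^sup>2)\<close> triangles, up to \<open>o(n\<^sup>2)\<close> the
  only \<open>K\<^sub>r\<close> that count are those made of \<open>r - 2\<close> big vertices and an edge outside \<open>U\<close>.

  The triangle bound combines the Ruzsa--Szemeredi theorem for the edges that lie in a large complete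
  bipartite graph (each of them is in few triangles made of such edges) with the Kovari--Sos--Turan
  bound for the remaining edges. For the exact result, an \<open>F\<close>-free graph \<open>H\<close> on \<open>m\<close> vertices satisfies
  \<open>e(H) + C t(H) \<le> m\<^sup>2 / 4\<close> for its numbers of edges and triangles: if \<open>H\<close> is dense, some edge \<open>x y\<close> has
  \<open>|N(x) \<union> N(y)|\<close> close to \<open>m\<close>, and since neighbourhoods span only \<open>O(m)\<close> edges, \<open>H\<close> is almost complete
  bipartite. The critical edge of \<open>F\<close> then forces every edge inside a part to have ends that miss
  many edges across, which costs more than the triangles gain.
\<close>

subsection \<open>Cliques and neighbourhoods\<close>

text \<open>Exactness is the obstacle. With \<open>k - 1\<close> big vertices deleted, the cliques
  that have at most two vertices in the rest \<open>H\<close> give at most the three terms of the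
  formula, but triangles of \<open>H\<close> produce further cliques, and \<open>o(n^2)\<close> of
  these could exceed the linear term. In a theta-free graph the number of cliques of any larger size
  is at most a constant times the number of triangles, because links are degenerate. Hence
  everything reduces to \<open>e(H) + C t(H)\<close> with a constant \<open>C\<close> depending on
  \<open>k\<close> and \<open>F\<close>, which must be at most the floor of \<open>m^2 / 4\<close>
  without any error term. With fewer big vertices nothing exact is needed: the leading coefficient
  is smaller by at least one.

  The Ruzsa-Szemeredi theorem does not apply directly, since an edge of a theta-free graph can lie
  in many triangles: the complete tripartite graph with parts 1, 1, s contains no five-cycle. Edges
  inside a large complete bipartite graph can be replaced by longer odd paths, and this flexibility
  is what bounds their triangles.\<close>

definition nb :: "('a \<Rightarrow> 'a \<Rightarrow> bool) \<Rightarrow> 'a set \<Rightarrow> 'a \<Rightarrow> 'a set" where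
  "nb E S x = {y \<in> S. E x y}"

definition clique :: "('a \<Rightarrow> 'a \<Rightarrow> bool) \<Rightarrow> 'a set \<Rightarrow> bool" where
  "clique E K \<longleftrightarrow> (\<forall>x\<in>K. \<forall>y\<in>K. x \<noteq> y \<longrightarrow> E x y)"

definition cliques :: "('a \<Rightarrow> 'a \<Rightarrow> bool) \<Rightarrow> nat \<Rightarrow> 'a set \<Rightarrow> 'a set set" where
  "cliques E j S = {K. K \<subseteq> S \<and> card K = j \<and> clique E K}"

definition nc :: "('a \<Rightarrow> 'a \<Rightarrow> bool) \<Rightarrow> nat \<Rightarrow> 'a set \<Rightarrow> nat" where
  "nc E j S = card (cliques E j S)"

lemma nb_subset: "nb E S x \<subseteq> S"
  by (auto simp: nb_def)

lemma finite_nb [simp]: "finite S \<Longrightarrow> finite (nb E S x)"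
  by (simp add: nb_def)

lemma in_nb [simp]: "y \<in> nb E S x \<longleftrightarrow> y \<in> S \<and> E x y"
  by (auto simp: nb_def)

lemma clique_subset: "clique E K \<Longrightarrow> L \<subseteq> K \<Longrightarrow> clique E L"
  by (auto simp: clique_def)

lemma finite_cliques [simp]: "finite S \<Longrightarrow> finite (cliques E j S)"
  by (rule finite_subset[of _ "Pow S"]) (auto simp: cliques_def)

lemma nc_mono: "finite T \<Longrightarrow> S \<subseteq> T \<Longrightarrow> nc E j S \<le> nc E j T"
  unfolding nc_def by (intro card_mono) (auto simp: cliques_def)

lemma cliques_0: "finite S \<Longrightarrow> cliques E 0 S = {{}}"
  by (auto simp: cliques_def clique_def dest: finite_subset)

lemma nc_0: "finite S \<Longrightarrow> nc E 0 S = 1"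
  by (simp add: nc_def cliques_0)

lemma nc_1: "nc E (Suc 0) S = card S"
proof -
  have "cliques E (Suc 0) S = (\<lambda>x. {x}) ` S"
    by (auto simp: cliques_def clique_def card_Suc_eq)
  then show ?thesis by (simp add: nc_def card_image)
qed

lemma nc_empty: "nc E (Suc j) {} = 0"
proof -
  have "cliques E (Suc j) {} = {}" by (auto simp: cliques_def)
  then show ?thesis by (simp add: nc_def)
qed

text \<open>Graphs are handled as symmetric irreflexive relations.\<close>

locale graph_rel =
  fixes E :: "'a \<Rightarrow> 'a \<Rightarrow> bool"
  assumes sym: "E x y \<Longrightarrow> E y x" and irr: "\<not> E x x"
begin

lemma clique_insert:
  "v \<notin> K \<Longrightarrow> clique E (insert v K) \<longleftrightarrow> clique E K \<and> (\<forall>x\<in>K. E v x)"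
  unfolding clique_def by (auto intro: sym)

lemma card_cliques_containing:
  assumes "finite S" "v \<in> S"
  shows "card {K \<in> cliques E (Suc j) S. v \<in> K} = nc E j (nb E S v)"
proof -
  have "bij_betw (insert v) (cliques E j (nb E S v)) {K \<in> cliques E (Suc j) S. v \<in> K}"
  proof (rule bij_betwI[where g = "\<lambda>K. K - {v}"])
    show "insert v \<in> cliques E j (nb E S v) \<rightarrow> {K \<in> cliques E (Suc j) S. v \<in> K}"
    proof
      fix K assume K: "K \<in> cliques E j (nb E S v)"
      then have "v \<notin> K" using irr by (auto simp: cliques_def)
      moreover have "finite K" using K assms by (auto simp: cliques_def dest: finite_subset)
      ultimately show "insert v K \<in> {K \<in> cliques E (Suc j) S. v \<in> K}"
        using K assms by (auto simp: cliques_def clique_insert)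
    qed
    show "(\<lambda>K. K - {v}) \<in> {K \<in> cliques E (Suc j) S. v \<in> K} \<rightarrow> cliques E j (nb E S v)"
    proof
      fix K assume K: "K \<in> {K \<in> cliques E (Suc j) S. v \<in> K}"
      then have "finite K" using assms by (auto simp: cliques_def dest: finite_subset)
      then show "K - {v} \<in> cliques E j (nb E S v)"
        using K by (fastforce simp: cliques_def clique_def)
    qed
    show "insert v K - {v} = K" if "K \<in> cliques E j (nb E S v)" for K
      using that irr by (auto simp: cliques_def)
    show "insert v (K - {v}) = K" if "K \<in> {K \<in> cliques E (Suc j) S. v \<in> K}" for K
      using that by auto
  qed
  then show ?thesis by (simp add: nc_def bij_betw_same_card)
qed

text \<open>Double counting of the pairs of a clique and a vertex in it. It turns bounds on links
  into bounds on global clique counts.\<close>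

lemma nc_handshake:
  assumes "finite S"
  shows "Suc j * nc E (Suc j) S = (\<Sum>v\<in>S. nc E j (nb E S v))"
proof -
  have "(\<Sum>v\<in>S. nc E j (nb E S v)) = (\<Sum>v\<in>S. card {K \<in> cliques E (Suc j) S. v \<in> K})"
    using assms by (intro sum.cong refl) (simp add: card_cliques_containing)
  also have "\<dots> = (\<Sum>v\<in>S. \<Sum>K\<in>cliques E (Suc j) S. if v \<in> K then 1 else 0)"
    using assms by (intro sum.cong refl) (simp add: sum.If_cases Int_def)
  also have "\<dots> = (\<Sum>K\<in>cliques E (Suc j) S. \<Sum>v\<in>S. if v \<in> K then 1 else 0)"
    by (rule sum.swap)
  also have "\<dots> = (\<Sum>K\<in>cliques E (Suc j) S. Suc j)"
  proof (intro sum.cong refl)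
    fix K assume "K \<in> cliques E (Suc j) S"
    then have "K \<subseteq> S" "card K = Suc j" by (auto simp: cliques_def)
    moreover from this have "{x \<in> S. x \<in> K} = K" by auto
    ultimately show "(\<Sum>v\<in>S. if v \<in> K then 1 else 0) = Suc j"
      using assms by (simp add: sum.If_cases Int_def)
  qed
  also have "\<dots> = Suc j * nc E (Suc j) S" by (simp add: nc_def)
  finally show ?thesis ..
qed

lemma nc_insert:
  assumes "finite S" "v \<notin> S"
  shows "nc E (Suc j) (insert v S) = nc E (Suc j) S + nc E j (nb E S v)"
proof -
  let ?A = "{K \<in> cliques E (Suc j) (insert v S). v \<in> K}"
  have eq: "cliques E (Suc j) (insert v S) = ?A \<union> cliques E (Suc j) S"
    by (auto simp: cliques_def)
  have dis: "?A \<inter> cliques E (Suc j) S = {}" using assms by (auto simp: cliques_def)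
  have nbeq: "nb E (insert v S) v = nb E S v" using irr by auto
  have "nc E (Suc j) (insert v S) = card ?A + nc E (Suc j) S"
    unfolding nc_def by (subst eq, subst card_Un_disjoint) (use assms dis in auto)
  then show ?thesis
    using card_cliques_containing[of "insert v S" v j] assms by (simp add: nbeq)
qed

lemma two_nc_2: "finite S \<Longrightarrow> 2 * nc E 2 S = (\<Sum>v\<in>S. card (nb E S v))"
  using nc_handshake[of S "Suc 0"] by (simp add: numeral_2_eq_2 nc_1)

lemma three_nc_3: "finite S \<Longrightarrow> 3 * nc E 3 S = (\<Sum>v\<in>S. nc E 2 (nb E S v))"
  using nc_handshake[of S 2] by (simp add: numeral_3_eq_3 numeral_2_eq_2)

lemma nc_2_insert: "finite S \<Longrightarrow> v \<notin> S \<Longrightarrow> nc E 2 (insert v S) = nc E 2 S + card (nb E S v)"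
  using nc_insert[of S v "Suc 0"] by (simp add: numeral_2_eq_2 nc_1)

lemma nc_3_insert: "finite S \<Longrightarrow> v \<notin> S \<Longrightarrow> nc E 3 (insert v S) = nc E 3 S + nc E 2 (nb E S v)"
  using nc_insert[of S v 2] by (simp add: numeral_2_eq_2 numeral_3_eq_3)

lemma nc_2_union:
  assumes "finite A" "finite B" "A \<inter> B = {}"
  shows "nc E 2 (A \<union> B) = nc E 2 A + nc E 2 B + (\<Sum>a\<in>A. card (nb E B a))"
  using assms(1,3)
proof (induction A)
  case empty
  then show ?case by (simp add: numeral_2_eq_2 nc_empty)
next
  case (insert v A)
  have "nb E (A \<union> B) v = nb E A v \<union> nb E B v" by auto
  moreover have "nb E A v \<inter> nb E B v = {}" using insert.prems by auto
  ultimately have "card (nb E (A \<union> B) v) = card (nb E A v) + card (nb E B v)"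
    using insert.hyps assms by (simp add: card_Un_disjoint)
  moreover have "nc E 2 (insert v (A \<union> B)) = nc E 2 (A \<union> B) + card (nb E (A \<union> B) v)"
    using insert assms by (intro nc_2_insert) auto
  ultimately show ?case
    using insert by (simp add: nc_2_insert)
qed

lemma nc_2_le_union:
  assumes "finite A" "finite B"
  shows "nc E 2 (A \<union> B) \<le> nc E 2 A + card B * card (A \<union> B)"
  using assms(2)
proof (induction B)
  case empty
  then show ?case by simp
next
  case (insert v B)
  show ?case
  proof (cases "v \<in> A \<union> B")
    case True
    then have "A \<union> insert v B = A \<union> B" by auto
    moreover have "card B * card (A \<union> B) \<le> card (insert v B) * card (A \<union> B)"
      using insert by (intro mult_le_mono1 card_mono) auto
    ultimately show ?thesis using insert.IH by (simp only:)
  next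
    case False
    have "nc E 2 (insert v (A \<union> B)) = nc E 2 (A \<union> B) + card (nb E (A \<union> B) v)"
      using insert assms False by (intro nc_2_insert) auto
    also have "card (nb E (A \<union> B) v) \<le> card (A \<union> insert v B)"
      using insert assms by (intro card_mono) auto
    also have "nc E 2 (A \<union> B) \<le> nc E 2 A + card B * card (A \<union> insert v B)"
    proof -
      have "card (A \<union> B) \<le> card (A \<union> insert v B)"
        using insert assms by (intro card_mono) auto
      then show ?thesis using insert.IH by (meson add_left_mono le_trans mult_le_mono2)
    qed
    finally show ?thesis using insert by simp
  qed
qed

lemma nc_2_Diff_ge:
  assumes "finite S" "finite R"
  shows "nc E 2 S \<le> nc E 2 (S - R) + card R * card S"
proof -
  have "nc E 2 S = nc E 2 ((S - R) \<union> (S \<inter> R))" by (simp add: Un_Diff_Int)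
  also have "\<dots> \<le> nc E 2 (S - R) + card (S \<inter> R) * card ((S - R) \<union> (S \<inter> R))"
    using assms by (intro nc_2_le_union) auto
  also have "\<dots> \<le> nc E 2 (S - R) + card R * card S"
    using assms by (intro add_left_mono mult_le_mono card_mono) auto
  finally show ?thesis .
qed

lemma nc_2_le_square:
  assumes "finite S" shows "nc E 2 S \<le> card S * card S"
  using nc_2_Diff_ge[of S S] assms by (simp add: numeral_2_eq_2 nc_empty)

text \<open>The worst case is a complete \<open>B\<close> joined completely to \<open>R\<close>.
  Adding a vertex of \<open>B\<close> splits the cliques by whether they contain it, and Pascal's
  rule recombines the two sums.\<close>

lemma nc_join_le:
  assumes "finite B" "finite R"
  shows "nc E r (B \<union> R) \<le> (\<Sum>j\<le>r. (card B choose j) * nc E (r - j) R)"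
  using assms(1)
proof (induction B arbitrary: r)
  case empty
  show ?case
    by (simp add: sum.remove[of "{..r}" 0])
next
  case (insert v B)
  show ?case
  proof (cases "v \<in> R")
    case True
    then have "nc E r (insert v B \<union> R) = nc E r (B \<union> R)" by (simp add: insert_absorb)
    also have "\<dots> \<le> (\<Sum>j\<le>r. (card B choose j) * nc E (r - j) R)" by (rule insert.IH)
    also have "\<dots> \<le> (\<Sum>j\<le>r. (card (insert v B) choose j) * nc E (r - j) R)"
      using insert by (intro sum_mono mult_le_mono1 binomial_right_mono) auto
    finally show ?thesis .
  next
    case False
    show ?thesis
    proof (cases r)
      case 0
      then show ?thesis using insert assms by (simp add: nc_0)
    next
      case (Suc q)
      have "nc E r (insert v B \<union> R) = nc E (Suc q) (B \<union> R) + nc E q (nb E (B \<union> R) v)"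
        using insert assms False Suc nc_insert[of "B \<union> R" v q] by simp
      also have "\<dots> \<le> nc E (Suc q) (B \<union> R) + nc E q (B \<union> R)"
        using insert assms by (intro add_left_mono nc_mono) (auto simp: nb_def)
      also have "\<dots> \<le> (\<Sum>j\<le>Suc q. (card B choose j) * nc E (Suc q - j) R)
          + (\<Sum>j\<le>q. (card B choose j) * nc E (q - j) R)"
        by (intro add_mono insert.IH)
      also have "\<dots> = (\<Sum>j\<le>Suc q. (card (insert v B) choose j) * nc E (Suc q - j) R)"
        using insert by (simp add: sum.atMost_Suc_shift sum.distrib algebra_simps del: sum.atMost_Suc)
      finally show ?thesis using Suc by simp
    qed
  qed
qed

text \<open>Here every new vertex is adjacent to everything else, so the recursion of
  \<open>nc_join_le\<close> loses nothing. The extremal graph has this form.\<close>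

lemma nc_join_eq:
  assumes "finite B" "finite R" "B \<inter> R = {}"
    and "\<And>x y. x \<in> B \<Longrightarrow> y \<in> B \<union> R \<Longrightarrow> x \<noteq> y \<Longrightarrow> E x y"
  shows "nc E r (B \<union> R) = (\<Sum>j\<le>r. (card B choose j) * nc E (r - j) R)"
  using assms(1,3,4)
proof (induction B arbitrary: r)
  case empty
  show ?case
    by (simp add: sum.remove[of "{..r}" 0])
next
  case (insert v B)
  have IH: "nc E r (B \<union> R) = (\<Sum>j\<le>r. (card B choose j) * nc E (r - j) R)" for r
    using insert by auto
  have nbv: "nb E (B \<union> R) v = B \<union> R"
    using insert.prems insert.hyps by (fastforce simp: nb_def)
  show ?case
  proof (cases r)
    case 0
    then show ?thesis using insert assms by (simp add: nc_0)
  next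
    case (Suc q)
    have "nc E r (insert v B \<union> R) = nc E (Suc q) (B \<union> R) + nc E q (B \<union> R)"
      using insert assms Suc nc_insert[of "B \<union> R" v q] by (simp add: nbv)
    also have "\<dots> = (\<Sum>j\<le>Suc q. (card B choose j) * nc E (Suc q - j) R)
          + (\<Sum>j\<le>q. (card B choose j) * nc E (q - j) R)"
      by (simp only: IH)
    also have "\<dots> = (\<Sum>j\<le>Suc q. (card (insert v B) choose j) * nc E (Suc q - j) R)"
      using insert by (simp add: sum.atMost_Suc_shift sum.distrib algebra_simps del: sum.atMost_Suc)
    finally show ?thesis using Suc by simp
  qed
qed

end

subsection \<open>Embedding theta graphs\<close>

lemma inj_on_insert_upd:
  "inj_on f W \<Longrightarrow> c \<notin> f ` W \<Longrightarrow> w \<notin> W \<Longrightarrow> inj_on (f(w := c)) (insert w W)"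
  by (auto simp: inj_on_def)

text \<open>Greedy choice: fewer than \<open>card W1 + card W2\<close> values are taken when a
  vertex of \<open>W2\<close> is placed, so one of its candidates is free. The embeddings into
  bipartite patterns fix a few vertices \<open>W1\<close> by hand and place the rest this
  way.\<close>

lemma distinct_extension:
  fixes g :: "'b \<Rightarrow> 'a"
  assumes "finite W1" "inj_on g W1" "finite W2" "W1 \<inter> W2 = {}"
    and "\<And>u. u \<in> W2 \<Longrightarrow> card W1 + card W2 \<le> card (A u)"
  obtains f where "inj_on f (W1 \<union> W2)" "\<And>u. u \<in> W1 \<Longrightarrow> f u = g u" "\<And>u. u \<in> W2 \<Longrightarrow> f u \<in> A u"
proof -
  have "\<exists>f. inj_on f (W1 \<union> W2) \<and> (\<forall>u\<in>W1. f u = g u) \<and> (\<forall>u\<in>W2. f u \<in> A u)"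
    using assms(3-5)
  proof (induction W2)
    case empty
    then show ?case using assms by auto
  next
    case (insert w W2)
    have "card W1 + card W2 \<le> card (A u)" if "u \<in> W2" for u
      using insert.prems(2)[of u] that insert.hyps by simp
    then obtain f where f: "inj_on f (W1 \<union> W2)" "\<forall>u\<in>W1. f u = g u" "\<forall>u\<in>W2. f u \<in> A u"
      using insert.IH insert.prems by auto
    have "card (f ` (W1 \<union> W2)) \<le> card W1 + card W2"
      by (meson assms(1) insert.hyps(1) card_Un_le card_image_le finite_UnI le_trans)
    also have "\<dots> < card (A w)" using insert.prems(2)[of w] insert.hyps by simp
    finally have "\<not> A w \<subseteq> f ` (W1 \<union> W2)"
      using assms(1) insert.hyps(1) by (meson card_mono finite_UnI finite_imageI leD)
    then obtain c where c: "c \<in> A w" "c \<notin> f ` (W1 \<union> W2)" by auto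
    have w: "w \<notin> W1 \<union> W2" using insert by auto
    have "inj_on (f(w := c)) (insert w (W1 \<union> W2))"
      by (rule inj_on_insert_upd) (use f(1) c w in auto)
    moreover have "\<forall>u\<in>W1. (f(w := c)) u = g u" using f w by auto
    moreover have "\<forall>u\<in>insert w W2. (f(w := c)) u \<in> A u" using f c by auto
    ultimately have "inj_on (f(w := c)) (W1 \<union> insert w W2) \<and> (\<forall>u\<in>W1. (f(w := c)) u = g u)
        \<and> (\<forall>u\<in>insert w W2. (f(w := c)) u \<in> A u)"
      by (metis Un_insert_right)
    then show ?case by blast
  qed
  then show thesis using that by blast
qed

text \<open>A parent map along which \<open>rk\<close> decreases describes a tree rooted at
  \<open>r0\<close>. Each vertex is placed next to the image of its parent; fewer than
  \<open>card W\<close> vertices are occupied, so a neighbour is free.\<close>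

lemma tree_embedding:
  fixes rk :: "'b \<Rightarrow> nat" and par :: "'b \<Rightarrow> 'b" and S :: "'a set"
  assumes "finite S" "S \<noteq> {}" "finite W" "r0 \<in> W"
    and par: "\<And>u. u \<in> W \<Longrightarrow> u \<noteq> r0 \<Longrightarrow> par u \<in> W \<and> rk (par u) < rk u"
    and deg: "\<And>v. v \<in> S \<Longrightarrow> card W \<le> card (nb E S v)"
  shows "\<exists>f. inj_on f W \<and> f ` W \<subseteq> S \<and> (\<forall>u\<in>W. u \<noteq> r0 \<longrightarrow> E (f (par u)) (f u))"
  using assms(3-)
proof (induction "card W" arbitrary: W)
  case 0
  then show ?case by auto
next
  case (Suc n)
  show ?case
  proof (cases "W = {r0}")
    case True
    obtain s where "s \<in> S" using assms by auto
    with True show ?thesis by (intro exI[of _ "\<lambda>_. s"]) auto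
  next
    case False
    then have "finite (W - {r0})" "W - {r0} \<noteq> {}" using Suc by auto
    \<comment> \<open>A non-root vertex of maximal rank is a leaf, so the parent map still acts on
      the remaining vertices.\<close>
    then obtain w where w: "w \<in> W - {r0}" "\<And>u. u \<in> W - {r0} \<Longrightarrow> rk u \<le> rk w"
      using Max_in[of "rk ` (W - {r0})"] Max_ge[of "rk ` (W - {r0})"] by fastforce
    let ?W = "W - {w}"
    have "\<exists>f. inj_on f ?W \<and> f ` ?W \<subseteq> S \<and> (\<forall>u\<in>?W. u \<noteq> r0 \<longrightarrow> E (f (par u)) (f u))"
    proof (rule Suc.hyps(1))
      show "n = card ?W" using Suc w by simp
      show "finite ?W" using Suc by simp
      show "r0 \<in> ?W" using Suc w by auto
      show "par u \<in> ?W \<and> rk (par u) < rk u" if "u \<in> ?W" "u \<noteq> r0" for u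
        using Suc.prems(3)[of u] w(2)[of u] that by auto
      show "card ?W \<le> card (nb E S v)" if "v \<in> S" for v
        using Suc.prems(4)[OF that] by (meson Suc.prems(1) Diff_subset card_mono le_trans)
    qed
    then obtain f where f: "inj_on f ?W" "f ` ?W \<subseteq> S" "\<forall>u\<in>?W. u \<noteq> r0 \<longrightarrow> E (f (par u)) (f u)"
      by blast
    have pw: "par w \<in> ?W" using Suc.prems(3)[of w] w by auto
    have "card (f ` ?W) < card W"
      using Suc.prems(1) w by (metis Diff_iff card_Diff1_less card_image f(1))
    also have "\<dots> \<le> card (nb E S (f (par w)))" using Suc.prems(4) f(2) pw by blast
    finally have "\<not> nb E S (f (par w)) \<subseteq> f ` ?W"
      using Suc.prems(1) by (meson card_mono finite_Diff finite_imageI leD)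
    then obtain c where "c \<in> nb E S (f (par w))" "c \<notin> f ` ?W" by blast
    then have c: "c \<in> S" "E (f (par w)) c" "c \<notin> f ` ?W" by auto
    have "inj_on (f(w := c)) (insert w ?W)"
      by (rule inj_on_insert_upd) (use f(1) c in auto)
    moreover have "insert w ?W = W" using w by auto
    moreover have "(f(w := c)) ` W \<subseteq> S" using f(2) c by auto
    moreover have "E ((f(w := c)) (par u)) ((f(w := c)) u)" if "u \<in> W" "u \<noteq> r0" for u
    proof (cases "u = w")
      case True then show ?thesis using c pw by auto
    next
      case False
      have "par u \<noteq> w" using Suc.prems(3)[OF that] w(2)[of u] that False by auto
      then show ?thesis using f(3) that False by auto
    qed
    ultimately show ?thesis by (intro exI[of _ "f(w := c)"]) simp
  qed
qed

text \<open>Copies are handled as injective homomorphisms from the standard theta graph;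
  \<open>F\<close> itself and the notion of subgraph return only in the final transfer.\<close>

definition theta_emb :: "nat list \<Rightarrow> ('a \<Rightarrow> 'a \<Rightarrow> bool) \<Rightarrow> 'a set \<Rightarrow> (theta_vertex \<Rightarrow> 'a) \<Rightarrow> bool" where
  "theta_emb ps E S f \<longleftrightarrow> inj_on f (verts (theta_graph ps)) \<and> f ` verts (theta_graph ps) \<subseteq> S \<and>
     (\<forall>u v. {u, v} \<in> edges (theta_graph ps) \<longrightarrow> E (f u) (f v))"

definition theta_free :: "nat list \<Rightarrow> ('a \<Rightarrow> 'a \<Rightarrow> bool) \<Rightarrow> 'a set \<Rightarrow> bool" where
  "theta_free ps E S \<longleftrightarrow> (\<nexists>f. theta_emb ps E S f)"

lemma theta_emb_mono: "theta_emb ps E S f \<Longrightarrow> S \<subseteq> T \<Longrightarrow> theta_emb ps E T f"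
  by (auto simp: theta_emb_def)

lemma theta_free_mono: "theta_free ps E T \<Longrightarrow> S \<subseteq> T \<Longrightarrow> theta_free ps E S"
  using theta_emb_mono[of ps E] unfolding theta_free_def by blast

locale theta =
  fixes ps :: "nat list"
  assumes lengths: "theta_lengths ps"
begin

abbreviation "VT \<equiv> verts (theta_graph ps)"
abbreviation "ET \<equiv> edges (theta_graph ps)"
definition h :: nat where "h = card VT"

lemma two_paths: "2 \<le> length ps"
  using lengths by (simp add: theta_lengths_def)

lemma path_pos: "i < length ps \<Longrightarrow> 1 \<le> ps ! i"
  using lengths nth_mem[of i ps] unfolding theta_lengths_def by blast

lemma path_in: "i < length ps \<Longrightarrow> j \<le> ps ! i \<Longrightarrow> theta_path ps i j \<in> VT"
  by (auto simp: theta_graph_def)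

lemma VT_eq: "VT = {Source, Sink} \<union> {Inner i j | i j. i < length ps \<and> 0 < j \<and> j < ps ! i}"
proof
  show "VT \<subseteq> {Source, Sink} \<union> {Inner i j | i j. i < length ps \<and> 0 < j \<and> j < ps ! i}"
    by (auto simp: theta_graph_def theta_path_def)
  have 0: "0 < length ps" using two_paths by linarith
  then have "theta_path ps 0 0 = Source" "theta_path ps 0 (ps ! 0) = Sink"
    using path_pos[of 0] by (auto simp: theta_path_def)
  then have "Source \<in> VT" "Sink \<in> VT" using path_in[OF 0] by (metis order_refl zero_le)+
  moreover have "Inner i j \<in> VT" if "i < length ps" "0 < j" "j < ps ! i" for i j
    using path_in[of i j] that by (simp add: theta_path_def)
  ultimately show "{Source, Sink} \<union> {Inner i j | i j. i < length ps \<and> 0 < j \<and> j < ps ! i} \<subseteq> VT"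
    by auto
qed

lemma Source_in [simp]: "Source \<in> VT" and Sink_in [simp]: "Sink \<in> VT"
  and Inner_in: "Inner i j \<in> VT \<longleftrightarrow> i < length ps \<and> 0 < j \<and> j < ps ! i"
  by (auto simp: VT_eq)

lemma finite_VT [simp]: "finite VT"
proof -
  have "VT = (\<Union>i<length ps. \<Union>j\<le>ps ! i. {theta_path ps i j})"
    by (auto simp: theta_graph_def)
  then show ?thesis by simp
qed

lemma h_ge_2: "2 \<le> h"
proof -
  have "card {Source, Sink} \<le> card VT" by (intro card_mono) auto
  then show ?thesis by (simp add: h_def)
qed

lemma edge_cases:
  assumes "{u, v} \<in> ET"
  obtains i j where "i < length ps" "j < ps ! i"
    "u = theta_path ps i j \<and> v = theta_path ps i (Suc j) \<or> v = theta_path ps i j \<and> u = theta_path ps i (Suc j)"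
  using assms by (auto simp: theta_graph_def doubleton_eq_iff)

lemma edge_in: "i < length ps \<Longrightarrow> j < ps ! i \<Longrightarrow> {theta_path ps i j, theta_path ps i (Suc j)} \<in> ET"
  by (auto simp: theta_graph_def)

lemma edge_verts: "{u, v} \<in> ET \<Longrightarrow> u \<in> VT \<and> v \<in> VT"
  by (erule edge_cases) (auto intro: path_in)

lemma path_eq_iff:
  assumes "i < length ps" "j \<le> ps ! i" "j' \<le> ps ! i"
  shows "theta_path ps i j = theta_path ps i j' \<longleftrightarrow> j = j'"
  using assms path_pos[of i] by (auto simp: theta_path_def)

end

locale theta_graph_rel = theta ps + graph_rel E
  for ps and E :: "'a \<Rightarrow> 'a \<Rightarrow> bool"
begin

lemma theta_embI:
  assumes "inj_on f VT" "f ` VT \<subseteq> S"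
    and "\<And>i j. i < length ps \<Longrightarrow> j < ps ! i \<Longrightarrow> E (f (theta_path ps i j)) (f (theta_path ps i (Suc j)))"
  shows "theta_emb ps E S f"
  unfolding theta_emb_def using assms by (auto elim!: edge_cases intro: sym)

text \<open>The tree is rooted at \<open>Sink\<close>, the parent of an inner vertex being the next
  vertex of its path. It is embedded into \<open>S\<close>; as \<open>x\<close> is adjacent to all
  of \<open>S\<close>, it can serve as \<open>Source\<close> wherever the first vertices of the
  paths went.\<close>

lemma link_embedding:
  assumes "finite S" "S \<noteq> {}" "x \<in> V" "S \<subseteq> nb E V x"
    and deg: "\<And>v. v \<in> S \<Longrightarrow> h \<le> card (nb E S v)"
  shows "\<exists>f. theta_emb ps E (insert x S) f"
proof -
  define par where "par u = (case u of Inner i j \<Rightarrow> theta_path ps i (Suc j) | _ \<Rightarrow> Sink)" for u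
  define rk where "rk u = (case u of Inner i j \<Rightarrow> ps ! i - j | _ \<Rightarrow> 0)" for u
  let ?W = "VT - {Source}"
  have "\<exists>f. inj_on f ?W \<and> f ` ?W \<subseteq> S \<and> (\<forall>u\<in>?W. u \<noteq> Sink \<longrightarrow> E (f (par u)) (f u))"
  proof (rule tree_embedding[where rk = rk])
    show "par u \<in> ?W \<and> rk (par u) < rk u" if u: "u \<in> ?W" "u \<noteq> Sink" for u
    proof -
      obtain i j where ij: "u = Inner i j" "i < length ps" "0 < j" "j < ps ! i"
        using u by (auto simp: VT_eq)
      then have "theta_path ps i (Suc j) \<in> VT" by (intro path_in) auto
      then show ?thesis using ij by (auto simp: par_def rk_def theta_path_def)
    qed
    show "card ?W \<le> card (nb E S v)" if "v \<in> S" for v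
      using deg[OF that] card_mono[of VT ?W] by (auto simp: h_def)
  qed (use assms in auto)
  then obtain f where f: "inj_on f ?W" "f ` ?W \<subseteq> S" "\<forall>u\<in>?W. u \<noteq> Sink \<longrightarrow> E (f (par u)) (f u)"
    by blast
  have xS: "x \<notin> S" using assms(4) irr by auto
  let ?f = "f(Source := x)"
  have "theta_emb ps E (insert x S) ?f"
  proof (rule theta_embI)
    have "inj_on ?f (insert Source ?W)"
      by (rule inj_on_insert_upd) (use f(1,2) xS in auto)
    moreover have "insert Source ?W = VT" by auto
    ultimately show "inj_on ?f VT" by simp
    show "?f ` VT \<subseteq> insert x S" using f(2) by auto
    fix i j assume ij: "i < length ps" "j < ps ! i"
    have ns: "theta_path ps i (Suc j) \<in> ?W"
      using ij path_in[of i "Suc j"] by (auto simp: theta_path_def)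
    show "E (?f (theta_path ps i j)) (?f (theta_path ps i (Suc j)))"
    proof (cases "j = 0")
      case True
      have "f (theta_path ps i (Suc j)) \<in> S" using ns f(2) by blast
      then show ?thesis using True assms(4) ns by (auto simp: theta_path_def)
    next
      case False
      then have e: "theta_path ps i j = Inner i j" "Inner i j \<in> ?W"
        using ij by (auto simp: theta_path_def VT_eq)
      have "E (f (par (Inner i j))) (f (Inner i j))" using f(3) e by auto
      then show ?thesis using e ns by (auto simp: par_def intro: sym)
    qed
  qed
  then show ?thesis by blast
qed

text \<open>The theta graph without its source is a tree, so links in theta-free graphs are degenerate.\<close>

lemma link_low_degree:
  assumes "finite V" "theta_free ps E V" "x \<in> V" "S \<subseteq> nb E V x" "S \<noteq> {}"
  shows "\<exists>v\<in>S. card (nb E S v) < h"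
proof (rule ccontr)
  assume "\<not> ?thesis"
  moreover have "finite S" using assms by (meson finite_nb finite_subset)
  ultimately obtain f where "theta_emb ps E (insert x S) f"
    using link_embedding[of S x V] assms by (auto simp: not_less)
  moreover have "insert x S \<subseteq> V" using assms nb_subset by auto
  ultimately show False using assms(2) theta_emb_mono[of ps E] unfolding theta_free_def by blast
qed

text \<open>Repeated removal of a vertex of degree below \<open>h\<close> destroys fewer than
  \<open>h\<close> edges per vertex.\<close>

lemma link_edges:
  assumes "finite V" "theta_free ps E V" "x \<in> V" "S \<subseteq> nb E V x"
  shows "nc E 2 S \<le> h * card S"
proof -
  have "finite S" using assms by (meson finite_nb finite_subset)
  then show ?thesis using assms(4)
  proof (induction "card S" arbitrary: S)
    case 0
    then show ?case by (simp add: numeral_2_eq_2 nc_empty)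
  next
    case (Suc n)
    have "S \<noteq> {}" using Suc.hyps(2) by auto
    then have "\<exists>v\<in>S. card (nb E S v) < h"
      using link_low_degree assms(1-3) Suc.prems by blast
    then obtain v where v: "v \<in> S" "card (nb E S v) < h" by auto
    have S: "insert v (S - {v}) = S" using v by auto
    have "nc E 2 S = nc E 2 (S - {v}) + card (nb E (S - {v}) v)"
      using nc_2_insert[of "S - {v}" v] Suc.prems(1) unfolding S by simp
    moreover have "nc E 2 (S - {v}) \<le> h * card (S - {v})"
      using Suc v by (intro Suc.hyps(1)) auto
    moreover have "card (nb E (S - {v}) v) \<le> card (nb E S v)"
      using Suc by (intro card_mono) auto
    ultimately have "nc E 2 S \<le> h * card (S - {v}) + h" using v by linarith
    moreover have "card S = Suc (card (S - {v}))" using Suc v by (metis card_Suc_Diff1)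
    ultimately show ?case by simp
  qed
qed

text \<open>The vertex removed in each round has fewer than \<open>h\<close> neighbours left, hence
  lies in at most \<open>2 ^ h\<close> cliques; if it lies in any, it has an edge, so the removed
  edges pay for them.\<close>

lemma link_cliques:
  assumes "finite V" "theta_free ps E V" "x \<in> V" "S \<subseteq> nb E V x"
  shows "nc E (Suc (Suc j)) S \<le> 2 ^ h * nc E 2 S"
proof -
  have "finite S" using assms by (meson finite_nb finite_subset)
  then show ?thesis using assms(4)
  proof (induction "card S" arbitrary: S)
    case 0
    then show ?case by (simp add: numeral_2_eq_2 nc_empty)
  next
    case (Suc n)
    have "S \<noteq> {}" using Suc.hyps(2) by auto
    then have "\<exists>v\<in>S. card (nb E S v) < h"
      using link_low_degree assms(1-3) Suc.prems by blast
    then obtain v where v: "v \<in> S" "card (nb E S v) < h" by auto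
    let ?S = "S - {v}" let ?N = "nb E ?S v"
    have fin: "finite S" using Suc by simp
    have IH: "nc E (Suc (Suc j)) ?S \<le> 2 ^ h * nc E 2 ?S"
      using Suc v by (intro Suc.hyps(1)) auto
    have S: "insert v ?S = S" using v by auto
    have 1: "nc E (Suc (Suc j)) S = nc E (Suc (Suc j)) ?S + nc E (Suc j) ?N"
      using nc_insert[of ?S v "Suc j"] fin unfolding S by simp
    have 2: "nc E 2 S = nc E 2 ?S + card ?N"
      using nc_2_insert[of ?S v] fin unfolding S by simp
    have "nc E (Suc j) ?N \<le> 2 ^ h * card ?N"
    proof (cases "?N = {}")
      case True
      then show ?thesis by (simp add: nc_empty)
    next
      case False
      have "nc E (Suc j) ?N \<le> card (Pow ?N)"
        unfolding nc_def using fin by (intro card_mono) (auto simp: cliques_def)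
      also have "\<dots> = 2 ^ card ?N" using fin by (simp add: card_Pow)
      also have "\<dots> \<le> 2 ^ h"
      proof -
        have "card ?N \<le> card (nb E S v)" using fin by (intro card_mono) auto
        then show ?thesis using v by (intro power_increasing) auto
      qed
      also have "\<dots> \<le> 2 ^ h * card ?N" using False fin by (simp add: Suc_le_eq card_gt_0_iff)
      finally show ?thesis .
    qed
    then show ?case using IH by (simp add: 1 2 algebra_simps)
  qed
qed

text \<open>Summation of \<open>link_cliques\<close> over all vertices. The factor 3 comes from
  counting a triangle at each of its vertices; the clique size on the other side is dropped.\<close>

lemma cliques_le_triangles:
  assumes "finite V" "theta_free ps E V"
  shows "nc E (j + 3) V \<le> 3 * 2 ^ h * nc E 3 V"
proof -
  have "nc E (j + 3) V \<le> Suc (j + 2) * nc E (Suc (j + 2)) V"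
    by (simp add: numeral_3_eq_3 numeral_2_eq_2)
  also have "\<dots> = (\<Sum>v\<in>V. nc E (j + 2) (nb E V v))" by (rule nc_handshake) fact
  also have "\<dots> \<le> (\<Sum>v\<in>V. 2 ^ h * nc E 2 (nb E V v))"
    using link_cliques[OF assms, of _ _ j] by (intro sum_mono) (simp add: numeral_2_eq_2)
  also have "\<dots> = 3 * 2 ^ h * nc E 3 V"
    using three_nc_3[OF assms(1)] by (simp flip: sum_distrib_left)
  finally show ?thesis .
qed

end

subsection \<open>The regularity lemma\<close>

text \<open>Conditional expectation of \<open>f\<close> given the label, for the uniform
  distribution on \<open>\<Omega>\<close>.\<close>

definition avg :: "('b \<Rightarrow> 'c) \<Rightarrow> 'b set \<Rightarrow> ('b \<Rightarrow> real) \<Rightarrow> 'b \<Rightarrow> real" where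
  "avg l \<Omega> f p = (\<Sum>q | q \<in> \<Omega> \<and> l q = l p. f q) / card {q \<in> \<Omega>. l q = l p}"

lemma avg_cong_label: "l p = l q \<Longrightarrow> avg l \<Omega> f p = avg l \<Omega> f q"
  by (simp add: avg_def)

text \<open>The projection property of conditional expectation: on each class \<open>g\<close> is a
  constant, and \<open>f\<close> and its average have the same sum.\<close>

lemma sum_avg_mult:
  assumes "finite \<Omega>" and g: "\<And>p q. p \<in> \<Omega> \<Longrightarrow> q \<in> \<Omega> \<Longrightarrow> l p = l q \<Longrightarrow> g p = g q"
  shows "(\<Sum>p\<in>\<Omega>. avg l \<Omega> f p * g p) = (\<Sum>p\<in>\<Omega>. f p * g p)"
proof -
  have classes: "(\<Sum>p | p \<in> \<Omega> \<and> l p = b. avg l \<Omega> f p * g p) = (\<Sum>p | p \<in> \<Omega> \<and> l p = b. f p * g p)"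
    if b: "b \<in> l ` \<Omega>" for b
  proof -
    obtain p0 where p0: "p0 \<in> \<Omega>" "l p0 = b" using b by auto
    let ?C = "{p \<in> \<Omega>. l p = b}"
    have fin: "finite ?C" and ne: "card ?C \<noteq> 0" using assms(1) p0 by auto
    have g0: "g p = g p0" if "p \<in> ?C" for p using g[of p p0] that p0 by auto
    have "(\<Sum>p\<in>?C. avg l \<Omega> f p * g p) = (\<Sum>p\<in>?C. (\<Sum>q\<in>?C. f q) / card ?C * g p0)"
      by (intro sum.cong refl) (use g0 in \<open>auto simp: avg_def\<close>)
    also have "\<dots> = (\<Sum>q\<in>?C. f q) * g p0" using ne by simp
    also have "\<dots> = (\<Sum>q\<in>?C. f q * g q)"
      unfolding sum_distrib_right by (intro sum.cong refl) (use g0 in auto)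
    finally show ?thesis .
  qed
  have "(\<Sum>b\<in>l ` \<Omega>. \<Sum>p | p \<in> \<Omega> \<and> l p = b. avg l \<Omega> f p * g p)
      = (\<Sum>b\<in>l ` \<Omega>. \<Sum>p | p \<in> \<Omega> \<and> l p = b. f p * g p)"
    by (rule sum.cong[OF refl classes])
  moreover have "(\<Sum>b\<in>l ` \<Omega>. \<Sum>p | p \<in> \<Omega> \<and> l p = b. H p) = sum H \<Omega>" for H :: "'a \<Rightarrow> real"
    using assms(1) by (intro sum.group) auto
  ultimately show ?thesis by (simp only:)
qed

lemma sum_avg:
  assumes "finite \<Omega>"
  shows "(\<Sum>p\<in>\<Omega>. avg l \<Omega> f p) = (\<Sum>p\<in>\<Omega>. f p)"
  using sum_avg_mult[OF assms, of l "\<lambda>_. 1" f] by simp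

text \<open>Pythagoras: the coarse average is the orthogonal projection of the fine one.\<close>

lemma energy_refine:
  assumes "finite \<Omega>" and ref: "\<And>p q. p \<in> \<Omega> \<Longrightarrow> q \<in> \<Omega> \<Longrightarrow> l' p = l' q \<Longrightarrow> l p = l q"
  shows "(\<Sum>p\<in>\<Omega>. (avg l' \<Omega> f p)\<^sup>2) = (\<Sum>p\<in>\<Omega>. (avg l \<Omega> f p)\<^sup>2)
           + (\<Sum>p\<in>\<Omega>. (avg l' \<Omega> f p - avg l \<Omega> f p)\<^sup>2)"
proof -
  have "(\<Sum>p\<in>\<Omega>. avg l' \<Omega> f p * avg l \<Omega> f p) = (\<Sum>p\<in>\<Omega>. f p * avg l \<Omega> f p)"
    by (rule sum_avg_mult[OF assms(1)]) (rule avg_cong_label, rule ref)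
  also have "\<dots> = (\<Sum>p\<in>\<Omega>. avg l \<Omega> f p * avg l \<Omega> f p)"
    by (rule sum_avg_mult[symmetric, OF assms(1)]) (rule avg_cong_label)
  finally have 1: "(\<Sum>p\<in>\<Omega>. avg l' \<Omega> f p * avg l \<Omega> f p) = (\<Sum>p\<in>\<Omega>. (avg l \<Omega> f p)\<^sup>2)"
    by (simp add: power2_eq_square)
  have "(\<Sum>p\<in>\<Omega>. (avg l' \<Omega> f p - avg l \<Omega> f p)\<^sup>2) = (\<Sum>p\<in>\<Omega>. (avg l' \<Omega> f p)\<^sup>2)
      - 2 * (\<Sum>p\<in>\<Omega>. avg l' \<Omega> f p * avg l \<Omega> f p) + (\<Sum>p\<in>\<Omega>. (avg l \<Omega> f p)\<^sup>2)"
    unfolding power2_diff sum.distrib sum_subtractf by (simp add: sum_distrib_left algebra_simps)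
  then show ?thesis using 1 by simp
qed

text \<open>A finite family \<open>S\<close> of sets encodes the partition of \<open>V\<close> into the atoms of \<open>S\<close>.\<close>

definition trace :: "'a set set \<Rightarrow> 'a \<Rightarrow> 'a set set" where
  "trace S x = {A \<in> S. x \<in> A}"

definition atom :: "'a set set \<Rightarrow> 'a set \<Rightarrow> 'a \<Rightarrow> 'a set" where
  "atom S V x = {y \<in> V. trace S y = trace S x}"

definition label :: "'a set set \<Rightarrow> 'a \<times> 'a \<Rightarrow> 'a set set \<times> 'a set set" where
  "label S p = (trace S (fst p), trace S (snd p))"

definition ind :: "('a \<Rightarrow> 'a \<Rightarrow> bool) \<Rightarrow> 'a \<times> 'a \<Rightarrow> real" where
  "ind E p = of_bool (E (fst p) (snd p))"

definition ed :: "('a \<Rightarrow> 'a \<Rightarrow> bool) \<Rightarrow> 'a set \<Rightarrow> 'a set \<Rightarrow> real" where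
  "ed E X Y = (\<Sum>p\<in>X \<times> Y. ind E p)"

definition dens :: "('a \<Rightarrow> 'a \<Rightarrow> bool) \<Rightarrow> 'a set \<Rightarrow> 'a set \<Rightarrow> real" where
  "dens E A B = ed E A B / (real (card A) * real (card B))"

text \<open>\<epsilon>-regularity with the deviation of densities multiplied by
  \<open>card X * card Y\<close>, so that no division by the size of a subset occurs.\<close>

definition reg :: "real \<Rightarrow> ('a \<Rightarrow> 'a \<Rightarrow> bool) \<Rightarrow> 'a set \<Rightarrow> 'a set \<Rightarrow> bool" where
  "reg \<epsilon> E A B \<longleftrightarrow> (\<forall>X Y. X \<subseteq> A \<longrightarrow> Y \<subseteq> B \<longrightarrow> \<epsilon> * card A \<le> card X \<longrightarrow> \<epsilon> * card B \<le> card Y \<longrightarrow>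
     \<bar>ed E X Y - dens E A B * (card X * card Y)\<bar> \<le> \<epsilon> * (card X * card Y))"

text \<open>Pairs of vertices, not of atoms: an irregular pair of atoms then counts with the product
  of its sizes, and the parts need not have equal size.\<close>

definition irregular :: "real \<Rightarrow> ('a \<Rightarrow> 'a \<Rightarrow> bool) \<Rightarrow> 'a set set \<Rightarrow> 'a set \<Rightarrow> ('a \<times> 'a) set" where
  "irregular \<epsilon> E S V = {p \<in> V \<times> V. \<not> reg \<epsilon> E (atom S V (fst p)) (atom S V (snd p))}"

text \<open>The mean square density of the partition, scaled by
  \<open>(card V)\<^sup>2\<close>.\<close>

definition energy :: "('a \<Rightarrow> 'a \<Rightarrow> bool) \<Rightarrow> 'a set set \<Rightarrow> 'a set \<Rightarrow> real" where
  "energy E S V = (\<Sum>p\<in>V \<times> V. (avg (label S) (V \<times> V) (ind E) p)\<^sup>2)"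

lemma atom_subset: "atom S V x \<subseteq> V"
  by (auto simp: atom_def)

lemma atom_self: "x \<in> V \<Longrightarrow> x \<in> atom S V x"
  by (simp add: atom_def)

lemma atom_eq: "y \<in> atom S V x \<Longrightarrow> atom S V y = atom S V x"
  by (simp add: atom_def)

lemma label_class: "{q \<in> V \<times> V. label S q = label S p} = atom S V (fst p) \<times> atom S V (snd p)"
  by (auto simp: label_def atom_def)

lemma avg_ind: "avg (label S) (V \<times> V) (ind E) p = dens E (atom S V (fst p)) (atom S V (snd p))"
  unfolding avg_def label_class dens_def ed_def by (simp add: card_cartesian_product)

lemma card_atoms_le:
  assumes "finite S"
  shows "card (atom S V ` V) \<le> 2 ^ card S" "finite (atom S V ` V)"
proof -
  have "atom S V ` V = (\<lambda>t. {y \<in> V. trace S y = t}) ` (trace S ` V)"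
    by (auto simp: atom_def image_image)
  moreover have sub: "trace S ` V \<subseteq> Pow S" by (auto simp: trace_def)
  moreover have "finite (trace S ` V)" using sub assms finite_subset by blast
  ultimately show "finite (atom S V ` V)" "card (atom S V ` V) \<le> 2 ^ card S"
    using card_image_le[of "trace S ` V" "\<lambda>t. {y \<in> V. trace S y = t}"] card_mono[OF _ sub] assms
    by (auto simp: card_Pow)
qed

lemma ind_bounds: "0 \<le> ind E p" "ind E p \<le> 1"
  by (auto simp: ind_def)

lemma ed_nonneg: "0 \<le> ed E A B"
  unfolding ed_def by (intro sum_nonneg ind_bounds)

lemma ed_le: "ed E A B \<le> card A * card B"
proof -
  have "ed E A B \<le> (\<Sum>p\<in>A \<times> B. 1)"
    unfolding ed_def by (intro sum_mono ind_bounds)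
  then show ?thesis by (simp add: card_cartesian_product)
qed

lemma dens_bounds: "0 \<le> dens E A B" "dens E A B \<le> 1"
  using ed_nonneg[of E A B] ed_le[of E A B] by (auto simp: dens_def divide_le_eq_1 zero_less_mult_iff)

lemma energy_le:
  assumes "finite V"
  shows "energy E S V \<le> (real (card V))\<^sup>2"
proof -
  have "energy E S V \<le> (\<Sum>p\<in>V \<times> V. 1)"
    unfolding energy_def avg_ind by (intro sum_mono) (simp add: dens_bounds power_le_one)
  then show ?thesis by (simp add: card_cartesian_product power2_eq_square)
qed

text \<open>Refining by the witnesses of irregularity makes the signed sum \<open>g\<close> of their indicators
  measurable, and \<open>g\<close> correlates with the difference of the two averages.\<close>

lemma energy_increment:
  fixes E :: "'a \<Rightarrow> 'a \<Rightarrow> bool"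
  assumes V: "finite V" and S: "finite S" and \<epsilon>: "0 < \<epsilon>"
    and irr: "\<epsilon> * (real (card V))\<^sup>2 < card (irregular \<epsilon> E S V)"
  obtains S' where "finite S'" "card S' \<le> card S + 2 * (2 ^ card S * 2 ^ card S)"
    "energy E S V + \<epsilon> ^ 8 * (real (card V))\<^sup>2 \<le> energy E S' V"
proof -
  let ?At = "atom S V" and ?\<Omega> = "V \<times> V" and ?f = "ind E"
  have "\<forall>A B. \<exists>w. \<not> reg \<epsilon> E A B \<longrightarrow> fst w \<subseteq> A \<and> snd w \<subseteq> B \<and> \<epsilon> * card A \<le> card (fst w) \<and>
     \<epsilon> * card B \<le> card (snd w) \<and>
     \<epsilon> * (card (fst w) * card (snd w)) < \<bar>ed E (fst w) (snd w) - dens E A B * (card (fst w) * card (snd w))\<bar>"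
  proof (intro allI)
    fix A B
    show "\<exists>w. \<not> reg \<epsilon> E A B \<longrightarrow> fst w \<subseteq> A \<and> snd w \<subseteq> B \<and> \<epsilon> * card A \<le> card (fst w) \<and>
     \<epsilon> * card B \<le> card (snd w) \<and>
     \<epsilon> * (card (fst w) * card (snd w)) < \<bar>ed E (fst w) (snd w) - dens E A B * (card (fst w) * card (snd w))\<bar>"
    proof (cases "reg \<epsilon> E A B")
      case False
      then obtain X Y where "X \<subseteq> A" "Y \<subseteq> B" "\<epsilon> * card A \<le> card X" "\<epsilon> * card B \<le> card Y"
        "\<epsilon> * (card X * card Y) < \<bar>ed E X Y - dens E A B * (card X * card Y)\<bar>"
        unfolding reg_def not_all not_imp not_le by blast
      then show ?thesis by (intro exI[of _ "(X, Y)"]) simp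
    qed simp
  qed
  then obtain w where w: "\<not> reg \<epsilon> E A B \<Longrightarrow> fst (w A B) \<subseteq> A \<and> snd (w A B) \<subseteq> B \<and>
     \<epsilon> * card A \<le> card (fst (w A B)) \<and> \<epsilon> * card B \<le> card (snd (w A B)) \<and>
     \<epsilon> * (card (fst (w A B)) * card (snd (w A B)))
       < \<bar>ed E (fst (w A B)) (snd (w A B)) - dens E A B * (card (fst (w A B)) * card (snd (w A B)))\<bar>" for A B
    by metis
  define WX where "WX A B = fst (w A B)" for A B
  define WY where "WY A B = snd (w A B)" for A B
  have W: "WX A B \<subseteq> A" "WY A B \<subseteq> B" "\<epsilon> * card A \<le> card (WX A B)" "\<epsilon> * card B \<le> card (WY A B)"
    "\<epsilon> * (card (WX A B) * card (WY A B)) < \<bar>ed E (WX A B) (WY A B) - dens E A B * (card (WX A B) * card (WY A B))\<bar>"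
    if "\<not> reg \<epsilon> E A B" for A B
    using w[OF that] by (simp_all add: WX_def WY_def)
  let ?P = "(?At ` V) \<times> (?At ` V)"
  have P: "finite ?P" "card ?P \<le> 2 ^ card S * 2 ^ card S"
    using card_atoms_le[OF S, of V] by (auto simp: card_cartesian_product intro: mult_le_mono)
  \<comment> \<open>Both witnesses are added for every pair of atoms, regular or not; this
    determines the size bound.\<close>
  define S' where "S' = S \<union> ((\<lambda>(A, B). WX A B) ` ?P \<union> (\<lambda>(A, B). WY A B) ` ?P)"
  have finS': "finite S'" using S P by (simp add: S'_def)
  have "card S' \<le> card S + (card ((\<lambda>(A, B). WX A B) ` ?P) + card ((\<lambda>(A, B). WY A B) ` ?P))"
    unfolding S'_def by (meson add_left_mono card_Un_le le_trans)
  also have "\<dots> \<le> card S + (card ?P + card ?P)"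
    using P by (intro add_left_mono add_mono card_image_le) auto
  also have "\<dots> \<le> card S + 2 * (2 ^ card S * 2 ^ card S)" using P by linarith
  finally have cardS': "card S' \<le> card S + 2 * (2 ^ card S * 2 ^ card S)" .
  define sg where "sg A B = sgn (ed E (WX A B) (WY A B) - dens E A B * (card (WX A B) * card (WY A B)))" for A B
  define g where "g p = (let A = ?At (fst p); B = ?At (snd p) in
      if \<not> reg \<epsilon> E A B \<and> p \<in> WX A B \<times> WY A B then sg A B else 0)" for p
  have SS': "S \<subseteq> S'" by (simp add: S'_def)
  have tr: "trace S x = trace S y" "A \<in> S' \<Longrightarrow> x \<in> A \<longleftrightarrow> y \<in> A" if "trace S' x = trace S' y" for x y A
  proof -
    have *: "x \<in> A \<longleftrightarrow> y \<in> A" if "A \<in> S'" for A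
      using \<open>trace S' x = trace S' y\<close> that unfolding trace_def by blast
    show "A \<in> S' \<Longrightarrow> x \<in> A \<longleftrightarrow> y \<in> A" by (rule *)
    show "trace S x = trace S y" using * SS' by (auto simp: trace_def)
  qed
  have refine: "label S p = label S q" if "label S' p = label S' q" for p q
    using that tr(1)[of "fst p" "fst q"] tr(1)[of "snd p" "snd q"] by (simp add: label_def)
  have ginv: "g p = g q" if pq: "p \<in> ?\<Omega>" "q \<in> ?\<Omega>" "label S' p = label S' q" for p q
  proof -
    have t: "trace S' (fst p) = trace S' (fst q)" "trace S' (snd p) = trace S' (snd q)"
      using pq by (auto simp: label_def)
    have at: "?At (fst p) = ?At (fst q)" "?At (snd p) = ?At (snd q)"
      using tr(1)[OF t(1)] tr(1)[OF t(2)] by (auto simp: atom_def)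
    have "(?At (fst p), ?At (snd p)) \<in> ?P" using pq by auto
    then have "WX (?At (fst p)) (?At (snd p)) \<in> S'" "WY (?At (fst p)) (?At (snd p)) \<in> S'"
      unfolding S'_def by force+
    then have "p \<in> WX (?At (fst p)) (?At (snd p)) \<times> WY (?At (fst p)) (?At (snd p)) \<longleftrightarrow>
        q \<in> WX (?At (fst p)) (?At (snd p)) \<times> WY (?At (fst p)) (?At (snd p))"
      using tr(2)[OF t(1)] tr(2)[OF t(2)] by (auto simp: mem_Times_iff)
    then show ?thesis unfolding g_def Let_def using at by simp
  qed
  let ?a = "avg (label S) ?\<Omega> ?f" and ?a' = "avg (label S') ?\<Omega> ?f"
  define u where "u p = ?a' p - ?a p" for p
  define hh where "hh p = (?f p - ?a p) * g p" for p
  have fin\<Omega>: "finite ?\<Omega>" using V by simp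
  \<comment> \<open>On an irregular pair the sizes of the two witnesses contribute a factor
    \<open>\<epsilon>\<close> each and the deviation a third one; the sign in \<open>g\<close> makes
    the contribution positive. On regular pairs \<open>g\<close> vanishes.\<close>
  have avg_hh: "\<epsilon> ^ 3 * of_bool (p \<in> irregular \<epsilon> E S V) \<le> avg (label S) ?\<Omega> hh p" if p: "p \<in> ?\<Omega>" for p
  proof -
    let ?A = "?At (fst p)" and ?B = "?At (snd p)"
    have at: "?At (fst q) = ?A" "?At (snd q) = ?B" if "q \<in> ?A \<times> ?B" for q
      using that atom_eq[of _ S V] by (auto simp: mem_Times_iff)
    have avgeq: "avg (label S) ?\<Omega> hh p = (\<Sum>q\<in>?A \<times> ?B. hh q) / (card ?A * card ?B)"
      unfolding avg_def label_class by (simp add: card_cartesian_product)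
    show ?thesis
    proof (cases "reg \<epsilon> E ?A ?B")
      case True
      have "hh q = 0" if "q \<in> ?A \<times> ?B" for q
        unfolding hh_def g_def Let_def at[OF that] using True by simp
      then have "avg (label S) ?\<Omega> hh p = 0" unfolding avgeq by simp
      moreover have "p \<notin> irregular \<epsilon> E S V" using True by (simp add: irregular_def)
      ultimately show ?thesis by simp
    next
      case False
      let ?X = "WX ?A ?B" and ?Y = "WY ?A ?B"
      note WW = W[OF False]
      have fA: "finite ?A" "finite ?B" using V atom_subset finite_subset by metis+
      have pos: "0 < real (card ?A)" "0 < real (card ?B)"
        using fA p atom_self[of "fst p" V S] atom_self[of "snd p" V S] by (auto simp: card_gt_0_iff)
      have "(\<Sum>q\<in>?A \<times> ?B. hh q) = (\<Sum>q\<in>?X \<times> ?Y. (?f q - dens E ?A ?B) * sg ?A ?B)"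
      proof -
        have "(\<Sum>q\<in>?A \<times> ?B. hh q) = (\<Sum>q\<in>?A \<times> ?B. if q \<in> ?X \<times> ?Y then (?f q - dens E ?A ?B) * sg ?A ?B else 0)"
        proof (intro sum.cong refl)
          fix q assume q: "q \<in> ?A \<times> ?B"
          show "hh q = (if q \<in> ?X \<times> ?Y then (?f q - dens E ?A ?B) * sg ?A ?B else 0)"
            unfolding hh_def g_def Let_def avg_ind at[OF q] using False by simp
        qed
        also have "\<dots> = (\<Sum>q\<in>(?A \<times> ?B) \<inter> (?X \<times> ?Y). (?f q - dens E ?A ?B) * sg ?A ?B)"
          by (rule sum.inter_restrict[symmetric]) (use fA in simp)
        also have "(?A \<times> ?B) \<inter> (?X \<times> ?Y) = ?X \<times> ?Y" using WW(1,2) by auto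
        finally show ?thesis .
      qed
      also have "\<dots> = (ed E ?X ?Y - dens E ?A ?B * (card ?X * card ?Y)) * sg ?A ?B"
        unfolding ed_def sum_distrib_right[symmetric] sum_subtractf by (simp add: card_cartesian_product)
      also have "\<dots> = \<bar>ed E ?X ?Y - dens E ?A ?B * (card ?X * card ?Y)\<bar>"
        unfolding sg_def by (simp add: abs_sgn)
      finally have "(\<Sum>q\<in>?A \<times> ?B. hh q) = \<bar>ed E ?X ?Y - dens E ?A ?B * (card ?X * card ?Y)\<bar>" .
      then have "\<epsilon> * (card ?X * card ?Y) \<le> (\<Sum>q\<in>?A \<times> ?B. hh q)" using WW(5) by simp
      moreover have "\<epsilon> * ((\<epsilon> * card ?A) * (\<epsilon> * card ?B)) \<le> \<epsilon> * (real (card ?X) * real (card ?Y))"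
        using WW(3,4) \<epsilon> by (intro mult_left_mono mult_mono) auto
      ultimately have "\<epsilon> ^ 3 * (card ?A * card ?B) \<le> (\<Sum>q\<in>?A \<times> ?B. hh q)"
        by (simp add: power3_eq_cube algebra_simps)
      moreover have "p \<in> irregular \<epsilon> E S V" using False p by (simp add: irregular_def)
      ultimately show ?thesis unfolding avgeq using pos
        by (simp add: pos_le_divide_eq)
    qed
  qed
  have "\<epsilon> ^ 4 * (real (card V))\<^sup>2 \<le> \<epsilon> ^ 3 * card (irregular \<epsilon> E S V)"
    using irr \<epsilon> by (simp add: power_numeral_reduce)
  also have "\<dots> = (\<Sum>p\<in>?\<Omega>. \<epsilon> ^ 3 * of_bool (p \<in> irregular \<epsilon> E S V))"
  proof -
    have "?\<Omega> \<inter> irregular \<epsilon> E S V = irregular \<epsilon> E S V" by (auto simp: irregular_def)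
    then show ?thesis using fin\<Omega> by (simp add: sum_distrib_left[symmetric])
  qed
  also have "\<dots> \<le> (\<Sum>p\<in>?\<Omega>. avg (label S) ?\<Omega> hh p)" by (intro sum_mono avg_hh)
  also have "\<dots> = (\<Sum>p\<in>?\<Omega>. hh p)" by (rule sum_avg) fact
  also have "\<dots> = (\<Sum>p\<in>?\<Omega>. ?f p * g p) - (\<Sum>p\<in>?\<Omega>. ?a p * g p)"
    by (simp add: hh_def algebra_simps sum_subtractf)
  also have "(\<Sum>p\<in>?\<Omega>. ?f p * g p) = (\<Sum>p\<in>?\<Omega>. ?a' p * g p)"
    by (rule sum_avg_mult[symmetric, OF fin\<Omega>]) (rule ginv)
  also have "(\<Sum>p\<in>?\<Omega>. ?a' p * g p) - (\<Sum>p\<in>?\<Omega>. ?a p * g p) = (\<Sum>p\<in>?\<Omega>. u p * g p)"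
    by (simp add: u_def algebra_simps sum_subtractf)
  finally have corr: "\<epsilon> ^ 4 * (real (card V))\<^sup>2 \<le> (\<Sum>p\<in>?\<Omega>. u p * g p)" .
  \<comment> \<open>Cauchy-Schwarz in the form
    \<open>0 \<le> (u - \<epsilon> ^ 4 * g)\<^sup>2\<close> with \<open>g\<^sup>2 \<le> 1\<close>.
    The factor \<open>\<epsilon> ^ 4\<close> is the correlation in \<open>corr\<close>, so that
    \<open>2 * \<epsilon> ^ 8 - \<epsilon> ^ 8\<close> remains.\<close>
  have "(\<Sum>p\<in>?\<Omega>. 2 * \<epsilon> ^ 4 * (u p * g p) - \<epsilon> ^ 8) \<le> (\<Sum>p\<in>?\<Omega>. (u p)\<^sup>2)"
  proof (intro sum_mono)
    fix p
    have "\<bar>g p\<bar> \<le> 1" by (auto simp: g_def Let_def sg_def abs_sgn_eq)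
    then have "(g p)\<^sup>2 \<le> 1" by (simp add: abs_square_le_1)
    then have "\<epsilon> ^ 8 * (g p)\<^sup>2 \<le> \<epsilon> ^ 8" using \<epsilon> by (simp add: mult_left_le)
    moreover have "0 \<le> (u p - \<epsilon> ^ 4 * g p)\<^sup>2" by simp
    moreover have "(u p - \<epsilon> ^ 4 * g p)\<^sup>2 = (u p)\<^sup>2 - 2 * \<epsilon> ^ 4 * (u p * g p) + \<epsilon> ^ 8 * (g p)\<^sup>2"
      by (simp add: power2_eq_square algebra_simps flip: power_add)
    ultimately show "2 * \<epsilon> ^ 4 * (u p * g p) - \<epsilon> ^ 8 \<le> (u p)\<^sup>2" by linarith
  qed
  moreover have "(\<Sum>p\<in>?\<Omega>. 2 * \<epsilon> ^ 4 * (u p * g p) - \<epsilon> ^ 8)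
      = 2 * \<epsilon> ^ 4 * (\<Sum>p\<in>?\<Omega>. u p * g p) - \<epsilon> ^ 8 * (real (card V))\<^sup>2"
    by (simp add: sum_subtractf sum_distrib_left card_cartesian_product power2_eq_square)
  moreover have "2 * \<epsilon> ^ 4 * (\<epsilon> ^ 4 * (real (card V))\<^sup>2) \<le> 2 * \<epsilon> ^ 4 * (\<Sum>p\<in>?\<Omega>. u p * g p)"
    using corr \<epsilon> by (intro mult_left_mono) auto
  moreover have "2 * \<epsilon> ^ 4 * (\<epsilon> ^ 4 * (real (card V))\<^sup>2) = 2 * (\<epsilon> ^ 8 * (real (card V))\<^sup>2)"
    by (simp add: algebra_simps flip: power_add)
  ultimately have "\<epsilon> ^ 8 * (real (card V))\<^sup>2 \<le> (\<Sum>p\<in>?\<Omega>. (u p)\<^sup>2)" by linarith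
  moreover have "energy E S' V = energy E S V + (\<Sum>p\<in>?\<Omega>. (u p)\<^sup>2)"
    unfolding energy_def u_def by (rule energy_refine[OF fin\<Omega>]) (rule refine)
  ultimately show thesis using that[OF finS' cardS'] by simp
qed

fun partition_bound :: "nat \<Rightarrow> nat" where
  "partition_bound 0 = 0"
| "partition_bound (Suc k) = partition_bound k + 2 * (2 ^ partition_bound k * 2 ^ partition_bound k)"

text \<open>The energy is at most \<open>(card V)\<^sup>2\<close> and every refinement gains
  \<open>\<epsilon> ^ 8 * (card V)\<^sup>2\<close>, so the process stops after a number of rounds
  that depends on \<epsilon> alone.\<close>

lemma regularity:
  fixes \<epsilon> :: real
  assumes "0 < \<epsilon>"
  obtains M where "\<And>(E :: 'a \<Rightarrow> 'a \<Rightarrow> bool) V. finite V \<Longrightarrow>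
    \<exists>S. finite S \<and> card S \<le> M \<and> card (irregular \<epsilon> E S V) \<le> \<epsilon> * (real (card V))\<^sup>2"
proof -
  obtain K :: nat where K: "1 / \<epsilon> ^ 8 < K" using reals_Archimedean2 by blast
  have "\<exists>S. finite S \<and> card S \<le> partition_bound K \<and> card (irregular \<epsilon> E S V) \<le> \<epsilon> * (real (card V))\<^sup>2"
    if V: "finite V" for E :: "'a \<Rightarrow> 'a \<Rightarrow> bool" and V
  proof -
    have "\<exists>S. finite S \<and> card S \<le> partition_bound k \<and>
        (card (irregular \<epsilon> E S V) \<le> \<epsilon> * (real (card V))\<^sup>2 \<or> k * \<epsilon> ^ 8 * (real (card V))\<^sup>2 \<le> energy E S V)" for k
    proof (induction k)
      case 0
      then show ?case by (intro exI[of _ "{}"]) (auto simp: energy_def intro: sum_nonneg)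
    next
      case (Suc k)
      then obtain S where S: "finite S" "card S \<le> partition_bound k"
        "card (irregular \<epsilon> E S V) \<le> \<epsilon> * (real (card V))\<^sup>2 \<or> k * \<epsilon> ^ 8 * (real (card V))\<^sup>2 \<le> energy E S V"
        by blast
      show ?case
      proof (cases "card (irregular \<epsilon> E S V) \<le> \<epsilon> * (real (card V))\<^sup>2")
        case True
        then show ?thesis using S by (intro exI[of _ S]) auto
      next
        case False
        then obtain S' where S': "finite S'" "card S' \<le> card S + 2 * (2 ^ card S * 2 ^ card S)"
          "energy E S V + \<epsilon> ^ 8 * (real (card V))\<^sup>2 \<le> energy E S' V"
          using energy_increment[OF V S(1) assms, of E] by (auto simp: not_le)
        have "(2::nat) ^ card S * 2 ^ card S \<le> 2 ^ partition_bound k * 2 ^ partition_bound k"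
          using S(2) by (intro mult_le_mono power_increasing) auto
        then have "card S' \<le> partition_bound (Suc k)" using S' S(2) by simp
        moreover have "Suc k * \<epsilon> ^ 8 * (real (card V))\<^sup>2 \<le> energy E S' V"
          using S' S(3) False by (simp add: algebra_simps)
        ultimately show ?thesis using S' by blast
      qed
    qed
    from this[of K] obtain S where S: "finite S" "card S \<le> partition_bound K"
        "card (irregular \<epsilon> E S V) \<le> \<epsilon> * (real (card V))\<^sup>2 \<or> K * \<epsilon> ^ 8 * (real (card V))\<^sup>2 \<le> energy E S V"
      by blast
    moreover have "card (irregular \<epsilon> E S V) \<le> \<epsilon> * (real (card V))\<^sup>2"
      if big: "K * \<epsilon> ^ 8 * (real (card V))\<^sup>2 \<le> energy E S V"
    proof (cases "V = {}")
      case True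
      then show ?thesis by (simp add: irregular_def)
    next
      case False
      then have "0 < (real (card V))\<^sup>2" using V by (simp add: card_gt_0_iff)
      moreover have "1 < K * \<epsilon> ^ 8" using K assms by (simp add: pos_divide_less_eq)
      ultimately have "(real (card V))\<^sup>2 < K * \<epsilon> ^ 8 * (real (card V))\<^sup>2" by simp
      then show ?thesis using big energy_le[OF V, of E S] by linarith
    qed
    ultimately show ?thesis by blast
  qed
  then show thesis using that by blast
qed

subsection \<open>The Ruzsa--Szemeredi theorem\<close>

text \<open>Ordered triangles: in a graph each triangle appears six times
  (\<open>card_triples\<close>).\<close>

definition triples :: "('a \<Rightarrow> 'a \<Rightarrow> bool) \<Rightarrow> 'a set \<Rightarrow> ('a \<times> 'a \<times> 'a) set" where
  "triples E V = {(x, y, z). x \<in> V \<and> y \<in> V \<and> z \<in> V \<and> E x y \<and> E y z \<and> E x z}"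

lemma finite_triples: "finite V \<Longrightarrow> finite (triples E V)"
  by (rule finite_subset[of _ "V \<times> V \<times> V"]) (auto simp: triples_def)

lemma ed_eq_sum_nb:
  assumes "finite X" "finite Y"
  shows "ed E X Y = (\<Sum>x\<in>X. real (card (nb E Y x)))"
proof -
  have "ed E X Y = (\<Sum>x\<in>X. \<Sum>y\<in>Y. of_bool (E x y))"
    unfolding ed_def ind_def by (simp add: sum.cartesian_product split_beta)
  also have "\<dots> = (\<Sum>x\<in>X. real (card (nb E Y x)))"
    using assms by (intro sum.cong refl) (simp add: nb_def Int_def)
  finally show ?thesis .
qed

text \<open>If the vertices of low degree made up an \<epsilon>-fraction of \<open>A\<close>,
  regularity applied to them and all of \<open>B\<close> would give them average degree at least
  \<open>\<epsilon> * card B\<close>.\<close>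

lemma regular_few_low:
  fixes \<epsilon> :: real
  assumes "finite A" "finite B" "A \<noteq> {}" "reg \<epsilon> E A B" "2 * \<epsilon> \<le> dens E A B" "0 < \<epsilon>" "\<epsilon> \<le> 1"
  shows "card {a \<in> A. real (card (nb E B a)) < \<epsilon> * card B} < \<epsilon> * card A"
proof (rule ccontr)
  let ?A = "{a \<in> A. real (card (nb E B a)) < \<epsilon> * card B}"
  assume "\<not> ?thesis"
  then have big: "\<epsilon> * card A \<le> card ?A" by simp
  have "0 < \<epsilon> * card A" using assms by (simp add: card_gt_0_iff)
  then have ne: "?A \<noteq> {}" using big by force
  have "\<epsilon> * card B \<le> card B" using assms(7) mult_right_mono[of \<epsilon> 1 "real (card B)"] by simp
  then have "\<bar>ed E ?A B - dens E A B * (card ?A * card B)\<bar> \<le> \<epsilon> * (card ?A * card B)"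
    using assms(4)[unfolded reg_def, rule_format, of ?A B] big by blast
  then have "dens E A B * (card ?A * card B) - \<epsilon> * (card ?A * card B) \<le> ed E ?A B" by linarith
  moreover have "2 * \<epsilon> * (card ?A * card B) \<le> dens E A B * (card ?A * card B)"
    using assms(5) by (intro mult_right_mono) auto
  ultimately have "\<epsilon> * (card ?A * card B) \<le> ed E ?A B" by simp
  also have "\<dots> = (\<Sum>a\<in>?A. real (card (nb E B a)))" using assms by (simp add: ed_eq_sum_nb)
  also have "\<dots> < (\<Sum>a\<in>?A. \<epsilon> * card B)" using assms ne by (intro sum_strict_mono) auto
  finally show False by simp
qed

text \<open>Fewer than \<open>2 * \<epsilon> * card A\<close> vertices of \<open>A\<close> are
  atypical towards \<open>B\<close> or \<open>C\<close>, so some \<open>a\<close> has large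
  neighbourhoods in both. Regularity between these neighbourhoods makes the average \<open>b\<close>
  suitable.\<close>

lemma regular_triple_codegree:
  fixes \<epsilon> :: real
  assumes fin: "finite A" "finite B" "finite C" and ne: "A \<noteq> {}" "B \<noteq> {}" "C \<noteq> {}"
    and reg: "reg \<epsilon> E A B" "reg \<epsilon> E A C" "reg \<epsilon> E B C"
    and dens: "2 * \<epsilon> \<le> dens E A B" "2 * \<epsilon> \<le> dens E A C" "2 * \<epsilon> \<le> dens E B C"
    and \<epsilon>: "0 < \<epsilon>" "\<epsilon> \<le> 1 / 2"
  obtains a b where "a \<in> A" "b \<in> B" "E a b" "\<epsilon>\<^sup>2 * card C \<le> card {c \<in> C. E a c \<and> E b c}"
proof -
  let ?LB = "{a \<in> A. real (card (nb E B a)) < \<epsilon> * card B}"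
  let ?LC = "{a \<in> A. real (card (nb E C a)) < \<epsilon> * card C}"
  have "real (card (?LB \<union> ?LC)) \<le> card ?LB + card ?LC"
    using of_nat_mono[OF card_Un_le[of ?LB ?LC], where ?'a = real] by simp
  also have "\<dots> < \<epsilon> * card A + \<epsilon> * card A"
    using regular_few_low[OF fin(1,2) ne(1) reg(1) dens(1)]
      regular_few_low[OF fin(1,3) ne(1) reg(2) dens(2)] \<epsilon> by linarith
  also have "\<dots> \<le> card A" using \<epsilon>(2) mult_right_mono[of "2 * \<epsilon>" 1 "real (card A)"] by simp
  finally have "card (?LB \<union> ?LC) < card A" by simp
  then have "\<not> A \<subseteq> ?LB \<union> ?LC"
    using card_mono[of "?LB \<union> ?LC" A] fin by auto
  then obtain a where "a \<in> A" "a \<notin> ?LB \<union> ?LC" by blast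
  then have a: "a \<in> A" "\<epsilon> * card B \<le> card (nb E B a)" "\<epsilon> * card C \<le> card (nb E C a)"
    by (auto simp: not_less)
  let ?N = "nb E B a" and ?M = "nb E C a"
  have pos: "0 < \<epsilon> * card B" "0 < \<epsilon> * card C" using \<epsilon> fin ne by (auto simp: card_gt_0_iff)
  have "?N \<noteq> {}" using a(2) pos by force
  have "\<bar>ed E ?N ?M - dens E B C * (card ?N * card ?M)\<bar> \<le> \<epsilon> * (card ?N * card ?M)"
    using reg(3) a nb_subset unfolding reg_def by metis
  moreover have "2 * \<epsilon> * (card ?N * card ?M) \<le> dens E B C * (card ?N * card ?M)"
    using dens(3) by (intro mult_right_mono) auto
  ultimately have ge: "\<epsilon> * (card ?N * card ?M) \<le> ed E ?N ?M" by linarith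
  have "\<exists>b\<in>?N. \<epsilon> * card ?M \<le> card (nb E ?M b)"
  proof (rule ccontr)
    assume "\<not> ?thesis"
    then have "(\<Sum>b\<in>?N. real (card (nb E ?M b))) < (\<Sum>b\<in>?N. \<epsilon> * card ?M)"
      using fin \<open>?N \<noteq> {}\<close> by (intro sum_strict_mono) (auto simp: not_le)
    then show False using ge fin by (simp add: ed_eq_sum_nb algebra_simps)
  qed
  then obtain b where b: "b \<in> ?N" "\<epsilon> * card ?M \<le> card (nb E ?M b)" by auto
  have "\<epsilon> * (\<epsilon> * card C) \<le> \<epsilon> * card ?M" using a \<epsilon> by (intro mult_left_mono) auto
  moreover have "nb E ?M b = {c \<in> C. E a c \<and> E b c}" by auto
  ultimately show thesis using that[of a b] a b by (simp add: power2_eq_square)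
qed

text \<open>There are at most \<open>2 ^ M\<close> atoms, and each small one contributes fewer than
  \<open>\<beta> * card V\<close> vertices.\<close>

lemma card_small_atoms:
  fixes \<beta> :: real
  assumes V: "finite V" and S: "finite S" "card S \<le> M" and "0 \<le> \<beta>"
  shows "card {x \<in> V. card (atom S V x) < \<beta> * card V} \<le> 2 ^ M * (\<beta> * card V)"
proof -
  let ?X = "{x \<in> V. card (atom S V x) < \<beta> * card V}"
  let ?As = "{A \<in> atom S V ` V. card A < \<beta> * card V}"
  have finA: "finite ?As" using V by simp
  have "card ?X \<le> card (\<Union> ?As)"
  proof (rule card_mono)
    have "finite A" if "A \<in> ?As" for A
      using that V atom_subset[of S V] finite_subset by blast
    then show "finite (\<Union> ?As)" using finA by (rule finite_Union[rotated])
    show "?X \<subseteq> \<Union> ?As" using atom_self[of _ V S] by blast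
  qed
  also have "\<dots> \<le> (\<Sum>A\<in>?As. card A)" by (rule card_Union_le_sum_card)
  finally have "card ?X \<le> (\<Sum>A\<in>?As. card A)" .
  then have "real (card ?X) \<le> (\<Sum>A\<in>?As. real (card A))" by (simp flip: of_nat_sum)
  also have "\<dots> \<le> (\<Sum>A\<in>?As. \<beta> * card V)" by (intro sum_mono) auto
  also have "\<dots> = card ?As * (\<beta> * card V)" by simp
  also have "\<dots> \<le> 2 ^ M * (\<beta> * card V)"
  proof (intro mult_right_mono)
    have "card ?As \<le> card (atom S V ` V)" using V by (intro card_mono) auto
    also have "\<dots> \<le> 2 ^ card S" by (rule card_atoms_le) fact
    also have "\<dots> \<le> 2 ^ M" using S by (intro power_increasing) auto
    finally have "card ?As \<le> 2 ^ M" .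
    from of_nat_mono[OF this, where ?'a = real] show "real (card ?As) \<le> 2 ^ M" by simp
  qed (use assms in auto)
  finally show ?thesis .
qed

text \<open>Delete the edges between irregular or sparse pairs and at small atoms. A triangle that
  survives would force an edge in many triangles, so each triangle contains a deleted edge.\<close>

theorem ruzsa_szemeredi:
  fixes \<epsilon> :: real and t :: nat
  assumes "0 < \<epsilon>"
  obtains n0 where "\<And>(E :: 'a \<Rightarrow> 'a \<Rightarrow> bool) V. graph_rel E \<Longrightarrow> finite V \<Longrightarrow> n0 \<le> card V \<Longrightarrow>
    (\<And>x y. x \<in> V \<Longrightarrow> y \<in> V \<Longrightarrow> E x y \<Longrightarrow> card {z \<in> V. E x z \<and> E y z} < t) \<Longrightarrow>
    card (triples E V) \<le> \<epsilon> * (real (card V))\<^sup>2"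
proof -
  \<comment> \<open>At most \<open>5 * \<delta> * n\<^sup>2\<close> ordered pairs are deleted: one
    \<delta> for irregular pairs, two for sparse ones, one for each end in a small atom. A deleted
    edge is in fewer than \<open>t\<close> triangles and can take three positions in an ordered
    triangle, whence 15.\<close>
  define \<delta> where "\<delta> = min (1 / 2) (\<epsilon> / (15 * (t + 1)))"
  have \<delta>: "0 < \<delta>" "\<delta> \<le> 1 / 2" "15 * (t + 1) * \<delta> \<le> \<epsilon>"
  proof -
    show "0 < \<delta>" using assms by (simp add: \<delta>_def)
    show "\<delta> \<le> 1 / 2" unfolding \<delta>_def by (rule min.cobounded1)
    have "15 * (t + 1) * \<delta> \<le> 15 * (t + 1) * (\<epsilon> / (15 * (t + 1)))"
      by (intro mult_left_mono) (auto simp: \<delta>_def)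
    also have "\<dots> = \<epsilon>" by simp
    finally show "15 * (t + 1) * \<delta> \<le> \<epsilon>" .
  qed
  obtain M where M: "\<And>(E :: 'a \<Rightarrow> 'a \<Rightarrow> bool) V. finite V \<Longrightarrow>
    \<exists>S. finite S \<and> card S \<le> M \<and> card (irregular \<delta> E S V) \<le> \<delta> * (real (card V))\<^sup>2"
    using regularity[OF \<delta>(1)] by blast
  define \<beta> where "\<beta> = \<delta> / 2 ^ M"
  have \<beta>: "0 < \<beta>" using \<delta> by (simp add: \<beta>_def)
  \<comment> \<open>A surviving triangle will give an edge in at least
    \<open>\<delta>\<^sup>2 * (\<beta> * n)\<close> triangles, which must exceed
    \<open>t\<close>.\<close>
  obtain n0 :: nat where n0: "t / (\<delta>\<^sup>2 * \<beta>) < n0" using reals_Archimedean2 by blast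
  show thesis
  proof (rule that)
    fix E :: "'a \<Rightarrow> 'a \<Rightarrow> bool" and V
    assume E: "graph_rel E" and V: "finite V" "n0 \<le> card V"
      and codeg: "\<And>x y. x \<in> V \<Longrightarrow> y \<in> V \<Longrightarrow> E x y \<Longrightarrow> card {z \<in> V. E x z \<and> E y z} < t"
    interpret graph_rel E by fact
    let ?n = "real (card V)"
    have big: "t < \<delta>\<^sup>2 * (\<beta> * ?n)"
    proof -
      have "t / (\<delta>\<^sup>2 * \<beta>) < ?n" using n0 V by linarith
      then show ?thesis using \<delta> \<beta> by (simp add: pos_divide_less_eq algebra_simps)
    qed
    obtain S where S: "finite S" "card S \<le> M" "card (irregular \<delta> E S V) \<le> \<delta> * ?n\<^sup>2"
      using M[OF V(1)] by blast
    let ?At = "atom S V"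
    define small where "small = {x \<in> V. card (?At x) < \<beta> * ?n}"
    define sparse where "sparse = {p \<in> V \<times> V. E (fst p) (snd p) \<and> dens E (?At (fst p)) (?At (snd p)) < 2 * \<delta>}"
    define D where "D = irregular \<delta> E S V \<union> sparse \<union> small \<times> V \<union> V \<times> small"
    have finD: "finite D" unfolding D_def irregular_def sparse_def small_def using V by auto
    have "card small \<le> 2 ^ M * (\<beta> * ?n)"
      unfolding small_def using V S \<beta> by (intro card_small_atoms) auto
    then have small: "card small \<le> \<delta> * ?n" by (simp add: \<beta>_def)
    have "real (card sparse) \<le> 2 * \<delta> * ?n\<^sup>2"
    proof -
      let ?lo = "\<lambda>p. dens E (?At (fst p)) (?At (snd p)) < 2 * \<delta>"
      have "real (card sparse) = (\<Sum>p\<in>V \<times> V. ind E p * of_bool (?lo p))"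
      proof -
        have "sparse = {p \<in> V \<times> V. E (fst p) (snd p) \<and> ?lo p}" by (auto simp: sparse_def)
        moreover have "(\<Sum>p\<in>V \<times> V. ind E p * of_bool (?lo p)) = (\<Sum>p\<in>V \<times> V. of_bool (E (fst p) (snd p) \<and> ?lo p))"
          by (intro sum.cong) (auto simp: ind_def)
        ultimately show ?thesis using V by (simp add: Int_def)
      qed
      \<comment> \<open>Sparseness depends on the atoms only, so edges may be replaced by densities,
        which are below \<open>2 * \<delta>\<close> wherever they count.\<close>
      also have "\<dots> = (\<Sum>p\<in>V \<times> V. avg (label S) (V \<times> V) (ind E) p * of_bool (?lo p))"
      proof (rule sum_avg_mult[symmetric])
        fix p q assume "label S p = label S q"
        then have "?At (fst p) = ?At (fst q)" "?At (snd p) = ?At (snd q)" by (auto simp: label_def atom_def)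
        then show "(of_bool (?lo p) :: real) = of_bool (?lo q)" by simp
      qed (use V in simp)
      also have "\<dots> \<le> (\<Sum>p\<in>V \<times> V. 2 * \<delta>)"
        unfolding avg_ind using \<delta> by (intro sum_mono) auto
      finally show ?thesis by (simp add: card_cartesian_product power2_eq_square mult_ac)
    qed
    moreover have "real (card (small \<times> V)) \<le> \<delta> * ?n\<^sup>2" "real (card (V \<times> small)) \<le> \<delta> * ?n\<^sup>2"
      using mult_right_mono[OF small, of ?n] by (simp_all add: card_cartesian_product power2_eq_square algebra_simps)
    moreover have "real (card D) \<le> card (irregular \<delta> E S V) + card sparse + card (small \<times> V) + card (V \<times> small)"
    proof -
      have "card D \<le> card (irregular \<delta> E S V) + card sparse + card (small \<times> V) + card (V \<times> small)"
        unfolding D_def by (meson card_Un_le add_right_mono le_trans)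
      from of_nat_mono[OF this, where ?'a = real] show ?thesis by simp
    qed
    ultimately have cardD: "real (card D) \<le> 5 * \<delta> * ?n\<^sup>2" using S(3) by linarith
    have surv: "(x, y) \<in> D \<or> (y, z) \<in> D \<or> (x, z) \<in> D" if xyz: "(x, y, z) \<in> triples E V" for x y z
    proof (rule ccontr)
      assume nD: "\<not> ?thesis"
      have V3: "x \<in> V" "y \<in> V" "z \<in> V" and E3: "E x y" "E y z" "E x z" using xyz by (auto simp: triples_def)
      have fA: "finite (?At u)" for u using V atom_subset finite_subset by metis
      have nonempty: "?At u \<noteq> {}" if "u \<in> V" for u using atom_self[OF that] by blast
      have sz: "\<beta> * ?n \<le> card (?At z)" using nD V3 by (auto simp: D_def small_def not_less)
      have R: "reg \<delta> E (?At x) (?At y)" "reg \<delta> E (?At x) (?At z)" "reg \<delta> E (?At y) (?At z)"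
        using nD V3 by (auto simp: D_def irregular_def)
      have De: "2 * \<delta> \<le> dens E (?At x) (?At y)" "2 * \<delta> \<le> dens E (?At x) (?At z)" "2 * \<delta> \<le> dens E (?At y) (?At z)"
        using nD V3 E3 by (auto simp: D_def sparse_def not_less)
      obtain a b where ab: "a \<in> ?At x" "b \<in> ?At y" "E a b"
        "\<delta>\<^sup>2 * card (?At z) \<le> card {c \<in> ?At z. E a c \<and> E b c}"
        using regular_triple_codegree[OF fA fA fA nonempty[OF V3(1)] nonempty[OF V3(2)] nonempty[OF V3(3)] R De \<delta>(1,2)]
        by blast
      have abV: "a \<in> V" "b \<in> V" using ab atom_subset by fast+
      have "\<delta>\<^sup>2 * (\<beta> * ?n) \<le> \<delta>\<^sup>2 * card (?At z)" using sz \<delta> by (intro mult_left_mono) auto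
      moreover have "card {c \<in> ?At z. E a c \<and> E b c} \<le> card {c \<in> V. E a c \<and> E b c}"
        using V atom_subset[of S V z] by (intro card_mono) auto
      ultimately have "t \<le> card {c \<in> V. E a c \<and> E b c}" using big ab(4) by linarith
      then show False using codeg[OF abV ab(3)] by simp
    qed
    let ?T = "\<lambda>p. {c \<in> V. E (fst p) c \<and> E (snd p) c}"
    let ?D = "{p \<in> D. fst p \<in> V \<and> snd p \<in> V \<and> E (fst p) (snd p)}"
    let ?\<Sigma> = "Sigma ?D ?T"
    have "card ?\<Sigma> \<le> card ?D * t"
    proof -
      have "card ?\<Sigma> = (\<Sum>p\<in>?D. card (?T p))" using V finD by (intro card_SigmaI) auto
      also have "\<dots> \<le> (\<Sum>p\<in>?D. t)" using codeg by (intro sum_mono) (auto intro: less_imp_le)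
      finally show ?thesis by simp
    qed
    also have "\<dots> \<le> card D * t" using finD by (intro mult_le_mono1 card_mono) auto
    finally have card\<Sigma>: "card ?\<Sigma> \<le> card D * t" .
    have fin\<Sigma>: "finite ?\<Sigma>" using V finD by auto
    have "triples E V \<subseteq> (\<lambda>(p, c). (fst p, snd p, c)) ` ?\<Sigma> \<union> (\<lambda>(p, c). (c, fst p, snd p)) ` ?\<Sigma>
        \<union> (\<lambda>(p, c). (fst p, c, snd p)) ` ?\<Sigma>" (is "_ \<subseteq> ?A \<union> ?B \<union> ?C")
    proof
      fix w assume w: "w \<in> triples E V"
      obtain x y z where xyz: "w = (x, y, z)" by (cases w)
      have V3: "x \<in> V" "y \<in> V" "z \<in> V" and E3: "E x y" "E y z" "E x z"
        using w xyz by (auto simp: triples_def)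
      note E6 = E3 E3[THEN sym]
      from surv[of x y z] w xyz consider "(x, y) \<in> D" | "(y, z) \<in> D" | "(x, z) \<in> D" by blast
      then show "w \<in> ?A \<union> ?B \<union> ?C"
      proof cases
        case 1
        then have "((x, y), z) \<in> ?\<Sigma>" using V3 E6 by auto
        then show ?thesis unfolding xyz by (force simp: image_iff)
      next
        case 2
        then have "((y, z), x) \<in> ?\<Sigma>" using V3 E6 by auto
        then show ?thesis unfolding xyz by (force simp: image_iff)
      next
        case 3
        then have "((x, z), y) \<in> ?\<Sigma>" using V3 E6 by auto
        then show ?thesis unfolding xyz by (force simp: image_iff)
      qed
    qed
    then have "card (triples E V) \<le> card (?A \<union> ?B \<union> ?C)"
      using fin\<Sigma> by (intro card_mono) auto
    also have "\<dots> \<le> card ?A + card ?B + card ?C" by (meson card_Un_le add_right_mono le_trans)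
    also have "\<dots> \<le> card ?\<Sigma> + card ?\<Sigma> + card ?\<Sigma>"
      by (intro add_mono card_image_le fin\<Sigma>)
    also have "\<dots> \<le> 3 * (card D * t)" using card\<Sigma> by linarith
    finally have "card (triples E V) \<le> 3 * (card D * t)" .
    from of_nat_mono[OF this, where ?'a = real]
    have "real (card (triples E V)) \<le> 3 * (real (card D) * t)" by simp
    also have "\<dots> \<le> 3 * (5 * \<delta> * ?n\<^sup>2 * t)"
      using mult_right_mono[OF cardD, of "real t"] by (simp add: mult_ac)
    also have "\<dots> \<le> (15 * (t + 1) * \<delta>) * ?n\<^sup>2"
      using \<delta> by (simp add: algebra_simps)
    also have "\<dots> \<le> \<epsilon> * ?n\<^sup>2" using \<delta>(3) by (intro mult_right_mono) auto
    finally show "card (triples E V) \<le> \<epsilon> * ?n\<^sup>2" .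
  qed
qed

subsection \<open>Triangles in theta-free graphs\<close>

text \<open>Count the pairs of a vertex of degree at least \<open>\<eta> * n\<close> and an
  \<open>s\<close>-set of its neighbours. An \<open>s\<close>-set occurs at most \<open>s\<close>
  times, while such a vertex contributes at least \<open>(\<eta> * n / s) ^ s\<close>; hence the
  number of these vertices is bounded independently of \<open>n\<close>.\<close>

lemma kovari_sos_turan:
  fixes \<epsilon> :: real and s :: nat
  assumes "0 < \<epsilon>" "0 < s"
  obtains n0 where "\<And>(E :: 'a \<Rightarrow> 'a \<Rightarrow> bool) V. finite V \<Longrightarrow> n0 \<le> card V \<Longrightarrow>
    (\<nexists>P Q. P \<subseteq> V \<and> Q \<subseteq> V \<and> card P = s \<and> card Q = s \<and> (\<forall>p\<in>P. \<forall>q\<in>Q. E p q)) \<Longrightarrow>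
    (\<Sum>v\<in>V. card (nb E V v)) \<le> \<epsilon> * (real (card V))\<^sup>2"
proof -
  \<comment> \<open>Half of \<epsilon> for the vertices of large degree, half for all
    others.\<close>
  define \<eta> where "\<eta> = \<epsilon> / 2"
  have \<eta>: "0 < \<eta>" using assms by (simp add: \<eta>_def)
  \<comment> \<open>The first summand makes \<open>\<eta> * n\<close> exceed \<open>s\<close>, as
    the lower bound for the binomial coefficient requires; the second makes it exceed the bound for
    \<open>card B\<close>.\<close>
  obtain n1 :: nat where n1: "s / \<eta> + s * (s / \<eta>) ^ s / \<eta> < n1" using reals_Archimedean2 by blast
  show thesis
  proof (rule that[of n1])
    fix E :: "'a \<Rightarrow> 'a \<Rightarrow> bool" and V
    assume V: "finite V" "n1 \<le> card V"
      and free: "\<nexists>P Q. P \<subseteq> V \<and> Q \<subseteq> V \<and> card P = s \<and> card Q = s \<and> (\<forall>p\<in>P. \<forall>q\<in>Q. E p q)"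
    let ?n = "real (card V)"
    have n: "s / \<eta> + s * (s / \<eta>) ^ s / \<eta> < ?n" using n1 V(2) by linarith
    have "0 \<le> s / \<eta>" "0 \<le> s * (s / \<eta>) ^ s / \<eta>" using \<eta> by auto
    then have n_ge: "s / \<eta> < ?n" "s * (s / \<eta>) ^ s / \<eta> < ?n" using n by linarith+
    then have n': "s < \<eta> * ?n" "s * (s / \<eta>) ^ s < \<eta> * ?n"
      using \<eta> by (simp_all add: pos_divide_less_eq mult.commute)
    define B where "B = {v \<in> V. \<eta> * ?n \<le> card (nb E V v)}"
    let ?Ss = "{S. S \<subseteq> V \<and> card S = s}"
    have finB: "finite B" and BV: "B \<subseteq> V" using V by (auto simp: B_def)
    have finS: "finite ?Ss" using V by simp
    have "card (SIGMA v:B. {S. S \<subseteq> nb E V v \<and> card S = s}) \<le> card (SIGMA S:?Ss. {v \<in> V. \<forall>q\<in>S. E v q})"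
    proof (rule card_inj_on_le[where f = "\<lambda>(v, S). (S, v)"])
      show "(\<lambda>(v, S). (S, v)) ` (SIGMA v:B. {S. S \<subseteq> nb E V v \<and> card S = s}) \<subseteq> (SIGMA S:?Ss. {v \<in> V. \<forall>q\<in>S. E v q})"
        using BV by auto
    qed (use V finS in \<open>auto simp: inj_on_def\<close>)
    also have "\<dots> = (\<Sum>S\<in>?Ss. card {v \<in> V. \<forall>q\<in>S. E v q})"
      using V finS by (intro card_SigmaI) auto
    also have "\<dots> \<le> (\<Sum>S\<in>?Ss. s)"
    proof (intro sum_mono)
      fix S assume S: "S \<in> ?Ss"
      show "card {v \<in> V. \<forall>q\<in>S. E v q} \<le> s"
      proof (rule ccontr)
        assume "\<not> ?thesis"
        then have "s \<le> card {v \<in> V. \<forall>q\<in>S. E v q}" by simp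
        then obtain P where "P \<subseteq> {v \<in> V. \<forall>q\<in>S. E v q}" "card P = s"
          using obtain_subset_with_card_n by blast
        then show False using free S by blast
      qed
    qed
    also have "\<dots> = s * (card V choose s)" using V by (simp add: n_subsets)
    finally have "card (SIGMA v:B. {S. S \<subseteq> nb E V v \<and> card S = s}) \<le> s * (card V choose s)" .
    moreover have "card (SIGMA v:B. {S. S \<subseteq> nb E V v \<and> card S = s}) = (\<Sum>v\<in>B. card (nb E V v) choose s)"
      using V finB by (subst card_SigmaI) (auto simp: n_subsets)
    ultimately have "(\<Sum>v\<in>B. card (nb E V v) choose s) \<le> s * (card V choose s)" by simp
    also have "\<dots> \<le> s * card V ^ s" by (intro mult_le_mono2) (cases "s \<le> card V"; simp add: binomial_le_pow binomial_eq_0)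
    finally have "real (\<Sum>v\<in>B. card (nb E V v) choose s) \<le> real (s * card V ^ s)" by (rule of_nat_mono)
    then have up: "(\<Sum>v\<in>B. real (card (nb E V v) choose s)) \<le> s * ?n ^ s" by simp
    have "card B * (\<eta> * ?n / s) ^ s \<le> (\<Sum>v\<in>B. real (card (nb E V v) choose s))"
    proof -
      have "(\<eta> * ?n / s) ^ s \<le> real (card (nb E V v) choose s)" if "v \<in> B" for v
      proof -
        have d: "\<eta> * ?n \<le> card (nb E V v)" using that by (simp add: B_def)
        then have "s \<le> card (nb E V v)" using n'(1) by linarith
        then have "(real (card (nb E V v)) / real s) ^ s \<le> real (card (nb E V v) choose s)"
          by (rule binomial_ge_n_over_k_pow_k)
        moreover have "(\<eta> * ?n / s) ^ s \<le> (real (card (nb E V v)) / real s) ^ s"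
          using d \<eta> by (intro power_mono divide_right_mono) auto
        ultimately show ?thesis by linarith
      qed
      then show ?thesis using sum_mono[of B "\<lambda>_. (\<eta> * ?n / s) ^ s"] by simp
    qed
    then have "card B * (\<eta> * ?n / s) ^ s \<le> s * ?n ^ s" using up by linarith
    moreover have "(\<eta> * ?n / s) ^ s = ?n ^ s / (s / \<eta>) ^ s"
      using \<eta> by (simp add: power_divide power_mult_distrib)
    ultimately have "card B * (?n ^ s / (s / \<eta>) ^ s) \<le> s * ?n ^ s" by simp
    moreover have npos: "0 < ?n ^ s" using n_ge \<eta> \<open>0 \<le> s / \<eta>\<close> by (intro zero_less_power) linarith
    moreover have spos: "0 < (s / \<eta>) ^ s" using assms \<eta> by simp
    moreover have "b \<le> c * a" if "b * (N / a) \<le> c * N" "0 < N" "0 < a" for a b c N :: real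
      using that by (simp add: field_simps)
    ultimately have "real (card B) \<le> s * (s / \<eta>) ^ s" by blast
    then have cB: "real (card B) \<le> \<eta> * ?n" using n'(2) by linarith
    have "(\<Sum>v\<in>V. real (card (nb E V v))) = (\<Sum>v\<in>B. real (card (nb E V v))) + (\<Sum>v\<in>V - B. real (card (nb E V v)))"
      using sum.subset_diff[OF BV V(1), of "\<lambda>v. real (card (nb E V v))"] by simp
    also have "\<dots> \<le> (\<Sum>v\<in>B. ?n) + (\<Sum>v\<in>V - B. \<eta> * ?n)"
    proof (intro add_mono sum_mono)
      show "real (card (nb E V v)) \<le> ?n" for v using V by (simp add: card_mono nb_subset)
      show "real (card (nb E V v)) \<le> \<eta> * ?n" if "v \<in> V - B" for v
        using that by (auto simp: B_def)
    qed
    also have "\<dots> = card B * ?n + card (V - B) * (\<eta> * ?n)" by simp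
    also have "\<dots> \<le> (\<eta> * ?n) * ?n + ?n * (\<eta> * ?n)"
    proof (intro add_mono mult_right_mono cB)
      show "real (card (V - B)) \<le> ?n" using V by (simp add: card_mono)
    qed (use \<eta> in auto)
    finally show "(\<Sum>v\<in>V. card (nb E V v)) \<le> \<epsilon> * ?n\<^sup>2" by (simp add: \<eta>_def power2_eq_square)
  qed
qed

text \<open>By the previous lemma all but \<open>o(n\<^sup>2)\<close> edges lie in some \<open>K\<^bsub>s,s\<^esub>\<close>; such an edge can be
  replaced by paths of any odd length up to \<open>2 s - 1\<close>.\<close>

definition good :: "('a \<Rightarrow> 'a \<Rightarrow> bool) \<Rightarrow> 'a set \<Rightarrow> nat \<Rightarrow> 'a \<Rightarrow> 'a \<Rightarrow> bool" where
  "good E V s x y \<longleftrightarrow> (\<exists>P Q. P \<subseteq> V \<and> Q \<subseteq> V \<and> card P = s \<and> card Q = s \<and> x \<in> P \<and> y \<in> Q \<and>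
     (\<forall>p\<in>P. \<forall>q\<in>Q. E p q))"

text \<open>The form in which edge-criticality enters the extremal argument;
  \<open>edge_critical_parity\<close> derives it.\<close>

locale critical_theta = theta +
  fixes i0
  assumes i0: "i0 < length ps"
    and parity: "i < length ps \<Longrightarrow> i \<noteq> i0 \<Longrightarrow> even (ps ! i) \<longleftrightarrow> odd (ps ! i0)"

text \<open>\<open>col\<close> is a proper 2-colouring of the theta graph minus the first edge of the path \<open>i0\<close>.\<close>

context critical_theta
begin

definition col :: "theta_vertex \<Rightarrow> bool" where
  "col u = (case u of Source \<Rightarrow> False | Sink \<Rightarrow> even (ps ! i0)
     | Inner i j \<Rightarrow> if i = i0 then even j else odd j)"

lemma col_path_other:
  assumes "i < length ps" "i \<noteq> i0" "j \<le> ps ! i"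
  shows "col (theta_path ps i j) \<longleftrightarrow> odd j"
  using assms parity[of i] by (auto simp: theta_path_def col_def)

lemma col_path_i0:
  assumes "j \<le> ps ! i0" "0 < j"
  shows "col (theta_path ps i0 j) \<longleftrightarrow> even j"
  using assms by (auto simp: theta_path_def col_def)

lemma col_Source: "\<not> col Source"
  by (simp add: col_def)

text \<open>Together with \<open>col_Source\<close>: both ends of the critical edge have colour
  \<open>False\<close>. If the path \<open>i0\<close> is a single edge, the second end is
  \<open>Sink\<close>.\<close>

lemma col_critical: "\<not> col (theta_path ps i0 1)"
  using col_path_i0[of 1] path_pos[OF i0] by simp

end

locale critical_theta_graph = critical_theta ps i0 + theta_graph_rel ps E
  for ps i0 and E :: "'a \<Rightarrow> 'a \<Rightarrow> bool"
begin

lemma good_sym: "good E V s x y \<Longrightarrow> good E V s y x"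
  unfolding good_def using sym by metis

text \<open>\<open>Source\<close> and \<open>Sink\<close> go to \<open>x\<close> and \<open>y\<close>. All paths other than \<open>i0\<close> have even length; each
  runs through its own \<open>K\<^bsub>h,h\<^esub>\<close> from \<open>x\<close> to some \<open>w \<in> W\<close> and then to \<open>y\<close>.\<close>

lemma embedding_short:
  assumes "ps ! i0 = 1" "finite V" "x \<in> V" "y \<in> V" "E x y"
    and W: "W \<subseteq> {w \<in> V. E x w \<and> E y w \<and> good E V h x w}" "h \<le> card W"
  shows "\<exists>f. theta_emb ps E V f"
proof -
  define I where "I = {..<length ps} - {i0}"
  have even: "even (ps ! i)" "2 \<le> ps ! i" if "i \<in> I" for i
  proof -
    show ev: "even (ps ! i)" using parity[of i] that assms(1) by (auto simp: I_def)
    show "2 \<le> ps ! i" using ev path_pos[of i] that by (cases "ps ! i = 1") (auto simp: I_def)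
  qed
  \<comment> \<open>The vertex before \<open>Sink\<close> on path \<open>i\<close> goes to
    \<open>\<omega> i\<close>, a common neighbour of \<open>x\<close> and \<open>y\<close> of its
    own.\<close>
  let ?last = "\<lambda>i. Inner i (ps ! i - 1)"
  have last: "?last ` I \<subseteq> VT" using even by (force simp: Inner_in I_def)
  have "card I = card (?last ` I)" by (rule card_image[symmetric]) (auto simp: inj_on_def)
  also have "\<dots> \<le> h" unfolding h_def by (intro card_mono last) simp
  also have "\<dots> \<le> card W" by fact
  finally have "card I \<le> card W" .
  moreover have "finite W" using W(1) assms(2) by (auto intro: finite_subset)
  ultimately obtain \<omega> where \<omega>: "inj_on \<omega> I" "\<omega> ` I \<subseteq> W"
    using card_le_inj[of I W] by (auto simp: I_def)
  have \<omega>': "\<omega> i \<in> V" "E x (\<omega> i)" "E y (\<omega> i)" "good E V h x (\<omega> i)" if "i \<in> I" for i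
    using \<omega>(2) W(1) that by blast+
  have "\<forall>i. \<exists>PQ. i \<in> I \<longrightarrow> fst PQ \<subseteq> V \<and> snd PQ \<subseteq> V \<and> card (fst PQ) = h \<and> card (snd PQ) = h \<and>
      x \<in> fst PQ \<and> \<omega> i \<in> snd PQ \<and> (\<forall>p\<in>fst PQ. \<forall>q\<in>snd PQ. E p q)"
  proof
    fix i
    show "\<exists>PQ. i \<in> I \<longrightarrow> fst PQ \<subseteq> V \<and> snd PQ \<subseteq> V \<and> card (fst PQ) = h \<and> card (snd PQ) = h \<and>
      x \<in> fst PQ \<and> \<omega> i \<in> snd PQ \<and> (\<forall>p\<in>fst PQ. \<forall>q\<in>snd PQ. E p q)"
    proof (cases "i \<in> I")
      case True
      then obtain P Q where "P \<subseteq> V" "Q \<subseteq> V" "card P = h" "card Q = h" "x \<in> P" "\<omega> i \<in> Q"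
        "\<forall>p\<in>P. \<forall>q\<in>Q. E p q"
        using \<omega>'(4)[OF True] unfolding good_def by (elim exE conjE)
      then show ?thesis by (intro exI[of _ "(P, Q)"]) simp
    qed simp
  qed
  then obtain PQ where PQ: "\<And>i. i \<in> I \<Longrightarrow> fst (PQ i) \<subseteq> V \<and> snd (PQ i) \<subseteq> V \<and>
      card (fst (PQ i)) = h \<and> card (snd (PQ i)) = h \<and>
      x \<in> fst (PQ i) \<and> \<omega> i \<in> snd (PQ i) \<and> (\<forall>p\<in>fst (PQ i). \<forall>q\<in>snd (PQ i). E p q)"
    by metis
  \<comment> \<open>Along path \<open>i\<close> the even positions, starting with \<open>x\<close>,
    use the first side and the odd ones the second. As the length is even, the last inner position
    is odd, in agreement with \<open>\<omega> i\<close> being in the second side.\<close>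
  define A where "A u = (case u of Inner i j \<Rightarrow> if odd j then snd (PQ i) else fst (PQ i) | _ \<Rightarrow> {})" for u
  define g where "g u = (case u of Source \<Rightarrow> x | Sink \<Rightarrow> y | Inner i j \<Rightarrow> \<omega> i)" for u
  define W1 where "W1 = {Source, Sink} \<union> ?last ` I"
  have W1: "W1 \<subseteq> VT" using last by (auto simp: W1_def)
  have InI: "i \<in> I" if "Inner i j \<in> VT" for i j
    using that assms(1) by (auto simp: Inner_in I_def)
  have "inj_on g W1"
  proof -
    have xy: "x \<noteq> y" using assms(5) irr by auto
    have ne: "x \<noteq> \<omega> i" "y \<noteq> \<omega> i" if "i \<in> I" for i using \<omega>'[OF that] irr by metis+
    have "inj_on g (?last ` I)" using \<omega>(1) by (auto simp: inj_on_def g_def)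
    moreover have "g ` ?last ` I = \<omega> ` I" by (auto simp: g_def image_image)
    moreover have "x \<notin> \<omega> ` I" "y \<notin> \<omega> ` I" using ne by auto
    moreover have "g Source = x" "g Sink = y" by (simp_all add: g_def)
    moreover have "W1 = insert Source (insert Sink (?last ` I))" by (simp add: W1_def)
    moreover have "?last ` I - {Sink} = ?last ` I" "insert Sink (?last ` I) - {Source} = insert Sink (?last ` I)" by auto
    ultimately show ?thesis using xy by (simp only: inj_on_insert image_insert) simp
  qed
  moreover have "card W1 + card (VT - W1) \<le> card (A u)" if "u \<in> VT - W1" for u
  proof -
    have "card W1 + card (VT - W1) = h"
      using W1 by (metis card_Diff_subset card_mono finite_VT finite_subset h_def le_add_diff_inverse)
    moreover have "card (A u) = h"
      using that InI PQ by (cases u) (auto simp: A_def W1_def)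
    ultimately show ?thesis by simp
  qed
  ultimately obtain f where f: "inj_on f (W1 \<union> (VT - W1))" "\<And>u. u \<in> W1 \<Longrightarrow> f u = g u"
      "\<And>u. u \<in> VT - W1 \<Longrightarrow> f u \<in> A u"
    using distinct_extension[of W1 g "VT - W1" A] W1 finite_VT
    by (metis Diff_disjoint finite_Diff finite_subset)
  have side: "f (theta_path ps i j) \<in> (if odd j then snd (PQ i) else fst (PQ i))"
    if ij: "i \<in> I" "j < ps ! i" for i j
  proof (cases "j = 0")
    case True
    then show ?thesis using PQ[OF ij(1)] f(2)[of Source] by (simp add: theta_path_def W1_def g_def)
  next
    case False
    then have p: "theta_path ps i j = Inner i j" using ij by (simp add: theta_path_def)
    have inVT: "Inner i j \<in> VT" using False ij by (auto simp: Inner_in I_def)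
    show ?thesis
    proof (cases "Inner i j \<in> W1")
      case True
      then have "j = ps ! i - 1" by (auto simp: W1_def)
      then have "odd j" using even[OF ij(1)] by simp
      then show ?thesis using PQ[OF ij(1)] f(2)[OF True] p by (simp add: g_def)
    next
      case nin: False
      then show ?thesis using f(3)[of "Inner i j"] inVT p by (simp add: A_def)
    qed
  qed
  have "theta_emb ps E V f"
  proof (rule theta_embI)
    have "W1 \<union> (VT - W1) = VT" using W1 by auto
    then show "inj_on f VT" using f(1) by simp
    have "f u \<in> V" if "u \<in> VT" for u
    proof (cases "u \<in> W1")
      case True
      then show ?thesis using f(2) assms(3,4) \<omega>'(1) by (auto simp: W1_def g_def)
    next
      case False
      then have u: "f u \<in> A u" "u \<noteq> Source" "u \<noteq> Sink" using f(3) that by (auto simp: W1_def)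
      then obtain i j where ij: "u = Inner i j" by (cases u) auto
      then show ?thesis using u(1) PQ[OF InI[of i j]] that by (auto simp: A_def split: if_splits)
    qed
    then show "f ` VT \<subseteq> V" by auto
    fix i j assume ij: "i < length ps" "j < ps ! i"
    show "E (f (theta_path ps i j)) (f (theta_path ps i (Suc j)))"
    proof (cases "i = i0")
      case True
      then show ?thesis using ij assms(1,5) f(2)[of Source] f(2)[of Sink]
        by (simp add: theta_path_def W1_def g_def)
    next
      case False
      then have iI: "i \<in> I" using ij by (simp add: I_def)
      show ?thesis
      proof (cases "Suc j < ps ! i")
        case True
        then show ?thesis using side[OF iI, of j] side[OF iI True] PQ[OF iI] ij sym
          by (cases "odd j") auto
      next
        case last: False
        then have j: "j = ps ! i - 1" "Suc j = ps ! i" "j \<noteq> 0" using ij even[OF iI] by auto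
        then have "theta_path ps i j = ?last i" "?last i \<in> W1" "theta_path ps i (Suc j) = Sink"
          using ij iI by (auto simp: theta_path_def W1_def)
        then show ?thesis using f(2)[of "?last i"] f(2)[of Sink] \<omega>'(3)[OF iI] sym
          by (auto simp: g_def W1_def)
      qed
    qed
  qed
  then show ?thesis by blast
qed

text \<open>The second vertex of the path \<open>i0\<close> goes to \<open>y\<close> and its neighbours go to \<open>x\<close> and \<open>w\<close>.
  Without that vertex the theta graph is bipartite and fits into the \<open>K\<^bsub>h,h\<^esub>\<close> through \<open>x\<close> and \<open>w\<close>.\<close>

lemma embedding_long:
  assumes "2 \<le> ps ! i0" "x \<in> V" "y \<in> V" "w \<in> V" "E x y" "E x w" "E y w" "good E V h x w"
  shows "\<exists>f. theta_emb ps E V f"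
proof -
  obtain P Q where PQ: "P \<subseteq> V" "Q \<subseteq> V" "card P = h" "card Q = h" "x \<in> P" "w \<in> Q" "\<forall>p\<in>P. \<forall>q\<in>Q. E p q"
    using assms(8) unfolding good_def by (elim exE conjE)
  define A where "A u = (if col u then Q else P)" for u
  \<comment> \<open>\<open>?z\<close> is \<open>Sink\<close> if the path has length 2. In every case
    its colour is \<open>True\<close>, that of the side \<open>Q\<close> containing
    \<open>w\<close>.\<close>
  let ?z = "theta_path ps i0 2" and ?y = "Inner i0 1"
  have z: "?z \<noteq> Source" "?z \<noteq> ?y" "?z \<in> VT" "?y \<in> VT" "col ?z"
    using assms(1) i0 path_in[of i0 2] col_path_i0[of 2] by (auto simp: theta_path_def Inner_in)
  define g where "g u = (if u = Source then x else if u = ?y then y else w)" for u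
  define W1 where "W1 = {Source, ?y, ?z}"
  have W1: "W1 \<subseteq> VT" using z by (auto simp: W1_def)
  have "x \<noteq> y" "x \<noteq> w" "y \<noteq> w" using assms irr by metis+
  then have "inj_on g W1" using z by (auto simp: inj_on_def W1_def g_def)
  moreover have "card W1 + card (VT - W1) \<le> card (A u)" for u
  proof -
    have "card W1 + card (VT - W1) = h"
      using W1 by (metis card_Diff_subset card_mono finite_VT finite_subset h_def le_add_diff_inverse)
    then show ?thesis using PQ by (simp add: A_def)
  qed
  ultimately obtain f where f: "inj_on f (W1 \<union> (VT - W1))" "\<And>u. u \<in> W1 \<Longrightarrow> f u = g u"
      "\<And>u. u \<in> VT - W1 \<Longrightarrow> f u \<in> A u"
    using distinct_extension[of W1 g "VT - W1" A] W1 finite_VT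
    by (metis Diff_disjoint finite_Diff finite_subset)
  have fy: "f ?y = y" using f(2)[of ?y] by (simp add: W1_def g_def)
  have side: "f u \<in> A u" if "u \<in> VT" "u \<noteq> ?y" for u
  proof (cases "u \<in> W1")
    case True
    then show ?thesis using f(2)[OF True] that z PQ by (auto simp: W1_def g_def A_def col_Source)
  qed (use f(3) that in auto)
  have adj: "E (f u) (f v)" if "u \<in> VT" "v \<in> VT" "u \<noteq> ?y" "v \<noteq> ?y" "col u \<noteq> col v" for u v
    using side[OF that(1,3)] side[OF that(2,4)] that(5) PQ sym by (auto simp: A_def split: if_splits)
  have "theta_emb ps E V f"
  proof (rule theta_embI)
    have "W1 \<union> (VT - W1) = VT" using W1 by auto
    then show "inj_on f VT" using f(1) by simp
    have "f u \<in> V" if "u \<in> VT" for u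
      using side[OF that] fy assms PQ by (cases "u = ?y") (auto simp: A_def split: if_splits)
    then show "f ` VT \<subseteq> V" by auto
    fix i j assume ij: "i < length ps" "j < ps ! i"
    have inVT: "theta_path ps i j \<in> VT" "theta_path ps i (Suc j) \<in> VT" using ij by (auto intro: path_in)
    show "E (f (theta_path ps i j)) (f (theta_path ps i (Suc j)))"
    proof (cases "i = i0")
      case False
      have "col (theta_path ps i j) \<noteq> col (theta_path ps i (Suc j))"
        using col_path_other[OF ij(1) False] ij by simp
      moreover have "theta_path ps i j' \<noteq> ?y" for j' using False by (simp add: theta_path_def)
      ultimately show ?thesis using adj inVT by blast
    next
      case True
      consider "j = 0" | "j = 1" | "2 \<le> j" by linarith
      then show ?thesis
      proof cases
        case 1
        then show ?thesis using True assms(1,5) fy f(2)[of Source] by (simp add: theta_path_def W1_def g_def)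
      next
        case 2
        have "f ?z = w" using f(2)[of ?z] z by (simp add: W1_def g_def)
        moreover have "theta_path ps i j = ?y" using 2 True assms(1) by (simp add: theta_path_def)
        ultimately show ?thesis using 2 True fy assms(7) by (simp add: numeral_2_eq_2)
      next
        case 3
        then have "theta_path ps i j \<noteq> ?y" "theta_path ps i (Suc j) \<noteq> ?y" by (auto simp: theta_path_def)
        moreover have "col (theta_path ps i j) \<noteq> col (theta_path ps i (Suc j))" using col_path_i0[of j] col_path_i0[of "Suc j"] True 3 ij by simp
        ultimately show ?thesis using adj inVT by blast
      qed
    qed
  qed
  then show ?thesis by blast
qed

text \<open>If the path \<open>i0\<close> is a single edge, every other path takes a common
  neighbour of its own, and \<open>h\<close> of them suffice; otherwise one is enough.\<close>

lemma good_codegree: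
  assumes "finite V" "theta_free ps E V" "x \<in> V" "y \<in> V" "E x y"
  shows "card {w \<in> V. E x w \<and> E y w \<and> good E V h x w} < h"
proof (rule ccontr)
  let ?W = "{w \<in> V. E x w \<and> E y w \<and> good E V h x w}"
  assume "\<not> ?thesis"
  then have big: "h \<le> card ?W" by simp
  have "\<exists>f. theta_emb ps E V f"
  proof (cases "ps ! i0 = 1")
    case True
    then show ?thesis using embedding_short[OF True assms(1,3,4,5) order_refl big] by blast
  next
    case False
    then have "2 \<le> ps ! i0" using path_pos[OF i0] by linarith
    moreover have "?W \<noteq> {}"
    proof
      assume "?W = {}"
      then have "card ?W = 0" by (simp only: card.empty)
      then show False using big h_ge_2 by linarith
    qed
    then obtain w where "w \<in> ?W" by blast
    ultimately show ?thesis using embedding_long assms by blast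
  qed
  then show False using assms(2) by (auto simp: theta_free_def)
qed

end

lemma (in graph_rel) card_triples:
  assumes "finite V"
  shows "card (triples E V) = 6 * nc E 3 V"
proof -
  have two: "2 * nc E 2 (nb E V x) = (\<Sum>y\<in>nb E V x. card (nb E (nb E V x) y))" for x
    using assms by (intro two_nc_2) simp
  have "triples E V = (SIGMA x:V. SIGMA y:nb E V x. nb E (nb E V x) y)"
    by (auto simp: triples_def)
  then have "card (triples E V) = (\<Sum>x\<in>V. 2 * nc E 2 (nb E V x))"
    unfolding two using assms by (simp add: card_SigmaI)
  also have "\<dots> = 2 * (3 * nc E 3 V)"
    using three_nc_3[OF assms] by (simp add: sum_distrib_left)
  finally show ?thesis by simp
qed

lemma (in graph_rel) card_adjacent_pairs:
  assumes "finite S"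
  shows "card {(y, z). y \<in> S \<and> z \<in> S \<and> E y z} = 2 * nc E 2 S"
proof -
  have "{(y, z). y \<in> S \<and> z \<in> S \<and> E y z} = (SIGMA y:S. nb E S y)" by auto
  then show ?thesis using assms by (simp add: card_SigmaI two_nc_2)
qed

context critical_theta
begin

text \<open>Consider a triangle with a bad edge \<open>x y\<close> and third vertex
  \<open>z\<close>. If \<open>x z\<close> or \<open>y z\<close> is bad too, the triangle is an edge
  among the bad neighbours of \<open>x\<close> or \<open>y\<close>, and these span few edges by
  \<open>link_edges\<close>. Otherwise \<open>x z\<close> is good, and \<open>good_codegree\<close>
  allows fewer than \<open>h\<close> choices of \<open>z\<close>. Both counts are linear in the
  number of bad edges.\<close>

lemma few_triangles:
  fixes \<epsilon> :: real
  assumes "0 < \<epsilon>"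
  obtains n0 where "\<And>(E :: 'a \<Rightarrow> 'a \<Rightarrow> bool) V. graph_rel E \<Longrightarrow> finite V \<Longrightarrow> theta_free ps E V \<Longrightarrow>
    n0 \<le> card V \<Longrightarrow> nc E 3 V \<le> \<epsilon> * (real (card V))\<^sup>2"
proof -
  have h0: "0 < h" using h_ge_2 by simp
  \<comment> \<open>The bad edge has three positions in an ordered triangle. Per position the bound
    is \<open>5 * h * b\<close>: \<open>2 * h * b\<close> for a second bad edge at either end, and
    \<open>h * b\<close> for a good \<open>x z\<close>.\<close>
  have "0 < \<epsilon> / (15 * h)" using assms h0 by simp
  then obtain n1 where n1: "\<And>(E :: 'a \<Rightarrow> 'a \<Rightarrow> bool) V. finite V \<Longrightarrow> n1 \<le> card V \<Longrightarrow>
    (\<nexists>P Q. P \<subseteq> V \<and> Q \<subseteq> V \<and> card P = h \<and> card Q = h \<and> (\<forall>p\<in>P. \<forall>q\<in>Q. E p q)) \<Longrightarrow>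
    (\<Sum>v\<in>V. card (nb E V v)) \<le> \<epsilon> / (15 * h) * (real (card V))\<^sup>2"
    using kovari_sos_turan[OF _ h0] by blast
  obtain n2 where n2: "\<And>(E :: 'a \<Rightarrow> 'a \<Rightarrow> bool) V. graph_rel E \<Longrightarrow> finite V \<Longrightarrow> n2 \<le> card V \<Longrightarrow>
    (\<And>x y. x \<in> V \<Longrightarrow> y \<in> V \<Longrightarrow> E x y \<Longrightarrow> card {z \<in> V. E x z \<and> E y z} < h) \<Longrightarrow>
    card (triples E V) \<le> \<epsilon> * (real (card V))\<^sup>2"
    using ruzsa_szemeredi[OF assms] by blast
  show thesis
  proof (rule that[of "max n1 n2"])
    fix E :: "'a \<Rightarrow> 'a \<Rightarrow> bool" and V
    assume E: "graph_rel E" and V: "finite V" and free: "theta_free ps E V" and n: "max n1 n2 \<le> card V"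
    interpret graph_rel E by fact
    interpret critical_theta_graph ps i0 E by unfold_locales
    let ?n = "real (card V)"
    define G where "G x y \<longleftrightarrow> E x y \<and> good E V h x y" for x y
    define B where "B x y \<longleftrightarrow> E x y \<and> \<not> good E V h x y" for x y
    have Gsym: "G x y \<Longrightarrow> G y x" and Bsym: "B x y \<Longrightarrow> B y x" for x y
      unfolding G_def B_def using sym good_sym by blast+
    interpret G: graph_rel G
    proof
      show "G y x" if "G x y" for x y by (rule Gsym[OF that])
      show "\<not> G x x" for x using irr by (simp add: G_def)
    qed
    have codeg: "card {w \<in> V. E x w \<and> E y w \<and> good E V h x w} < h" if "x \<in> V" "y \<in> V" "E x y" for x y
      by (rule good_codegree[OF V free that])
    have trG: "card (triples G V) \<le> \<epsilon> * ?n\<^sup>2"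
    proof (rule n2[OF _ V])
      fix x y assume xy: "x \<in> V" "y \<in> V" "G x y"
      have "card {z \<in> V. G x z \<and> G y z} \<le> card {w \<in> V. E x w \<and> E y w \<and> good E V h x w}"
        using V by (intro card_mono) (auto simp: G_def)
      then show "card {z \<in> V. G x z \<and> G y z} < h" using codeg[of x y] xy by (simp add: G_def)
    qed (use n in \<open>auto intro: G.graph_rel_axioms\<close>)
    define b where "b = (\<Sum>v\<in>V. card (nb B V v))"
    have bb: "real b \<le> \<epsilon> / (15 * h) * ?n\<^sup>2"
      unfolding b_def
    proof (rule n1[OF V])
      show "\<nexists>P Q. P \<subseteq> V \<and> Q \<subseteq> V \<and> card P = h \<and> card Q = h \<and> (\<forall>p\<in>P. \<forall>q\<in>Q. B p q)"
      proof
        assume "\<exists>P Q. P \<subseteq> V \<and> Q \<subseteq> V \<and> card P = h \<and> card Q = h \<and> (\<forall>p\<in>P. \<forall>q\<in>Q. B p q)"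
        then obtain P Q where PQ: "P \<subseteq> V" "Q \<subseteq> V" "card P = h" "card Q = h" "\<forall>p\<in>P. \<forall>q\<in>Q. B p q"
          by blast
        have "P \<noteq> {}" "Q \<noteq> {}" using PQ(3,4) h0 by auto
        then obtain p q where pq: "p \<in> P" "q \<in> Q" by blast
        have "\<forall>p\<in>P. \<forall>q\<in>Q. E p q" using PQ(5) by (auto simp: B_def)
        then have "good E V h p q" unfolding good_def using PQ pq by blast
        then show False using PQ pq by (simp add: B_def)
      qed
    qed (use n in simp)
    define T where "T = {(x, y, z). (x, y, z) \<in> triples E V \<and> B x y}"
    define T1 where "T1 = (SIGMA x:V. {(y, z). y \<in> nb B V x \<and> z \<in> nb B V x \<and> E y z})"
    define T3 where "T3 = (SIGMA p:(SIGMA x:V. nb B V x). {w \<in> V. E (fst p) w \<and> E (snd p) w \<and> good E V h (fst p) w})"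
    have pairs_fin: "finite {(y, z). y \<in> S \<and> z \<in> S \<and> E y z}" if "finite S" for S
      by (rule finite_subset[of _ "S \<times> S"]) (use that in auto)
    have fin1: "finite T1" unfolding T1_def using V by (intro finite_SigmaI pairs_fin) auto
    have fin3: "finite T3" unfolding T3_def using V by (intro finite_SigmaI) auto
    have "card T1 = (\<Sum>x\<in>V. 2 * nc E 2 (nb B V x))"
      unfolding T1_def using V
      by (subst card_SigmaI) (auto intro!: pairs_fin card_adjacent_pairs sum.cong simp del: in_nb)
    also have "\<dots> \<le> (\<Sum>x\<in>V. 2 * (h * card (nb B V x)))"
      by (intro sum_mono mult_le_mono2 link_edges[OF V free]) (auto simp: B_def)
    also have "\<dots> = 2 * h * b" by (simp add: b_def sum_distrib_left mult.assoc)
    finally have c1: "card T1 \<le> 2 * h * b" .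
    have "card T3 = (\<Sum>p\<in>(SIGMA x:V. nb B V x). card {w \<in> V. E (fst p) w \<and> E (snd p) w \<and> good E V h (fst p) w})"
      unfolding T3_def using V by (intro card_SigmaI) auto
    also have "\<dots> \<le> (\<Sum>p\<in>(SIGMA x:V. nb B V x). h)"
      using codeg by (intro sum_mono less_imp_le) (auto simp: B_def)
    also have "\<dots> = h * b" using V by (simp add: b_def card_SigmaI)
    finally have c3: "card T3 \<le> h * b" .
    have "T \<subseteq> T1 \<union> (\<lambda>(y, x, z). (x, y, z)) ` T1 \<union> (\<lambda>((x, y), z). (x, y, z)) ` T3"
    proof
      fix w assume w: "w \<in> T"
      obtain x y z where xyz: "w = (x, y, z)" by (cases w)
      have p: "x \<in> V" "y \<in> V" "z \<in> V" "E x y" "E y z" "E x z" "B x y" "B y x"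
        using w xyz Bsym by (auto simp: T_def triples_def)
      consider "B x z" | "B y z" | "good E V h x z" using p by (auto simp: B_def)
      then show "w \<in> T1 \<union> (\<lambda>(y, x, z). (x, y, z)) ` T1 \<union> (\<lambda>((x, y), z). (x, y, z)) ` T3"
      proof cases
        case 1
        then have "(x, y, z) \<in> T1" using p by (auto simp: T1_def)
        then show ?thesis using xyz by simp
      next
        case 2
        then have "(y, x, z) \<in> T1" using p by (auto simp: T1_def)
        then show ?thesis using xyz by (force simp: image_iff)
      next
        case 3
        then have "((x, y), z) \<in> T3" using p by (auto simp: T3_def)
        then show ?thesis using xyz by (force simp: image_iff)
      qed
    qed
    then have "card T \<le> card (T1 \<union> (\<lambda>(y, x, z). (x, y, z)) ` T1 \<union> (\<lambda>((x, y), z). (x, y, z)) ` T3)"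
      using fin1 fin3 by (intro card_mono) auto
    also have "\<dots> \<le> card T1 + card ((\<lambda>(y, x, z). (x, y, z)) ` T1) + card ((\<lambda>((x, y), z). (x, y, z)) ` T3)"
      by (meson card_Un_le add_right_mono le_trans)
    also have "\<dots> \<le> card T1 + card T1 + card T3"
      by (intro add_mono card_image_le fin1 fin3 order_refl)
    also have "\<dots> \<le> 5 * (h * b)" using c1 c3 by linarith
    finally have cT: "card T \<le> 5 * (h * b)" .
    have finT: "finite T" by (rule finite_subset[OF _ finite_triples[OF V, of E]]) (auto simp: T_def)
    have "triples E V \<subseteq> triples G V \<union> T \<union> (\<lambda>(x, y, z). (z, x, y)) ` T \<union> (\<lambda>(x, y, z). (x, z, y)) ` T"
    proof
      fix w assume w: "w \<in> triples E V"
      obtain x y z where xyz: "w = (x, y, z)" by (cases w)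
      have p: "x \<in> V" "y \<in> V" "z \<in> V" "E x y" "E y z" "E x z"
        using w xyz by (auto simp: triples_def)
      note q = p p(4-6)[THEN sym]
      consider "B x y" | "B y z" | "B x z" | "G x y" "G y z" "G x z" using p by (auto simp: B_def G_def)
      then show "w \<in> triples G V \<union> T \<union> (\<lambda>(x, y, z). (z, x, y)) ` T \<union> (\<lambda>(x, y, z). (x, z, y)) ` T"
      proof cases
        case 1
        then show ?thesis using xyz w by (simp add: T_def)
      next
        case 2
        then have "(y, z, x) \<in> T" using q by (auto simp: T_def triples_def)
        then show ?thesis using xyz by (force simp: image_iff)
      next
        case 3
        then have "(x, z, y) \<in> T" using q by (auto simp: T_def triples_def)
        then show ?thesis using xyz by (force simp: image_iff)
      next
        case 4
        then show ?thesis using xyz p by (simp add: triples_def)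
      qed
    qed
    then have "card (triples E V) \<le> card (triples G V \<union> T \<union> (\<lambda>(x, y, z). (z, x, y)) ` T \<union> (\<lambda>(x, y, z). (x, z, y)) ` T)"
      using finT finite_triples[OF V] by (intro card_mono) auto
    also have "\<dots> \<le> card (triples G V) + card T + card ((\<lambda>(x, y, z). (z, x, y)) ` T) + card ((\<lambda>(x, y, z). (x, z, y)) ` T)"
      by (meson card_Un_le add_right_mono le_trans)
    also have "\<dots> \<le> card (triples G V) + card T + card T + card T"
      by (intro add_mono card_image_le finT order_refl)
    also have "\<dots> \<le> card (triples G V) + 15 * (h * b)" using cT by linarith
    finally have "6 * nc E 3 V \<le> card (triples G V) + 15 * (h * b)" using card_triples[OF V] by simp
    from of_nat_mono[OF this, where ?'a = real]
    have "6 * real (nc E 3 V) \<le> real (card (triples G V)) + real (15 * h) * real b" by simp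
    moreover have "15 * h * real b \<le> 15 * h * (\<epsilon> / (15 * h) * ?n\<^sup>2)" using bb by (intro mult_left_mono) auto
    moreover have "15 * h * (\<epsilon> / (15 * h) * ?n\<^sup>2) = \<epsilon> * ?n\<^sup>2" using h0 by simp
    moreover have "0 \<le> \<epsilon> * ?n\<^sup>2" using assms by simp
    ultimately show "nc E 3 V \<le> \<epsilon> * ?n\<^sup>2" using trG by linarith
  qed
qed

end

subsection \<open>Graphs that are almost complete bipartite\<close>

context graph_rel
begin

lemma sum_nb_missing:
  assumes "finite A" "finite B"
  shows "(\<Sum>a\<in>A. card (nb E B a)) + (\<Sum>a\<in>A. card (B - nb E B a)) = card A * card B"
proof -
  have "card (nb E B a) + card (B - nb E B a) = card B" for a
    using assms card_mono[OF assms(2) nb_subset[of E B a]] by (simp add: card_Diff_subset nb_subset)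
  then show ?thesis by (simp flip: sum.distrib)
qed

end

context critical_theta_graph
begin

text \<open>The critical edge goes to \<open>z z'\<close>, the colour class without its ends goes into the common
  neighbourhood of \<open>z\<close> and \<open>z'\<close> in \<open>Y\<close>, and the other vertices go into \<open>X\<close>.\<close>

lemma critical_edge_embedding:
  fixes \<mu> :: real
  assumes "finite V" "z \<in> V" "z' \<in> V" "E z z'" "X \<subseteq> V" "Y \<subseteq> V"
    and common: "h \<le> card {y \<in> Y. E z y \<and> E z' y}"
    and miss: "\<And>y. y \<in> Y \<Longrightarrow> real (card (X - nb E X y)) \<le> \<mu>"
    and X: "h + h * \<mu> \<le> card X"
  shows "\<exists>f. theta_emb ps E V f"
proof -
  let ?c = "theta_path ps i0 1"
  define W1 where "W1 = {Source, ?c}"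
  define W2 where "W2 = {u \<in> VT - W1. col u}"
  define W3 where "W3 = {u \<in> VT - W1. \<not> col u}"
  let ?Y = "{y \<in> Y. E z y \<and> E z' y}"
  have c: "?c \<noteq> Source" "?c \<in> VT" using path_in[of i0 1] path_pos[OF i0] i0 by (auto simp: theta_path_def)
  have fin: "finite W1" "finite W2" "finite W3" by (auto simp: W1_def W2_def W3_def)
  have W: "W1 \<union> W2 \<union> W3 = VT" using c by (auto simp: W1_def W2_def W3_def)
  have dis: "W1 \<inter> W2 = {}" "(W1 \<union> W2) \<inter> W3 = {}" by (auto simp: W2_def W3_def)
  have h: "card (W1 \<union> W2) + card W3 = h" "card W1 + card W2 = card (W1 \<union> W2)"
    using card_Un_disjoint[of "W1 \<union> W2" W3] card_Un_disjoint[of W1 W2] fin dis W by (auto simp: h_def)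
  define g where "g u = (if u = Source then z else z')" for u
  have "z \<noteq> z'" using assms irr by auto
  then have "inj_on g W1" using c by (auto simp: inj_on_def W1_def g_def)
  moreover have "card W1 + card W2 \<le> card ?Y" using h common by linarith
  ultimately obtain f1 where f1: "inj_on f1 (W1 \<union> W2)" "\<And>u. u \<in> W1 \<Longrightarrow> f1 u = g u" "\<And>u. u \<in> W2 \<Longrightarrow> f1 u \<in> ?Y"
    using distinct_extension[OF fin(1) _ fin(2) dis(1), of g "\<lambda>_. ?Y"] by blast
  \<comment> \<open>Every vertex chosen in \<open>Y\<close> misses at most \<open>\<mu>\<close>
    vertices of \<open>X\<close>, so \<open>W2\<close> as a whole rules out at most
    \<open>h * \<mu>\<close>.\<close>
  let ?A = "{x \<in> X. \<forall>v\<in>W2. E (f1 v) x}"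
  have finX: "finite X" using assms finite_subset by blast
  have "h \<le> card ?A"
  proof -
    have "X - ?A \<subseteq> (\<Union>v\<in>W2. X - nb E X (f1 v))" by auto
    then have "card (X - ?A) \<le> card (\<Union>v\<in>W2. X - nb E X (f1 v))"
      using finX fin by (intro card_mono) auto
    also have "\<dots> \<le> (\<Sum>v\<in>W2. card (X - nb E X (f1 v)))" by (rule card_UN_le) fact
    finally have "real (card (X - ?A)) \<le> (\<Sum>v\<in>W2. real (card (X - nb E X (f1 v))))"
      by (simp flip: of_nat_sum)
    also have "\<dots> \<le> (\<Sum>v\<in>W2. \<mu>)" using f1(3) miss by (intro sum_mono) auto
    also have "\<dots> = card W2 * \<mu>" by simp
    also have "\<dots> \<le> h * \<mu>"
    proof (cases "W2 = {}")
      case True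
      have "Y \<noteq> {}" using common h_ge_2 by auto
      then obtain y where "y \<in> Y" by blast
      then have "0 \<le> \<mu>" using miss[of y] by (meson of_nat_0_le_iff order_trans)
      then show ?thesis using True by simp
    next
      case False
      then obtain v where "v \<in> W2" by blast
      then have "f1 v \<in> Y" using f1(3) by blast
      then have "0 \<le> \<mu>" using miss[of "f1 v"] by (meson of_nat_0_le_iff order_trans)
      moreover have "card W2 \<le> h" using h by linarith
      ultimately show ?thesis by (intro mult_right_mono) auto
    qed
    finally have "real (card (X - ?A)) \<le> h * \<mu>" .
    moreover have "card X = card ?A + card (X - ?A)"
      using finX card_mono[of X ?A] by (subst card_Diff_subset) auto
    ultimately show ?thesis using X by linarith
  qed
  then have "card (W1 \<union> W2) + card W3 \<le> card ?A" using h by simp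
  then obtain f where f: "inj_on f (W1 \<union> W2 \<union> W3)" "\<And>u. u \<in> W1 \<union> W2 \<Longrightarrow> f u = f1 u" "\<And>u. u \<in> W3 \<Longrightarrow> f u \<in> ?A"
    using distinct_extension[OF _ f1(1) fin(3) dis(2), of "\<lambda>_. ?A"] fin by blast
  have fz: "f Source = z" "f ?c = z'"
    using f(2)[of Source] f(2)[of ?c] f1(2)[of Source] f1(2)[of ?c] c by (auto simp: W1_def g_def)
  have fY: "f u \<in> ?Y" if "u \<in> VT" "col u" for u
  proof -
    have "u \<in> W2" using that col_Source col_critical by (auto simp: W1_def W2_def)
    then show ?thesis using f(2)[of u] f1(3)[of u] by simp
  qed
  have adj: "E (f u) (f v)" if "u \<in> VT" "v \<in> VT" "col u" "\<not> col v" for u v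
  proof -
    have u: "u \<in> W2" using that col_Source col_critical by (auto simp: W1_def W2_def)
    show ?thesis
    proof (cases "v \<in> W1")
      case True
      then show ?thesis using fY[OF that(1,3)] fz sym by (auto simp: W1_def)
    next
      case False
      then have "f v \<in> ?A" using that f(3) by (auto simp: W3_def)
      then show ?thesis using u f(2)[of u] by auto
    qed
  qed
  have "theta_emb ps E V f"
  proof (rule theta_embI)
    show "inj_on f VT" using f(1) W by simp
    have "f u \<in> V" if u: "u \<in> VT" for u
    proof -
      consider "u \<in> W1" | "col u" | "u \<in> W3" using u unfolding W3_def by blast
      then show ?thesis
      proof cases
        case 1
        then show ?thesis using fz assms(2,3) by (auto simp: W1_def)
      next
        case 2
        then show ?thesis using fY[OF u] assms(6) by blast
      next
        case 3
        then show ?thesis using f(3) assms(5) by blast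
      qed
    qed
    then show "f ` VT \<subseteq> V" by auto
    fix i j assume ij: "i < length ps" "j < ps ! i"
    have inVT: "theta_path ps i j \<in> VT" "theta_path ps i (Suc j) \<in> VT" using ij by (auto intro: path_in)
    show "E (f (theta_path ps i j)) (f (theta_path ps i (Suc j)))"
    proof (cases "i = i0 \<and> j = 0")
      case True
      then have "theta_path ps i j = Source" "theta_path ps i (Suc j) = ?c" by (auto simp: theta_path_def)
      then show ?thesis using fz assms by simp
    next
      case False
      have "col (theta_path ps i j) \<noteq> col (theta_path ps i (Suc j))"
      proof (cases "i = i0")
        case True
        then show ?thesis using False ij col_path_i0[of j] col_path_i0[of "Suc j"] by simp
      next
        case other: False
        then show ?thesis using ij col_path_other[OF ij(1) other] by simp
      qed
      then show ?thesis using adj inVT sym by blast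
    qed
  qed
  then show ?thesis by blast
qed

text \<open>One half of the almost complete bipartite structure: \<open>X\<close> with the vertices \<open>ZA\<close> that have
  many neighbours in \<open>Y\<close>.\<close>

lemma half_structure:
  fixes \<gamma> \<eta> m :: real
  assumes fin: "finite V" and free: "theta_free ps E V" and sub: "X \<subseteq> V" "Y \<subseteq> V" "ZA \<subseteq> V"
    and mX: "\<And>x. x \<in> X \<Longrightarrow> card (Y - nb E Y x) \<le> \<gamma> * m"
    and mY: "\<And>y. y \<in> Y \<Longrightarrow> card (X - nb E X y) \<le> \<gamma> * m"
    and cX: "h + h * (\<gamma> * m) \<le> card X" and cY: "h + 2 * (\<gamma> * m) \<le> card Y"
    and dA: "\<And>z. z \<in> ZA \<Longrightarrow> \<eta> * m \<le> card (nb E Y z)" and \<eta>: "h + \<gamma> * m \<le> \<eta> * m"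
  defines "WA \<equiv> {z \<in> ZA. \<exists>z'\<in>ZA. E z z'}"
  shows "\<And>z z'. z \<in> V \<Longrightarrow> z' \<in> V \<Longrightarrow> E z z' \<Longrightarrow> card {y \<in> Y. E z y \<and> E z' y} < h"
    and "\<And>u v. u \<in> X \<union> ZA \<Longrightarrow> v \<in> X \<union> ZA \<Longrightarrow> E u v \<Longrightarrow> u \<in> WA \<and> v \<in> WA"
    and "\<And>z. z \<in> WA \<Longrightarrow> \<eta> * m - h \<le> card (Y - nb E Y z)"
proof -
  have finY: "finite Y" using fin sub finite_subset by blast
  \<comment> \<open>An edge with \<open>h\<close> common neighbours in \<open>Y\<close> could serve
    as the critical edge.\<close>
  show common: "card {y \<in> Y. E z y \<and> E z' y} < h" if "z \<in> V" "z' \<in> V" "E z z'" for z z'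
  proof (rule ccontr)
    assume "\<not> ?thesis"
    then have "\<exists>f. theta_emb ps E V f"
      using critical_edge_embedding[OF fin that sub(1,2) _ mY cX] by simp
    then show False using free by (simp add: theta_free_def)
  qed
  \<comment> \<open>Combined with \<open>common\<close>: the degrees into \<open>Y\<close> of
    adjacent vertices sum to less than \<open>card Y + h\<close>. This will exclude edges inside
    \<open>X\<close> and between \<open>X\<close> and \<open>ZA\<close>.\<close>
  have count: "real (card (nb E Y u)) + card (nb E Y v) \<le> card Y + card {y \<in> Y. E u y \<and> E v y}" for u v
  proof -
    have "card (nb E Y u) + card (nb E Y v) = card (nb E Y u \<union> nb E Y v) + card (nb E Y u \<inter> nb E Y v)"
      using finY by (intro card_Un_Int) auto
    moreover have "card (nb E Y u \<union> nb E Y v) \<le> card Y" using finY by (intro card_mono) auto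
    moreover have "nb E Y u \<inter> nb E Y v = {y \<in> Y. E u y \<and> E v y}" by auto
    ultimately show ?thesis by simp
  qed
  have cnb: "real (card (Y - nb E Y u)) = card Y - card (nb E Y u)" for u
    using finY card_mono[OF finY nb_subset[of E Y u]] by (simp add: card_Diff_subset nb_subset of_nat_diff)
  have common': "real (card {y \<in> Y. E z y \<and> E z' y}) < h" if "z \<in> V" "z' \<in> V" "E z z'" for z z'
    using common[OF that] by simp
  have XX: "\<not> E x x'" if x: "x \<in> X" "x' \<in> X" for x x'
  proof
    assume "E x x'"
    then have "real (card {y \<in> Y. E x y \<and> E x' y}) < h" using common' x sub by blast
    then show False
      using count[of x x'] mX[OF x(1)] mX[OF x(2)] cnb[of x] cnb[of x'] cY by linarith
  qed
  have AX: "\<not> E z x" if zx: "z \<in> ZA" "x \<in> X" for z x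
  proof
    assume "E z x"
    then have "real (card {y \<in> Y. E z y \<and> E x y}) < h" using common' zx sub by blast
    then show False
      using count[of z x] mX[OF zx(2)] dA[OF zx(1)] cnb[of x] \<eta> by linarith
  qed
  show "u \<in> WA \<and> v \<in> WA" if "u \<in> X \<union> ZA" "v \<in> X \<union> ZA" "E u v" for u v
    using that XX AX sym unfolding WA_def by blast
  \<comment> \<open>\<open>z\<close> misses all but fewer than \<open>h\<close> of the neighbours of
    \<open>z'\<close> in \<open>Y\<close>, and \<open>z'\<close> has at least
    \<open>\<eta> * m\<close> of them.\<close>
  show "\<eta> * m - h \<le> card (Y - nb E Y z)" if zW: "z \<in> WA" for z
  proof -
    obtain z' where z': "z' \<in> ZA" "E z z'" "z \<in> ZA" using zW by (auto simp: WA_def)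
    then have "real (card {y \<in> Y. E z y \<and> E z' y}) < h" using common' sub by blast
    then show ?thesis using count[of z z'] dA[OF z'(1)] cnb[of z] by linarith
  qed
qed

text \<open>The vertices of \<open>L\<close> are added one at a time; each contributes its degree
  and \<open>C\<close> times the edges of its link, which only grow when measured in the final
  graph.\<close>

lemma remove_low_degree:
  assumes "finite V1" "finite L" "V1 \<inter> L = {}"
  shows "nc E 2 (V1 \<union> L) + C * nc E 3 (V1 \<union> L)
    \<le> nc E 2 V1 + C * nc E 3 V1 + (\<Sum>z\<in>L. card (nb E (V1 \<union> L) z) + C * nc E 2 (nb E (V1 \<union> L) z))"
  using assms(2,3)
proof (induction L)
  case empty
  then show ?case by simp
next
  case (insert l L)
  let ?V = "V1 \<union> L"
  have fV: "finite ?V" "l \<notin> ?V" using insert assms by auto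
  have mono: "card (nb E ?V z) + C * nc E 2 (nb E ?V z)
      \<le> card (nb E (insert l ?V) z) + C * nc E 2 (nb E (insert l ?V) z)" for z
    using fV by (intro add_mono mult_le_mono2 card_mono nc_mono) (auto simp: nb_def)
  have "nc E 2 (insert l ?V) + C * nc E 3 (insert l ?V)
      = nc E 2 ?V + C * nc E 3 ?V + (card (nb E ?V l) + C * nc E 2 (nb E ?V l))"
    using fV by (simp add: nc_2_insert nc_3_insert algebra_simps)
  also have "\<dots> \<le> nc E 2 V1 + C * nc E 3 V1 + (\<Sum>z\<in>L. card (nb E ?V z) + C * nc E 2 (nb E ?V z))
      + (card (nb E ?V l) + C * nc E 2 (nb E ?V l))"
    using insert by simp
  also have "\<dots> \<le> nc E 2 V1 + C * nc E 3 V1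
      + (\<Sum>z\<in>L. card (nb E (insert l ?V) z) + C * nc E 2 (nb E (insert l ?V) z))
      + (card (nb E (insert l ?V) l) + C * nc E 2 (nb E (insert l ?V) l))"
    by (intro add_mono sum_mono mono order_refl)
  finally show ?case using insert by simp
qed

text \<open>Missing pairs at \<open>WA\<close> have their \<open>A\<close>-end in \<open>WA\<close>,
  those at \<open>WB\<close> have it in \<open>X\<close>; these sets are disjoint, so no pair is
  counted twice.\<close>

lemma missing_pairs_ge:
  fixes d :: real
  assumes fin: "finite A" "finite B" and sub: "WA \<subseteq> A" "Y \<subseteq> B" "WB \<subseteq> B" "X \<subseteq> A" and dis: "WA \<inter> X = {}"
    and dA: "\<And>z. z \<in> WA \<Longrightarrow> d \<le> card (Y - nb E Y z)" and dB: "\<And>z. z \<in> WB \<Longrightarrow> d \<le> card (X - nb E X z)"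
  shows "(card WA + card WB) * d \<le> (\<Sum>a\<in>A. card (B - nb E B a))"
proof -
  have finW: "finite WA" "finite WB" "finite X" "finite Y" using fin sub finite_subset by metis+
  let ?A = "SIGMA z:WA. Y - nb E Y z" and ?B = "SIGMA z:WB. X - nb E X z"
  let ?M = "SIGMA a:A. B - nb E B a"
  have "?A \<union> prod.swap ` ?B \<subseteq> ?M" using sub sym by auto
  then have "card (?A \<union> prod.swap ` ?B) \<le> card ?M" using fin by (intro card_mono) auto
  moreover have "card (?A \<union> prod.swap ` ?B) = card ?A + card (prod.swap ` ?B)"
    using finW dis by (intro card_Un_disjoint) auto
  moreover have "card (prod.swap ` ?B) = card ?B" by (intro card_image) auto
  ultimately have "card ?A + card ?B \<le> card ?M" by simp
  then have "(\<Sum>z\<in>WA. card (Y - nb E Y z)) + (\<Sum>z\<in>WB. card (X - nb E X z)) \<le> (\<Sum>a\<in>A. card (B - nb E B a))"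
    using fin finW by (simp add: card_SigmaI)
  from of_nat_mono[OF this, where ?'a = real]
  have "(\<Sum>z\<in>WA. real (card (Y - nb E Y z))) + (\<Sum>z\<in>WB. real (card (X - nb E X z)))
      \<le> real (\<Sum>a\<in>A. card (B - nb E B a))" by simp
  moreover have "card WA * d \<le> (\<Sum>z\<in>WA. real (card (Y - nb E Y z)))"
    using sum_mono[of WA "\<lambda>_. d"] dA by simp
  moreover have "card WB * d \<le> (\<Sum>z\<in>WB. real (card (X - nb E X z)))"
    using sum_mono[of WB "\<lambda>_. d"] dB by simp
  ultimately show ?thesis by (simp add: algebra_simps)
qed

lemma nc_2_le_endpoints:
  assumes "finite A" and W: "\<And>u v. u \<in> A \<Longrightarrow> v \<in> A \<Longrightarrow> E u v \<Longrightarrow> u \<in> W \<and> v \<in> W" and "W \<subseteq> A"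
  shows "nc E 2 A \<le> card W * card W"
proof -
  have "cliques E 2 A \<subseteq> cliques E 2 W"
  proof
    fix K assume "K \<in> cliques E 2 A"
    then have K: "K \<subseteq> A" "card K = 2" "clique E K" by (auto simp: cliques_def)
    obtain u v where uv: "K = {u, v}" "u \<noteq> v" using K(2) by (meson card_2_iff)
    then have "u \<in> W \<and> v \<in> W" using K W[of u v] by (auto simp: clique_def)
    then show "K \<in> cliques E 2 W" using K uv by (simp add: cliques_def)
  qed
  moreover have "finite W" using assms finite_subset by blast
  ultimately have "nc E 2 A \<le> nc E 2 W" unfolding nc_def by (intro card_mono) auto
  also have "\<dots> \<le> card W * card W" by (rule nc_2_le_square) fact
  finally show ?thesis .
qed

text \<open>Two of the three vertices lie on the same side, hence in \<open>WA\<close> or in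
  \<open>WB\<close>. The third is either in the opposite core, with at most \<open>h\<close>
  choices, or in \<open>Z\<close>, and then the triangle is an edge in the link, within
  \<open>Z\<close>, of a vertex of \<open>WA\<close> or \<open>WB\<close>.\<close>

lemma triangles_near_bipartite:
  assumes fin: "finite X" "finite Y" "finite Z"
    and sub: "ZA \<subseteq> Z" "ZB \<subseteq> Z" "WA \<subseteq> ZA" "WB \<subseteq> ZB"
    and WA: "\<And>u v. u \<in> X \<union> ZA \<Longrightarrow> v \<in> X \<union> ZA \<Longrightarrow> E u v \<Longrightarrow> u \<in> WA \<and> v \<in> WA"
    and WB: "\<And>u v. u \<in> Y \<union> ZB \<Longrightarrow> v \<in> Y \<union> ZB \<Longrightarrow> E u v \<Longrightarrow> u \<in> WB \<and> v \<in> WB"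
    and coY: "\<And>u v. u \<in> WA \<Longrightarrow> v \<in> WA \<Longrightarrow> E u v \<Longrightarrow> card {y \<in> Y. E u y \<and> E v y} \<le> h"
    and coX: "\<And>u v. u \<in> WB \<Longrightarrow> v \<in> WB \<Longrightarrow> E u v \<Longrightarrow> card {x \<in> X. E u x \<and> E v x} \<le> h"
    and link: "\<And>w. w \<in> WA \<union> WB \<Longrightarrow> nc E 2 (nb E Z w) \<le> h * card Z"
  shows "nc E 3 ((X \<union> ZA) \<union> (Y \<union> ZB)) \<le> h * (card WA * card WA + card WB * card WB) + (card WA + card WB) * (h * card Z)"
proof -
  let ?V = "(X \<union> ZA) \<union> (Y \<union> ZB)"
  define out where "out W Y = (\<Union>p\<in>{p \<in> W \<times> W. E (fst p) (snd p)}. (\<lambda>y. {fst p, snd p, y}) ` {y \<in> Y. E (fst p) y \<and> E (snd p) y})" for W Y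
  define inn where "inn = (\<Union>w\<in>WA \<union> WB. insert w ` cliques E 2 (nb E Z w))"
  have finW: "finite WA" "finite WB" using fin sub by (meson finite_subset)+
  have card_out: "card (out W Y') \<le> card W * card W * h"
    if "finite W" "finite Y'" "\<And>u v. u \<in> W \<Longrightarrow> v \<in> W \<Longrightarrow> E u v \<Longrightarrow> card {y \<in> Y'. E u y \<and> E v y} \<le> h" for W Y'
  proof -
    let ?P = "{p \<in> W \<times> W. E (fst p) (snd p)}"
    have finP: "finite ?P" using that by simp
    have "card (out W Y') \<le> (\<Sum>p\<in>?P. card ((\<lambda>y. {fst p, snd p, y}) ` {y \<in> Y'. E (fst p) y \<and> E (snd p) y}))"
      unfolding out_def by (rule card_UN_le) fact
    also have "\<dots> \<le> (\<Sum>p\<in>?P. h)"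
    proof (intro sum_mono)
      fix p assume p: "p \<in> ?P"
      have "card ((\<lambda>y. {fst p, snd p, y}) ` {y \<in> Y'. E (fst p) y \<and> E (snd p) y}) \<le> card {y \<in> Y'. E (fst p) y \<and> E (snd p) y}"
        using that by (intro card_image_le) simp
      also have "\<dots> \<le> h" using p that(3)[of "fst p" "snd p"] by auto
      finally show "card ((\<lambda>y. {fst p, snd p, y}) ` {y \<in> Y'. E (fst p) y \<and> E (snd p) y}) \<le> h" .
    qed
    also have "\<dots> = card ?P * h" by simp
    also have "\<dots> \<le> card (W \<times> W) * h" using that by (intro mult_le_mono1 card_mono) auto
    finally show ?thesis by (simp add: card_cartesian_product)
  qed
  have "card inn \<le> (\<Sum>w\<in>WA \<union> WB. card (insert w ` cliques E 2 (nb E Z w)))"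
    unfolding inn_def using finW by (intro card_UN_le) simp
  also have "\<dots> \<le> (\<Sum>w\<in>WA \<union> WB. h * card Z)"
  proof (intro sum_mono)
    fix w assume w: "w \<in> WA \<union> WB"
    have "card (insert w ` cliques E 2 (nb E Z w)) \<le> nc E 2 (nb E Z w)"
      unfolding nc_def using fin by (intro card_image_le) simp
    then show "card (insert w ` cliques E 2 (nb E Z w)) \<le> h * card Z" using link[OF w] by linarith
  qed
  also have "\<dots> = card (WA \<union> WB) * (h * card Z)" by simp
  also have "\<dots> \<le> (card WA + card WB) * (h * card Z)" by (intro mult_le_mono1 card_Un_le)
  finally have card_inn: "card inn \<le> (card WA + card WB) * (h * card Z)" .
  have inn: "{u, v, t} \<in> inn"
    if "u \<in> WA \<union> WB" "v \<in> Z" "t \<in> Z" "E u v" "E u t" "E v t" for u v t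
  proof -
    have "v \<noteq> t" using that irr by auto
    then have "{v, t} \<in> cliques E 2 (nb E Z u)"
      using that sym by (auto simp: cliques_def clique_def)
    then show ?thesis unfolding inn_def using that(1) by blast
  qed
  have half: "{u, v, t} \<in> out WA Y \<union> out WB X \<union> inn"
    if uv: "u \<in> X \<union> ZA" "v \<in> X \<union> ZA" and t: "t \<in> ?V" and E3: "E u v" "E u t" "E v t" for u v t
  proof -
    have W: "u \<in> WA" "v \<in> WA" using WA[OF uv E3(1)] by auto
    consider "t \<in> X \<union> ZA" | "t \<in> Y" | "t \<in> ZB" using t by blast
    then show ?thesis
    proof cases
      case 1
      then have "t \<in> WA" using WA[OF uv(1) 1 E3(2)] by auto
      then show ?thesis using inn[of u v t] W E3 sub by blast
    next
      case 2
      have "{u, v, t} \<in> out WA Y"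
        unfolding out_def using W E3 2 by (auto intro!: bexI[of _ "(u, v)"])
      then show ?thesis by blast
    next
      case 3
      then show ?thesis using inn[of u v t] W E3 sub by blast
    qed
  qed
  have half': "{u, v, t} \<in> out WA Y \<union> out WB X \<union> inn"
    if uv: "u \<in> Y \<union> ZB" "v \<in> Y \<union> ZB" and t: "t \<in> ?V" and E3: "E u v" "E u t" "E v t" for u v t
  proof -
    have W: "u \<in> WB" "v \<in> WB" using WB[OF uv E3(1)] by auto
    consider "t \<in> Y \<union> ZB" | "t \<in> X" | "t \<in> ZA" using t by blast
    then show ?thesis
    proof cases
      case 1
      then have "t \<in> WB" using WB[OF uv(1) 1 E3(2)] by auto
      then show ?thesis using inn[of u v t] W E3 sub by blast
    next
      case 2
      have "{u, v, t} \<in> out WB X"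
        unfolding out_def using W E3 2 by (auto intro!: bexI[of _ "(u, v)"])
      then show ?thesis by blast
    next
      case 3
      then show ?thesis using inn[of u v t] W E3 sub by blast
    qed
  qed
  have "cliques E 3 ?V \<subseteq> out WA Y \<union> out WB X \<union> inn"
  proof
    fix K assume "K \<in> cliques E 3 ?V"
    then have K: "K \<subseteq> ?V" "card K = 3" "clique E K" by (auto simp: cliques_def)
    obtain a b c where abc: "K = {a, b, c}" "a \<noteq> b" "b \<noteq> c" "a \<noteq> c" using K(2) by (auto simp: card_3_iff)
    then have E3: "E a b" "E b c" "E a c" "E b a" "E c b" "E c a" using K(3) by (auto simp: clique_def)
    have in3: "a \<in> ?V" "b \<in> ?V" "c \<in> ?V" using K(1) abc(1) by auto
    have perm: "K = {a, c, b}" "K = {b, c, a}" using abc(1) by auto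
    consider "a \<in> X \<union> ZA" "b \<in> X \<union> ZA" | "a \<in> X \<union> ZA" "c \<in> X \<union> ZA" | "b \<in> X \<union> ZA" "c \<in> X \<union> ZA"
      | "a \<in> Y \<union> ZB" "b \<in> Y \<union> ZB" | "a \<in> Y \<union> ZB" "c \<in> Y \<union> ZB" | "b \<in> Y \<union> ZB" "c \<in> Y \<union> ZB"
      using in3 by blast
    then show "K \<in> out WA Y \<union> out WB X \<union> inn"
    proof cases
      case 1 then show ?thesis using half[of a b c] in3 E3 unfolding abc(1) by blast
    next
      case 2 then show ?thesis using half[of a c b] in3 E3 unfolding perm(1) by blast
    next
      case 3 then show ?thesis using half[of b c a] in3 E3 unfolding perm(2) by blast
    next
      case 4 then show ?thesis using half'[of a b c] in3 E3 unfolding abc(1) by blast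
    next
      case 5 then show ?thesis using half'[of a c b] in3 E3 unfolding perm(1) by blast
    next
      case 6 then show ?thesis using half'[of b c a] in3 E3 unfolding perm(2) by blast
    qed
  qed
  moreover have "finite (out WA Y \<union> out WB X \<union> inn)"
    using fin finW by (auto simp: out_def inn_def)
  ultimately have "nc E 3 ?V \<le> card (out WA Y \<union> out WB X \<union> inn)"
    unfolding nc_def by (rule card_mono[rotated])
  also have "\<dots> \<le> card (out WA Y) + card (out WB X) + card inn"
    by (meson card_Un_le add_right_mono le_trans)
  also have "\<dots> \<le> card WA * card WA * h + card WB * card WB * h + (card WA + card WB) * (h * card Z)"
    using finW fin coX coY by (intro add_mono card_out card_inn) auto
  finally show ?thesis by (simp add: algebra_simps)
qed

end

context critical_theta_graph
begin

text \<open>Let \<open>w = card WA + card WB\<close>. Edges inside the sides and triangles gain at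
  most \<open>w\<close> times a small multiple of \<open>m\<close>, while at least
  \<open>w * (\<eta> * m - h)\<close> pairs across are missing; \<open>par(4)\<close> says that the
  loss prevails. What remains is the product of the two side sizes.\<close>

lemma near_bipartite_bound:
  fixes \<gamma> \<eta> \<zeta> m :: real and C :: nat
  assumes fin: "finite V" and free: "theta_free ps E V" and m: "m = card V"
    and sub: "X \<subseteq> V" "Y \<subseteq> V" "X \<inter> Y = {}" and cZ: "card (V - X - Y) \<le> \<zeta> * m"
    and mX: "\<And>x. x \<in> X \<Longrightarrow> card (Y - nb E Y x) \<le> \<gamma> * m"
    and mY: "\<And>y. y \<in> Y \<Longrightarrow> card (X - nb E X y) \<le> \<gamma> * m"
    and cX: "h + h * (\<gamma> * m) \<le> card X" and cY: "h + h * (\<gamma> * m) \<le> card Y"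
    and par: "0 \<le> \<gamma>" "h + \<gamma> * m \<le> \<eta> * m" "(2 * \<eta> + \<zeta>) * (1 + real C * h) \<le> 1 / 4"
      "h + \<zeta> * m + C * (2 * h * (\<zeta> * m)) \<le> \<eta> * m"
  shows "nc E 2 V + C * nc E 3 V \<le> m\<^sup>2 / 4"
proof -
  define Z where "Z = V - X - Y"
  \<comment> \<open>A leftover vertex with many neighbours in \<open>Y\<close> joins the side of
    \<open>X\<close>, and vice versa; \<open>L\<close> collects those with few neighbours in both
    cores.\<close>
  define ZA where "ZA = {z \<in> Z. \<eta> * m \<le> card (nb E Y z)}"
  define ZB where "ZB = {z \<in> Z. \<eta> * m \<le> card (nb E X z)}"
  define L where "L = Z - ZA - ZB"
  define WA where "WA = {z \<in> ZA. \<exists>z'\<in>ZA. E z z'}"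
  define WB where "WB = {z \<in> ZB. \<exists>z'\<in>ZB. E z z'}"
  have ZV: "ZA \<subseteq> Z" "ZB \<subseteq> Z" "Z \<subseteq> V" "ZA \<subseteq> V" "ZB \<subseteq> V" "L \<subseteq> V" "WA \<subseteq> ZA" "WB \<subseteq> ZB"
    by (auto simp: ZA_def ZB_def Z_def L_def WA_def WB_def)
  have fins: "finite X" "finite Y" "finite Z" "finite ZA" "finite ZB" "finite L" "finite WA" "finite WB"
    using fin sub ZV by (meson finite_subset)+
  have m0: "0 \<le> m" using m by simp
  then have \<gamma>m: "0 \<le> \<gamma> * m" using par by simp
  then have "2 * (\<gamma> * m) \<le> h * (\<gamma> * m)" using h_ge_2 by (intro mult_right_mono) auto
  then have c2: "h + 2 * (\<gamma> * m) \<le> card X" "h + 2 * (\<gamma> * m) \<le> card Y" using cX cY by linarith+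
  have dA: "\<eta> * m \<le> card (nb E Y z)" if "z \<in> ZA" for z using that by (simp add: ZA_def)
  have dB: "\<eta> * m \<le> card (nb E X z)" if "z \<in> ZB" for z using that by (simp add: ZB_def)
  note A = half_structure[OF fin free sub(1,2) ZV(4) mX mY cX c2(2) dA par(2), folded WA_def]
  note B = half_structure[OF fin free sub(2,1) ZV(5) mY mX cY c2(1) dB par(2), folded WB_def]
  have disZ: "X \<inter> Z = {}" "Y \<inter> Z = {}" by (auto simp: Z_def)
  \<comment> \<open>A vertex of both sets lies in \<open>ZA\<close> and has a neighbour
    \<open>x\<close> in \<open>X\<close>, which puts \<open>x\<close> into \<open>WA\<close>; but
    \<open>WA\<close> is disjoint from \<open>X\<close>.\<close>
  have disAB: "ZA \<inter> ZB = {}"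
  proof (rule ccontr)
    assume "ZA \<inter> ZB \<noteq> {}"
    then obtain z where z: "z \<in> ZA" "z \<in> ZB" by blast
    have "0 < real (card (nb E X z))" using dB[OF z(2)] par(2) \<gamma>m h_ge_2 by linarith
    then have "nb E X z \<noteq> {}" by (metis card.empty less_irrefl of_nat_0)
    then obtain x where x: "x \<in> X" "E z x" by auto
    then have "x \<in> WA" using A(2)[of z x] z by blast
    then show False using x ZV disZ by blast
  qed
  define V1 where "V1 = (X \<union> ZA) \<union> (Y \<union> ZB)"
  have V: "V = V1 \<union> L" "V1 \<inter> L = {}"
    using sub by (auto simp: V1_def L_def ZA_def ZB_def Z_def)
  have dis: "(X \<union> ZA) \<inter> (Y \<union> ZB) = {}" using sub disAB disZ ZV by blast
  let ?a = "card (X \<union> ZA)" and ?b = "card (Y \<union> ZB)" and ?wa = "real (card WA)" and ?wb = "real (card WB)"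
  have XA: "nc E 2 (X \<union> ZA) \<le> card WA * card WA"
    using A(2) ZV fins by (intro nc_2_le_endpoints) auto
  have YB: "nc E 2 (Y \<union> ZB) \<le> card WB * card WB"
    using B(2) ZV fins by (intro nc_2_le_endpoints) auto
  have miss: "(card WA + card WB) * (\<eta> * m - h) \<le> (\<Sum>a\<in>X \<union> ZA. card ((Y \<union> ZB) - nb E (Y \<union> ZB) a))"
    by (rule missing_pairs_ge[where X = X and Y = Y]) (use A(3) B(3) ZV disZ fins in auto)
  have "nc E 2 V1 = nc E 2 (X \<union> ZA) + nc E 2 (Y \<union> ZB) + (\<Sum>a\<in>X \<union> ZA. card (nb E (Y \<union> ZB) a))"
    unfolding V1_def by (rule nc_2_union) (use fins dis in auto)
  then have "nc E 2 V1 + (\<Sum>a\<in>X \<union> ZA. card ((Y \<union> ZB) - nb E (Y \<union> ZB) a))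
      \<le> card WA * card WA + card WB * card WB + ?a * ?b"
    using XA YB sum_nb_missing[of "X \<union> ZA" "Y \<union> ZB"] fins by simp
  from of_nat_mono[OF this, where ?'a = real]
  have e1: "real (nc E 2 V1) \<le> ?wa * ?wa + ?wb * ?wb + ?a * ?b - (?wa + ?wb) * (\<eta> * m - h)"
    using miss by simp
  have "nc E 3 V1 \<le> h * (card WA * card WA + card WB * card WB) + (card WA + card WB) * (h * card Z)"
    unfolding V1_def
  proof (rule triangles_near_bipartite[where ZA = ZA and ZB = ZB])
    show "card {y \<in> Y. E u y \<and> E v y} \<le> h" if "u \<in> WA" "v \<in> WA" "E u v" for u v
      using A(1)[of u v] that ZV by (meson less_imp_le subsetD)
    show "card {x \<in> X. E u x \<and> E v x} \<le> h" if "u \<in> WB" "v \<in> WB" "E u v" for u v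
      using B(1)[of u v] that ZV by (meson less_imp_le subsetD)
    show "nc E 2 (nb E Z w) \<le> h * card Z" if "w \<in> WA \<union> WB" for w
    proof -
      have "nc E 2 (nb E Z w) \<le> h * card (nb E Z w)"
        using that ZV by (intro link_edges[OF fin free, of w]) (auto simp: nb_def)
      also have "\<dots> \<le> h * card Z" using fins by (intro mult_le_mono2 card_mono nb_subset)
      finally show ?thesis .
    qed
  qed (use A(2) B(2) ZV fins in auto)
  from of_nat_mono[OF this, where ?'a = real]
  have t1: "real (nc E 3 V1) \<le> h * (?wa * ?wa + ?wb * ?wb) + (?wa + ?wb) * (h * card Z)" by simp
  have "card WA + card WB = card (WA \<union> WB)" using fins ZV disAB by (subst card_Un_disjoint) auto
  also have "\<dots> \<le> card Z" using fins ZV by (intro card_mono) auto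
  finally have w_le: "?wa + ?wb \<le> \<zeta> * m" using cZ by (simp add: Z_def)
  define w where "w = ?wa + ?wb"
  have w0: "0 \<le> w" by (simp add: w_def)
  have cZ': "real (card Z) \<le> \<zeta> * m" using cZ by (simp add: Z_def)
  have sq: "?wa * ?wa + ?wb * ?wb \<le> w * (\<zeta> * m)"
  proof -
    have "?wa * ?wa + ?wb * ?wb \<le> w * w" by (simp add: w_def algebra_simps)
    also have "\<dots> \<le> w * (\<zeta> * m)" using w_le w0 by (intro mult_left_mono) (auto simp: w_def)
    finally show ?thesis .
  qed
  have "h * (?wa * ?wa + ?wb * ?wb) \<le> h * (w * (\<zeta> * m))" using sq by (intro mult_left_mono) auto
  moreover have "w * (h * real (card Z)) \<le> w * (h * (\<zeta> * m))" using cZ' w0 by (intro mult_left_mono) auto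
  ultimately have "real (nc E 3 V1) \<le> w * (2 * h * (\<zeta> * m))"
    using t1 by (simp add: w_def[symmetric] algebra_simps)
  then have "C * real (nc E 3 V1) \<le> C * (w * (2 * h * (\<zeta> * m)))" by (intro mult_left_mono) auto
  then have "nc E 2 V1 + C * real (nc E 3 V1) \<le> w * (\<zeta> * m) + ?a * ?b - w * (\<eta> * m - h) + C * (w * (2 * h * (\<zeta> * m)))"
    using e1 sq unfolding w_def[symmetric] by linarith
  also have "\<dots> = ?a * ?b + w * (h + \<zeta> * m + C * (2 * h * (\<zeta> * m)) - \<eta> * m)"
    by (simp add: algebra_simps)
  also have "\<dots> \<le> ?a * ?b" using par(4) w0 by (simp add: mult_nonneg_nonpos)
  also have "\<dots> \<le> (real ?a + ?b)\<^sup>2 / 4"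
    using zero_le_power2[of "real ?a - ?b"] by (simp add: power2_eq_square algebra_simps)
  also have "real ?a + ?b = card V1"
    unfolding V1_def using fins dis by (simp add: card_Un_disjoint)
  finally have V1: "nc E 2 V1 + C * real (nc E 3 V1) \<le> (real (card V1))\<^sup>2 / 4" .
  have low: "real (card (nb E V z) + C * nc E 2 (nb E V z)) \<le> m / 4" if z: "z \<in> L" for z
  proof -
    have zV: "z \<in> V" using z ZV by blast
    have "nb E V z \<subseteq> nb E X z \<union> nb E Y z \<union> Z" by (auto simp: Z_def)
    then have "card (nb E V z) \<le> card (nb E X z \<union> nb E Y z \<union> Z)" using fins by (intro card_mono) auto
    also have "\<dots> \<le> card (nb E X z) + card (nb E Y z) + card Z"
      by (meson card_Un_le add_right_mono le_trans)
    finally have "real (card (nb E V z)) \<le> real (card (nb E X z) + card (nb E Y z) + card Z)" by (rule of_nat_mono)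
    moreover have "card (nb E X z) < \<eta> * m" "card (nb E Y z) < \<eta> * m"
      using z by (auto simp: L_def ZA_def ZB_def)
    ultimately have d: "real (card (nb E V z)) \<le> (2 * \<eta> + \<zeta>) * m" using cZ' by (simp add: algebra_simps)
    have "nc E 2 (nb E V z) \<le> h * card (nb E V z)" by (rule link_edges[OF fin free zV order_refl])
    then have "card (nb E V z) + C * nc E 2 (nb E V z) \<le> card (nb E V z) + C * (h * card (nb E V z))"
      by (intro add_mono mult_le_mono2) auto
    from of_nat_mono[OF this, where ?'a = real]
    have "real (card (nb E V z) + C * nc E 2 (nb E V z)) \<le> (1 + real C * h) * real (card (nb E V z))"
      by (simp add: algebra_simps)
    also have "\<dots> \<le> (1 + real C * h) * ((2 * \<eta> + \<zeta>) * m)" using d by (intro mult_left_mono) auto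
    also have "\<dots> = ((2 * \<eta> + \<zeta>) * (1 + real C * h)) * m" by simp
    also have "\<dots> \<le> 1 / 4 * m" using par(3) m0 by (intro mult_right_mono) auto
    finally show ?thesis by simp
  qed
  have "nc E 2 V + C * nc E 3 V \<le> nc E 2 V1 + C * nc E 3 V1 + (\<Sum>z\<in>L. card (nb E V z) + C * nc E 2 (nb E V z))"
    using remove_low_degree[of V1 L C] V fins fin by (metis finite_Un)
  from of_nat_mono[OF this, where ?'a = real]
  have "real (nc E 2 V + C * nc E 3 V) \<le> nc E 2 V1 + C * real (nc E 3 V1) + (\<Sum>z\<in>L. real (card (nb E V z) + C * nc E 2 (nb E V z)))"
    by simp
  also have "\<dots> \<le> (real (card V1))\<^sup>2 / 4 + (\<Sum>z\<in>L. m / 4)" by (intro add_mono V1 sum_mono low)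
  also have "\<dots> = (real (card V1))\<^sup>2 / 4 + card L * m / 4" by simp
  also have "real (card V1) = m - card L"
    using card_Un_disjoint[of V1 L] V fin fins unfolding m by (metis finite_Un of_nat_add add_diff_cancel_right')
  \<comment> \<open>Removing a low vertex lowers \<open>m\<^sup>2 / 4\<close> by enough to pay its
    \<open>m / 4\<close>, since \<open>card L\<close> is at most \<open>m\<close>.\<close>
  also have "(m - card L)\<^sup>2 / 4 + card L * m / 4 = m\<^sup>2 / 4 - card L * (m - card L) / 4"
    by (simp add: power2_eq_square algebra_simps add_divide_distrib diff_divide_distrib)
  also have "\<dots> \<le> m\<^sup>2 / 4"
  proof -
    have "card L \<le> card V" using fin ZV by (intro card_mono) auto
    then show ?thesis using m by simp
  qed
  finally show ?thesis by simp
qed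

end

section \<open>Stability of dense theta-free graphs\<close>

context graph_rel
begin

lemma sum_nb_swap:
  assumes "finite A" "finite B"
  shows "(\<Sum>a\<in>A. card (nb E B a)) = (\<Sum>b\<in>B. card (nb E A b))"
proof -
  have "(\<Sum>a\<in>A. \<Sum>b\<in>B. if E a b then 1 else 0) = (\<Sum>b\<in>B. \<Sum>a\<in>A. if E a b then 1::nat else 0)"
    by (rule sum.swap)
  moreover have "{a \<in> A. E a b} = nb E A b" for b using sym by auto
  ultimately show ?thesis using assms by (simp add: sum.If_cases Int_def nb_def)
qed

text \<open>Average \<open>|N(x) \<union> N(y)|\<close>, the sum of the two degrees minus the codegree, over all edges.\<close>

lemma edge_with_large_neighbourhood:
  fixes \<delta> m :: real
  assumes V: "finite V" and m: "m = card V" "24 < m" and \<delta>: "0 < \<delta>" "\<delta> \<le> 1 / 8"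
    and e: "(1 / 4 - \<delta>) * m\<^sup>2 \<le> nc E 2 V" and t: "nc E 3 V \<le> \<delta> * m\<^sup>2"
  shows "\<exists>x y. x \<in> V \<and> y \<in> V \<and> E x y \<and> (1 - 5 * \<delta>) * m \<le> card (nb E V x \<union> nb E V y)"
proof (rule ccontr)
  assume none: "\<not> ?thesis"
  have small: "real (card (nb E V x \<union> nb E V y)) \<le> (1 - 5 * \<delta>) * m" if "x \<in> V" "y \<in> V" "E x y" for x y
    using none that linear by blast
  let ?d = "\<lambda>x. card (nb E V x)" and ?K = "(1 - 5 * \<delta>) * m" and ?e = "real (nc E 2 V)"
  have sumd: "(\<Sum>x\<in>V. real (?d x)) = 2 * ?e"
    using two_nc_2[OF V] by (metis of_nat_mult of_nat_numeral of_nat_sum)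
  have "(\<Sum>x\<in>V. \<Sum>y\<in>nb E V x. ?d x + ?d y) = (\<Sum>x\<in>V. \<Sum>y\<in>nb E V x. card (nb E V x \<union> nb E V y) + card (nb E (nb E V x) y))"
  proof (intro sum.cong refl)
    fix x y
    have "nb E (nb E V x) y = nb E V x \<inter> nb E V y" by auto
    then show "?d x + ?d y = card (nb E V x \<union> nb E V y) + card (nb E (nb E V x) y)"
      using card_Un_Int[of "nb E V x" "nb E V y"] V by simp
  qed
  moreover have "(\<Sum>x\<in>V. \<Sum>y\<in>nb E V x. ?d x + ?d y) = 2 * (\<Sum>x\<in>V. ?d x * ?d x)"
  proof -
    have "(\<Sum>x\<in>V. \<Sum>y\<in>nb E V x. ?d y) = (\<Sum>x\<in>V. \<Sum>y\<in>V. if E x y then ?d y else 0)"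
      using V by (intro sum.cong[OF refl]) (unfold nb_def, simp add: sum.inter_filter)
    also have "\<dots> = (\<Sum>y\<in>V. \<Sum>x\<in>V. if E x y then ?d y else 0)" by (rule sum.swap)
    also have "\<dots> = (\<Sum>y\<in>V. ?d y * ?d y)"
    proof (intro sum.cong refl)
      fix y
      have "{x \<in> V. E x y} = nb E V y" using sym by auto
      then show "(\<Sum>x\<in>V. if E x y then ?d y else 0) = ?d y * ?d y"
        using V by (simp add: sum.If_cases Int_def)
    qed
    finally show ?thesis by (simp add: sum.distrib)
  qed
  moreover have "(\<Sum>x\<in>V. \<Sum>y\<in>nb E V x. card (nb E (nb E V x) y)) = 6 * nc E 3 V"
  proof -
    have "(\<Sum>x\<in>V. \<Sum>y\<in>nb E V x. card (nb E (nb E V x) y)) = (\<Sum>x\<in>V. 2 * nc E 2 (nb E V x))"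
      using V by (intro sum.cong refl two_nc_2[symmetric]) simp
    also have "\<dots> = 2 * (3 * nc E 3 V)" using three_nc_3[OF V] by (simp add: sum_distrib_left)
    finally show ?thesis by simp
  qed
  ultimately have "2 * (\<Sum>x\<in>V. ?d x * ?d x) = (\<Sum>x\<in>V. \<Sum>y\<in>nb E V x. card (nb E V x \<union> nb E V y)) + 6 * nc E 3 V"
    by (simp add: sum.distrib)
  then have "real (2 * (\<Sum>x\<in>V. ?d x * ?d x)) = real ((\<Sum>x\<in>V. \<Sum>y\<in>nb E V x. card (nb E V x \<union> nb E V y)) + 6 * nc E 3 V)"
    by (simp only:)
  then have "2 * (\<Sum>x\<in>V. (real (?d x))\<^sup>2) = (\<Sum>x\<in>V. \<Sum>y\<in>nb E V x. real (card (nb E V x \<union> nb E V y))) + 6 * real (nc E 3 V)"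
    by (simp add: power2_eq_square)
  also have "\<dots> \<le> (\<Sum>x\<in>V. \<Sum>y\<in>nb E V x. ?K) + 6 * (\<delta> * m\<^sup>2)"
    using t by (intro add_mono sum_mono small) auto
  also have "(\<Sum>x\<in>V. \<Sum>y\<in>nb E V x. ?K) = 2 * ?e * ?K"
    by (simp add: sumd flip: sum_distrib_right)
  finally have up: "2 * (\<Sum>x\<in>V. (real (?d x))\<^sup>2) \<le> 2 * ?e * ?K + 6 * (\<delta> * m\<^sup>2)" .
  \<comment> \<open>Cauchy-Schwarz, as nonnegativity of the squared deviations from the average
    degree \<open>?c\<close>.\<close>
  have "(2 * ?e)\<^sup>2 \<le> (\<Sum>x\<in>V. (real (?d x))\<^sup>2) * m"
  proof -
    let ?c = "2 * ?e / m"
    have "0 \<le> (\<Sum>x\<in>V. (real (?d x) - ?c)\<^sup>2)" by (intro sum_nonneg) simp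
    also have "\<dots> = (\<Sum>x\<in>V. (real (?d x))\<^sup>2) - 2 * ?c * (\<Sum>x\<in>V. real (?d x)) + m * ?c\<^sup>2"
      unfolding power2_diff sum.distrib sum_subtractf m(1) by (simp add: sum_distrib_left sum_divide_distrib mult_ac)
    also have "\<dots> = (\<Sum>x\<in>V. (real (?d x))\<^sup>2) - (2 * ?e)\<^sup>2 / m"
      unfolding sumd using m(2) by (simp add: power2_eq_square field_simps)
    finally show ?thesis using m(2) by (simp add: field_simps)
  qed
  also have "\<dots> \<le> (?e * ?K + 3 * (\<delta> * m\<^sup>2)) * m" using up m by (intro mult_right_mono) auto
  finally have 1: "4 * ?e * ?e \<le> ?e * ?K * m + 3 * \<delta> * m\<^sup>2 * m"
    by (simp add: power2_eq_square algebra_simps)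
  \<comment> \<open>\<open>4 * e\<close> exceeds \<open>?K * m\<close> by at least
    \<open>\<delta> * m\<^sup>2\<close>, while the triangles account only for
    \<open>3 * \<delta> * m\<^sup>2 * m\<close>; this forces \<open>e \<le> 3 * m\<close>,
    impossible for a dense graph with \<open>m > 24\<close>.\<close>
  have "?e * (4 * ((1 / 4 - \<delta>) * m\<^sup>2)) \<le> ?e * (4 * ?e)" using e by (intro mult_left_mono) auto
  then have "?e * (\<delta> * m\<^sup>2) \<le> 3 * m * (\<delta> * m\<^sup>2)" using 1 by (simp add: power2_eq_square algebra_simps)
  then have "?e \<le> 3 * m" using \<delta> m by (simp add: mult_le_cancel_right)
  moreover have "1 / 8 * m\<^sup>2 \<le> (1 / 4 - \<delta>) * m\<^sup>2" using \<delta> by (intro mult_right_mono) auto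
  moreover have "24 * m < m\<^sup>2" using m by (simp add: power2_eq_square)
  ultimately show False using e by linarith
qed

text \<open>Markov's inequality for the number of missing neighbours.\<close>

lemma few_atypical:
  fixes \<gamma> m M :: real
  assumes "finite A" "(\<Sum>a\<in>A. real (card (B - nb E B a))) \<le> M"
  shows "card {a \<in> A. \<not> card (B - nb E B a) \<le> \<gamma> * m} * (\<gamma> * m) \<le> M"
proof -
  let ?A = "{a \<in> A. \<not> card (B - nb E B a) \<le> \<gamma> * m}"
  have "card ?A * (\<gamma> * m) = (\<Sum>a\<in>?A. \<gamma> * m)" by simp
  also have "\<dots> \<le> (\<Sum>a\<in>?A. real (card (B - nb E B a)))" by (intro sum_mono) auto
  also have "\<dots> \<le> (\<Sum>a\<in>A. real (card (B - nb E B a)))" using assms by (intro sum_mono2) auto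
  finally show ?thesis using assms by linarith
qed

end

context theta_graph_rel
begin

text \<open>\<open>A\<close>, the neighbourhood of \<open>x\<close>, and \<open>B\<close>, the rest
  of that of \<open>y\<close>, span \<open>O(m)\<close> edges each, so nearly all edges run between
  them. As \<open>card A * card B\<close> is at most \<open>m\<^sup>2 / 4\<close>, few pairs across
  are missing, and the vertices that miss many are discarded.\<close>

lemma stability:
  fixes \<gamma> \<zeta> \<delta> m :: real
  assumes V: "finite V" and free: "theta_free ps E V" and m: "m = card V" "24 < m" "2 * h \<le> \<delta> * m"
    and \<gamma>: "0 < \<gamma>" "\<gamma> \<le> 1" and \<zeta>: "0 < \<zeta>" "\<zeta> \<le> 1 / 8" and \<delta>: "\<delta> = \<gamma> * \<zeta> / 20"
    and e: "(1 / 4 - \<delta>) * m\<^sup>2 \<le> nc E 2 V" and t: "nc E 3 V \<le> \<delta> * m\<^sup>2"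
  obtains X Y where "X \<subseteq> V" "Y \<subseteq> V" "X \<inter> Y = {}" "card (V - X - Y) \<le> \<zeta> * m"
    "m / 8 \<le> card X" "m / 8 \<le> card Y"
    "\<And>x. x \<in> X \<Longrightarrow> card (Y - nb E Y x) \<le> \<gamma> * m" "\<And>y. y \<in> Y \<Longrightarrow> card (X - nb E X y) \<le> \<gamma> * m"
proof -
  have "0 < \<gamma> * \<zeta>" using \<gamma> \<zeta> by simp
  moreover have "\<gamma> * \<zeta> \<le> 1 * \<zeta>" using \<gamma> \<zeta> by (intro mult_right_mono) auto
  ultimately have \<delta>\<zeta>: "\<delta> \<le> \<zeta> / 20" "0 < \<delta>" using \<delta> by auto
  have m0: "0 < m" using m by simp
  obtain x y where xy: "x \<in> V" "y \<in> V" "E x y" "(1 - 5 * \<delta>) * m \<le> card (nb E V x \<union> nb E V y)"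
    using edge_with_large_neighbourhood[OF V m(1,2) \<delta>\<zeta>(2) _ e t] \<delta>\<zeta> \<zeta> by auto
  define A where "A = nb E V x"
  define B where "B = nb E V y - A"
  define Z0 where "Z0 = V - (A \<union> B)"
  have sub: "A \<subseteq> V" "B \<subseteq> V" "A \<inter> B = {}" "Z0 \<subseteq> V" "A \<union> B = nb E V x \<union> nb E V y"
    by (auto simp: A_def B_def Z0_def)
  have fin: "finite A" "finite B" "finite Z0" using V sub finite_subset by metis+
  have cards: "card A + card B + card Z0 = card V"
  proof -
    have "card (A \<union> B) + card Z0 = card (A \<union> B \<union> Z0)"
      using fin by (intro card_Un_disjoint[symmetric]) (auto simp: Z0_def)
    moreover have "A \<union> B \<union> Z0 = V" using sub(1,2) by (auto simp: Z0_def)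
    ultimately show ?thesis using card_Un_disjoint[OF fin(1,2) sub(3)] by simp
  qed
  have cZ0: "real (card Z0) \<le> 5 * \<delta> * m"
  proof -
    have "card (A \<union> B) + card Z0 = card V" using cards card_Un_disjoint[OF fin(1,2) sub(3)] by simp
    then have "real (card Z0) = m - card (A \<union> B)" using m(1) by (metis add_diff_cancel_left' of_nat_add)
    then show ?thesis using xy(4) sub(5) by (simp add: algebra_simps)
  qed
  have eA: "nc E 2 A \<le> h * card V" "nc E 2 B \<le> h * card V"
  proof -
    have "nc E 2 A \<le> h * card A" unfolding A_def by (rule link_edges[OF V free xy(1) order_refl])
    moreover have "nc E 2 B \<le> h * card B" unfolding B_def by (rule link_edges[OF V free xy(2)]) auto
    moreover have "h * card A \<le> h * card V" "h * card B \<le> h * card V"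
      using sub V by (auto intro!: mult_le_mono2 card_mono)
    ultimately show "nc E 2 A \<le> h * card V" "nc E 2 B \<le> h * card V" by linarith+
  qed
  define eAB where "eAB = (\<Sum>a\<in>A. card (nb E B a))"
  have "nc E 2 V \<le> nc E 2 (V - Z0) + card Z0 * card V" by (rule nc_2_Diff_ge) fact+
  moreover have "V - Z0 = A \<union> B" using sub by (auto simp: Z0_def)
  moreover have "nc E 2 (A \<union> B) = nc E 2 A + nc E 2 B + eAB"
    unfolding eAB_def using fin sub by (intro nc_2_union) auto
  ultimately have "nc E 2 V \<le> 2 * (h * card V) + eAB + card Z0 * card V" using eA by simp
  from of_nat_mono[OF this, where ?'a = real]
  have "real (nc E 2 V) \<le> 2 * (h * m) + eAB + card Z0 * m" by (simp add: m)
  also have "card Z0 * m \<le> 5 * \<delta> * m * m" using cZ0 m0 by (intro mult_right_mono) auto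
  finally have e1: "(1 / 4 - \<delta>) * m\<^sup>2 \<le> 2 * h * m + eAB + 5 * \<delta> * m * m" using e by simp
  have "2 * h * m \<le> \<delta> * m * m" using m(3) m0 by (intro mult_right_mono) auto
  \<comment> \<open>One \<delta> is the density deficit, five come from the uncovered set
    \<open>Z0\<close>, one from the edges inside \<open>A\<close> and \<open>B\<close>.\<close>
  then have eAB: "(1 / 4 - 7 * \<delta>) * m\<^sup>2 \<le> eAB" using e1 by (simp add: power2_eq_square algebra_simps)
  have total: "eAB + (\<Sum>a\<in>A. card (B - nb E B a)) = card A * card B"
    unfolding eAB_def by (rule sum_nb_missing[OF fin(1,2)])
  have total': "eAB + (\<Sum>b\<in>B. card (A - nb E A b)) = card A * card B"
    unfolding eAB_def sum_nb_swap[OF fin(1,2)] using sum_nb_missing[OF fin(2,1)] by (simp add: mult.commute)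
  have AB: "real (card A) * card B \<le> m\<^sup>2 / 4"
  proof -
    have "real (card A) * card B \<le> (real (card A) + card B)\<^sup>2 / 4"
      using zero_le_power2[of "real (card A) - card B"] by (simp add: power2_eq_square algebra_simps)
    also have "\<dots> \<le> m\<^sup>2 / 4"
      using cards m by (intro divide_right_mono power_mono) auto
    finally show ?thesis .
  qed
  have "real eAB + real (\<Sum>a\<in>A. card (B - nb E B a)) = real (card A) * card B"
    using total by (metis of_nat_add of_nat_mult)
  then have mA: "(\<Sum>a\<in>A. real (card (B - nb E B a))) \<le> 7 * \<delta> * m\<^sup>2"
    using AB eAB by (simp add: algebra_simps)
  have "real eAB + real (\<Sum>b\<in>B. card (A - nb E A b)) = real (card A) * card B"
    using total' by (metis of_nat_add of_nat_mult)
  then have mB: "(\<Sum>b\<in>B. real (card (A - nb E A b))) \<le> 7 * \<delta> * m\<^sup>2"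
    using AB eAB by (simp add: algebra_simps)
  define X where "X = {a \<in> A. card (B - nb E B a) \<le> \<gamma> * m}"
  define Y where "Y = {b \<in> B. card (A - nb E A b) \<le> \<gamma> * m}"
  have few: "real (card (A - X)) \<le> 7 / 20 * \<zeta> * m" "real (card (B - Y)) \<le> 7 / 20 * \<zeta> * m"
  proof -
    \<comment> \<open>The choice of \<delta> is made for this: at most
      \<open>7 / 20 * \<zeta> * m\<close> vertices on each side miss more than
      \<open>\<gamma> * m\<close>, and \<open>Z0\<close> fits into the rest of
      \<open>\<zeta> * m\<close>.\<close>
    have eq: "7 * \<delta> * m\<^sup>2 = (7 / 20 * \<zeta> * m) * (\<gamma> * m)" by (simp add: \<delta> power2_eq_square)
    have pos: "0 < \<gamma> * m" using \<gamma> m0 by simp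
    have "A - X = {a \<in> A. \<not> card (B - nb E B a) \<le> \<gamma> * m}" "B - Y = {b \<in> B. \<not> card (A - nb E A b) \<le> \<gamma> * m}"
      by (auto simp: X_def Y_def)
    then have "real (card (A - X)) * (\<gamma> * m) \<le> (7 / 20 * \<zeta> * m) * (\<gamma> * m)"
      "real (card (B - Y)) * (\<gamma> * m) \<le> (7 / 20 * \<zeta> * m) * (\<gamma> * m)"
      using few_atypical[OF fin(1) mA, of \<gamma> m] few_atypical[OF fin(2) mB, of \<gamma> m] eq by simp_all
    then show "real (card (A - X)) \<le> 7 / 20 * \<zeta> * m" "real (card (B - Y)) \<le> 7 / 20 * \<zeta> * m"
      using pos mult_right_le_imp_le by blast+
  qed
  have subXY: "X \<subseteq> A" "Y \<subseteq> B" by (auto simp: X_def Y_def)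
  have cX: "real (card A) = card X + card (A - X)" "real (card B) = card Y + card (B - Y)"
    using subXY fin by (auto simp: card_Diff_subset card_mono of_nat_diff finite_subset)
  have large: "(1 / 4 - 7 * \<delta>) * m \<le> card A" "(1 / 4 - 7 * \<delta>) * m \<le> card B"
  proof -
    have "real eAB \<le> real (card A) * card B" using total by (metis le_add1 of_nat_le_iff of_nat_mult)
    then have 1: "((1 / 4 - 7 * \<delta>) * m) * m \<le> real (card A) * card B" using eAB by (simp add: power2_eq_square mult.assoc)
    have le: "real (card A) \<le> m" "real (card B) \<le> m" using cards m by auto
    have "real (card A) * card B \<le> real (card A) * m" "real (card A) * card B \<le> real (card B) * m"
      using mult_left_mono[OF le(2), of "real (card A)"] mult_right_mono[OF le(1), of "real (card B)"]
      by (simp_all add: mult.commute)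
    then show "(1 / 4 - 7 * \<delta>) * m \<le> card A" "(1 / 4 - 7 * \<delta>) * m \<le> card B"
      using 1 m0 by (meson mult_right_le_imp_le order_trans)+
  qed
  have arith: "1 / 8 \<le> 1 / 4 - 7 * \<delta> - 7 / 20 * \<zeta>" "5 * \<delta> + 7 / 20 * \<zeta> + 7 / 20 * \<zeta> \<le> \<zeta>"
    using \<delta>\<zeta> \<zeta> by linarith+
  have big: "m / 8 \<le> (1 / 4 - 7 * \<delta>) * m - 7 / 20 * \<zeta> * m"
    using mult_right_mono[OF arith(1), of m] m0 by (simp add: algebra_simps)
  show thesis
  proof (rule that[of X Y])
    show "X \<subseteq> V" "Y \<subseteq> V" "X \<inter> Y = {}" using subXY sub by auto
    show "m / 8 \<le> card X" "m / 8 \<le> card Y" using big large cX few by linarith+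
    have "V - X - Y = (A - X) \<union> (B - Y) \<union> Z0" using subXY sub by (auto simp: Z0_def)
    then have "card (V - X - Y) \<le> card (A - X) + card (B - Y) + card Z0"
      by (metis (no_types, lifting) card_Un_le add_right_mono le_trans)
    then have "real (card (V - X - Y)) \<le> card (A - X) + card (B - Y) + card Z0"
      using of_nat_mono[where ?'a = real] by fastforce
    also have "\<dots> \<le> (5 * \<delta> + 7 / 20 * \<zeta> + 7 / 20 * \<zeta>) * m" using few cZ0 by (simp add: algebra_simps)
    also have "\<dots> \<le> \<zeta> * m" using arith(2) m0 by (intro mult_right_mono) auto
    finally show "card (V - X - Y) \<le> \<zeta> * m" .
    show "card (Y - nb E Y x) \<le> \<gamma> * m" if "x \<in> X" for x
    proof -
      have "card (Y - nb E Y x) \<le> card (B - nb E B x)" using fin subXY by (intro card_mono) auto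
      then show ?thesis using that by (simp add: X_def) 
    qed
    show "card (X - nb E X y) \<le> \<gamma> * m" if "y \<in> Y" for y
    proof -
      have "card (X - nb E X y) \<le> card (A - nb E A y)" using fin subXY by (intro card_mono) auto
      then show ?thesis using that by (simp add: Y_def)
    qed
  qed
qed

end

section \<open>Edges against triangles in theta-free graphs\<close>

context critical_theta
begin

text \<open>With fewer than \<open>(1 / 4 - \<delta>) * m\<^sup>2\<close> edges the triangles fit
  into the deficit. Otherwise \<open>stability\<close> supplies the cores for
  \<open>near_bipartite_bound\<close>.\<close>

theorem edges_and_triangles_bound:
  fixes C :: nat
  obtains n0 where "\<And>(E :: 'a \<Rightarrow> 'a \<Rightarrow> bool) V. graph_rel E \<Longrightarrow> finite V \<Longrightarrow> theta_free ps E V \<Longrightarrow>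
    n0 \<le> card V \<Longrightarrow> nc E 2 V + C * nc E 3 V \<le> (card V)\<^sup>2 div 4"
proof -
  have h2: "2 \<le> real h" using h_ge_2 by simp
  \<comment> \<open>The order is that of dependence: \<eta> makes a low vertex cost at most
    \<open>m / 4\<close>, \<zeta> makes missing pairs outweigh the inner edges and triangles,
    \<gamma> keeps \<open>h * \<gamma>\<close> small against \<eta>, and \<delta> is prescribed by
    \<open>stability\<close>.\<close>
  define \<eta> where "\<eta> = 1 / (12 * (1 + real C * h))"
  define \<zeta> where "\<zeta> = \<eta> / (2 * (1 + 2 * real C * h))"
  define \<gamma> where "\<gamma> = \<eta> / (32 * h)"
  define \<delta> where "\<delta> = \<gamma> * \<zeta> / 20"
  have Ch: "0 \<le> real C * h" by simp
  have \<eta>: "0 < \<eta>" "\<eta> \<le> 1 / 12" "3 * \<eta> * (1 + real C * h) = 1 / 4"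
  proof -
    obtain P where P: "P = 1 + real C * h" "1 \<le> P" using Ch by simp
    show "0 < \<eta>" "\<eta> \<le> 1 / 12" "3 * \<eta> * (1 + real C * h) = 1 / 4"
      unfolding \<eta>_def P(1)[symmetric] using P(2) by (auto simp: field_simps)
  qed
  have \<zeta>: "0 < \<zeta>" "\<zeta> \<le> \<eta> / 2" "\<zeta> * (1 + 2 * real C * h) = \<eta> / 2"
  proof -
    have pos: "1 \<le> 1 + 2 * real C * h" by simp
    then have "0 < 2 * (1 + 2 * real C * h)"
      using order.strict_trans2[OF zero_less_one pos] by (intro mult_pos_pos) auto
    with \<eta>(1) show "0 < \<zeta>" unfolding \<zeta>_def by (rule divide_pos_pos)
    show eq: "\<zeta> * (1 + 2 * real C * h) = \<eta> / 2"     proof -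
      obtain Q where Q: "Q = 1 + 2 * real C * h" "1 \<le> Q" using pos by blast
      show ?thesis unfolding \<zeta>_def Q(1)[symmetric] using Q(2) by simp
    qed
    have "\<zeta> * 1 \<le> \<zeta> * (1 + 2 * real C * h)" using pos \<open>0 < \<zeta>\<close> by (intro mult_left_mono) auto
    then show "\<zeta> \<le> \<eta> / 2" using eq by simp
  qed
  have \<gamma>: "0 < \<gamma>" "h * \<gamma> = \<eta> / 32" "\<gamma> \<le> \<eta> / 64"
    using \<eta> h2 by (auto simp: \<gamma>_def field_simps)
  have \<delta>: "0 < \<delta>" using \<gamma> \<zeta> by (simp add: \<delta>_def)
  have "0 < \<delta> / (C + 1)" using \<delta> by simp
  then obtain n1 where n1: "\<And>(E :: 'a \<Rightarrow> 'a \<Rightarrow> bool) V. graph_rel E \<Longrightarrow> finite V \<Longrightarrow> theta_free ps E V \<Longrightarrow>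
    n1 \<le> card V \<Longrightarrow> nc E 3 V \<le> \<delta> / (C + 1) * (real (card V))\<^sup>2"
    using few_triangles[of "\<delta> / (C + 1)"] by blast
  obtain n2 :: nat where n2: "25 + 2 * h / \<delta> + 2 * h / \<eta> < n2" using reals_Archimedean2 by blast
  show thesis
  proof (rule that[of "max n1 n2"])
    fix E :: "'a \<Rightarrow> 'a \<Rightarrow> bool" and V
    assume E: "graph_rel E" and V: "finite V" and free: "theta_free ps E V" and n: "max n1 n2 \<le> card V"
    interpret graph_rel E by fact
    interpret critical_theta_graph ps i0 E by unfold_locales
    define m where "m = real (card V)"
    have "n2 \<le> m" using n by (simp add: m_def)
    moreover have "0 \<le> 2 * h / \<delta>" "0 \<le> 2 * h / \<eta>" using \<delta> \<eta> by auto
    ultimately have "2 * h / \<delta> \<le> m" "2 * h / \<eta> \<le> m" and m24: "24 < m" using n2 by linarith+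
    then have m: "2 * h \<le> \<delta> * m" "2 * h \<le> \<eta> * m"
      using \<delta> \<eta> by (simp_all add: pos_divide_le_eq mult.commute)
    have t0: "nc E 3 V \<le> \<delta> / (C + 1) * m\<^sup>2"
      unfolding m_def by (rule n1[OF E V free]) (use n in simp)
    then have "real (C + 1) * nc E 3 V \<le> real (C + 1) * (\<delta> / (C + 1) * m\<^sup>2)" by (intro mult_left_mono) auto
    then have t: "real (C + 1) * nc E 3 V \<le> \<delta> * m\<^sup>2" by simp
    have t3: "nc E 3 V \<le> \<delta> * m\<^sup>2" and tC: "C * real (nc E 3 V) \<le> \<delta> * m\<^sup>2"
    proof -
      have "real (C + 1) * nc E 3 V = C * real (nc E 3 V) + nc E 3 V" by (simp add: algebra_simps)
      moreover have "0 \<le> C * real (nc E 3 V)" by simp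
      ultimately show "nc E 3 V \<le> \<delta> * m\<^sup>2" "C * real (nc E 3 V) \<le> \<delta> * m\<^sup>2" using t by linarith+
    qed
    have "nc E 2 V + C * nc E 3 V \<le> m\<^sup>2 / 4"
    proof (cases "(1 / 4 - \<delta>) * m\<^sup>2 \<le> nc E 2 V")
      case False
      then show ?thesis using tC by (simp add: algebra_simps)
    next
      case True
      have \<gamma>1: "\<gamma> \<le> 1" and \<zeta>8: "\<zeta> \<le> 1 / 8" using \<gamma> \<zeta> \<eta> by linarith+
      obtain X Y where XY: "X \<subseteq> V" "Y \<subseteq> V" "X \<inter> Y = {}" "card (V - X - Y) \<le> \<zeta> * m"
        "m / 8 \<le> card X" "m / 8 \<le> card Y"
        "\<And>x. x \<in> X \<Longrightarrow> card (Y - nb E Y x) \<le> \<gamma> * m" "\<And>y. y \<in> Y \<Longrightarrow> card (X - nb E X y) \<le> \<gamma> * m"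
        using stability[OF V free m_def m24 m(1) \<gamma>(1) \<gamma>1 \<zeta>(1) \<zeta>8 \<delta>_def True t3] by blast
      have hg: "h * (\<gamma> * m) = \<eta> * m / 32" using \<gamma>(2) by (metis mult.assoc times_divide_eq_left)
      have \<eta>m: "\<eta> * m \<le> m / 12" using mult_right_mono[OF \<eta>(2), of m] m24 by simp
      have \<gamma>m: "\<gamma> * m \<le> \<eta> * m / 64" using mult_right_mono[OF \<gamma>(3), of m] m24 by simp
      have \<eta>m0: "0 \<le> \<eta> * m" using \<eta> m24 by simp
      show ?thesis
      proof (rule near_bipartite_bound[OF V free m_def XY(1-4,7,8)])
        show "h + h * (\<gamma> * m) \<le> card X" "h + h * (\<gamma> * m) \<le> card Y"
          using XY(5,6) m(2) \<eta>m \<eta>m0 hg by linarith+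
        show "h + \<gamma> * m \<le> \<eta> * m" using m(2) \<gamma>m \<eta>m0 by linarith
        have "(2 * \<eta> + \<zeta>) * (1 + real C * h) \<le> (3 * \<eta>) * (1 + real C * h)"
          using \<zeta> \<eta> by (intro mult_right_mono) auto
        then show "(2 * \<eta> + \<zeta>) * (1 + real C * h) \<le> 1 / 4" using \<eta>(3) by simp
        have "\<zeta> * m + C * (2 * h * (\<zeta> * m)) = (\<zeta> * (1 + 2 * real C * h)) * m" by (simp add: algebra_simps)
        also have "\<dots> = \<eta> * m / 2" unfolding \<zeta>(3) by simp
        finally show "h + \<zeta> * m + C * (2 * h * (\<zeta> * m)) \<le> \<eta> * m" using m(2) by linarith
      qed (use \<gamma> in auto)
    qed
    then have "real (4 * (nc E 2 V + C * nc E 3 V)) \<le> real ((card V)\<^sup>2)" by (simp add: m_def)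
    then have "4 * (nc E 2 V + C * nc E 3 V) \<le> (card V)\<^sup>2" by (simp only: of_nat_le_iff)
    from div_le_mono[OF this, of 4] show "nc E 2 V + C * nc E 3 V \<le> (card V)\<^sup>2 div 4" by simp
  qed
qed

end

subsection \<open>Disjoint copies of theta graphs\<close>

definition disjoint_thetas_free :: "nat list \<Rightarrow> nat \<Rightarrow> ('a \<Rightarrow> 'a \<Rightarrow> bool) \<Rightarrow> 'a set \<Rightarrow> bool" where
  "disjoint_thetas_free ps k E V \<longleftrightarrow> (\<nexists>g. (\<forall>i<k. theta_emb ps E V (g i)) \<and>
     (\<forall>i<k. \<forall>j<k. i \<noteq> j \<longrightarrow> g i ` verts (theta_graph ps) \<inter> g j ` verts (theta_graph ps) = {}))"

text \<open>Allows any finite index set with at least \<open>k\<close> elements, such as a set of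
  big vertices.\<close>

lemma disjoint_thetas_freeD:
  assumes free: "disjoint_thetas_free ps k E V" and I: "finite I" "k \<le> card I"
    and emb: "\<And>i. i \<in> I \<Longrightarrow> theta_emb ps E V (g i)"
    and dis: "\<And>i j. i \<in> I \<Longrightarrow> j \<in> I \<Longrightarrow> i \<noteq> j \<Longrightarrow> g i ` verts (theta_graph ps) \<inter> g j ` verts (theta_graph ps) = {}"
  shows False
proof -
  have "card {..<k} \<le> card I" using I by simp
  then obtain b where b: "b ` {..<k} \<subseteq> I" "inj_on b {..<k}"
    using card_le_inj[of "{..<k}" I] I by auto
  have bI: "b i \<in> I" if "i < k" for i using b(1) that by auto
  have "\<forall>i<k. theta_emb ps E V (g (b i))" using emb bI by blast
  moreover have "\<forall>i<k. \<forall>j<k. i \<noteq> j \<longrightarrow> g (b i) ` verts (theta_graph ps) \<inter> g (b j) ` verts (theta_graph ps) = {}"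
    using dis bI b(2) by (meson inj_onD lessThan_iff)
  ultimately have "\<exists>g. (\<forall>i<k. theta_emb ps E V (g i)) \<and>
     (\<forall>i<k. \<forall>j<k. i \<noteq> j \<longrightarrow> g i ` verts (theta_graph ps) \<inter> g j ` verts (theta_graph ps) = {})"
    by (intro exI[of _ "\<lambda>i. g (b i)"] conjI)
  then show False using free unfolding disjoint_thetas_free_def by (rule notE[rotated])
qed

context theta_graph_rel
begin

text \<open>Greedy construction: removing \<open>U0\<close>, \<open>B\<close> and the earlier copies
  from the link of \<open>u\<close> costs at most \<open>card V\<close> edges per removed vertex.
  More than \<open>h * card V\<close> edges remain, too many for a theta-free graph.\<close>

lemma embeddings_from_big_links:
  assumes V: "finite V" and B: "B \<subseteq> V" and U0: "finite U0" "U0 \<inter> B = {}"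
    and big: "\<And>u. u \<in> B \<Longrightarrow> (h + (card U0 + card B + card B * h)) * card V < nc E 2 (nb E V u)"
  shows "\<exists>g. (\<forall>u\<in>B. theta_emb ps E V (g u) \<and> g u ` VT \<inter> U0 = {}) \<and>
    (\<forall>u\<in>B. \<forall>v\<in>B. u \<noteq> v \<longrightarrow> g u ` VT \<inter> g v ` VT = {})"
proof -
  have finB: "finite B" using V B finite_subset by blast
  \<comment> \<open>The extra invariant that a copy meets \<open>B\<close> at most in its own vertex
    keeps the rest of \<open>B\<close> free for later copies.\<close>
  have "\<exists>g. (\<forall>u\<in>A. theta_emb ps E V (g u) \<and> g u ` VT \<inter> U0 = {} \<and> g u ` VT \<inter> B \<subseteq> {u}) \<and>
    (\<forall>u\<in>A. \<forall>v\<in>A. u \<noteq> v \<longrightarrow> g u ` VT \<inter> g v ` VT = {})" if "A \<subseteq> B" for A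
    using finite_subset[OF that finB] that
  proof (induction A)
    case empty
    show ?case by simp
  next
    case (insert u A)
    have "A \<subseteq> B" using insert.prems by simp
    from insert.IH[OF this] obtain g where
      g0: "\<forall>v\<in>A. theta_emb ps E V (g v) \<and> g v ` VT \<inter> U0 = {} \<and> g v ` VT \<inter> B \<subseteq> {v}"
      and g4: "\<forall>v\<in>A. \<forall>w\<in>A. v \<noteq> w \<longrightarrow> g v ` VT \<inter> g w ` VT = {}"
      by (elim exE conjE)
    have g: "theta_emb ps E V (g v)" "g v ` VT \<inter> U0 = {}" "g v ` VT \<inter> B \<subseteq> {v}" if "v \<in> A" for v
      using g0 that by simp_all
    have uB: "u \<in> B" "u \<in> V" "u \<notin> U0" using insert B U0 by auto
    define R where "R = U0 \<union> B \<union> (\<Union>v\<in>A. g v ` VT)"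
    have finR: "finite R" using U0 finB insert by (simp add: R_def)
    have "card R \<le> card U0 + card B + card (\<Union>v\<in>A. g v ` VT)"
      unfolding R_def by (meson card_Un_le add_right_mono le_trans)
    also have "card (\<Union>v\<in>A. g v ` VT) \<le> (\<Sum>v\<in>A. card (g v ` VT))" using insert by (intro card_UN_le)
    also have "\<dots> \<le> (\<Sum>v\<in>A. h)" by (intro sum_mono) (simp add: h_def card_image_le)
    also have "\<dots> = card A * h" by simp
    also have "\<dots> \<le> card B * h" using insert finB by (intro mult_le_mono1 card_mono) auto
    finally have cR: "card R \<le> card U0 + card B + card B * h" by simp
    define S where "S = nb E V u - R"
    have finS: "finite S" using V by (simp add: S_def)
    \<comment> \<open>The copy need not contain \<open>u\<close>; lying inside
      \<open>insert u S\<close> is all that disjointness requires.\<close>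
    have "\<not> theta_free ps E (insert u S)"
    proof
      assume free: "theta_free ps E (insert u S)"
      have "nc E 2 S \<le> h * card S"
        using finS by (intro link_edges[OF _ free, of u]) (auto simp: S_def)
      also have "\<dots> \<le> h * card V" using V by (intro mult_le_mono2 card_mono) (auto simp: S_def)
      finally have S: "nc E 2 S \<le> h * card V" .
      have "nc E 2 (nb E V u) \<le> nc E 2 S + card R * card (nb E V u)"
        unfolding S_def using V finR by (intro nc_2_Diff_ge) auto
      also have "card R * card (nb E V u) \<le> (card U0 + card B + card B * h) * card V"
        using cR V by (intro mult_le_mono card_mono nb_subset)
      finally have "nc E 2 (nb E V u) \<le> (h + (card U0 + card B + card B * h)) * card V"
        using S by (simp add: algebra_simps)
      then show False using big[OF uB(1)] by simp
    qed
    then obtain f where f: "theta_emb ps E (insert u S) f" by (auto simp: theta_free_def)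
    have fS: "f ` VT \<subseteq> insert u S" using f by (simp add: theta_emb_def)
    have fV: "theta_emb ps E V f" by (rule theta_emb_mono[OF f]) (use uB in \<open>auto simp: S_def\<close>)
    have f0: "f ` VT \<inter> U0 = {}" "f ` VT \<inter> B \<subseteq> {u}" using fS uB by (auto simp: S_def R_def)
    have fg: "f ` VT \<inter> g v ` VT = {}" if v: "v \<in> A" for v
    proof -
      have "u \<noteq> v" using v insert.hyps by auto
      then have un: "u \<notin> g v ` VT" using g(3)[OF v] uB(1) by (metis IntI singletonD subsetD)
      moreover have "S \<inter> g v ` VT = {}" unfolding S_def R_def using v by blast
      ultimately have "insert u S \<inter> g v ` VT = {}" by simp
      moreover have "P \<inter> Q = {}" if "P \<subseteq> R" "R \<inter> Q = {}" for P Q R :: "'a set"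
        using that by blast
      ultimately show ?thesis using fS by blast
    qed
    show ?case
    proof (intro exI[of _ "g(u := f)"] conjI ballI impI)
      fix v assume v: "v \<in> insert u A"
      show "theta_emb ps E V ((g(u := f)) v)" "(g(u := f)) v ` VT \<inter> U0 = {}" "(g(u := f)) v ` VT \<inter> B \<subseteq> {v}"
        using v g[of v] fV f0 by (cases "v = u"; simp)+
      fix w assume w: "w \<in> insert u A" "v \<noteq> w"
      show "(g(u := f)) v ` VT \<inter> (g(u := f)) w ` VT = {}"
      proof (cases "v = u")
        case True
        then show ?thesis using w fg[of w] by simp
      next
        case False
        then have vA: "v \<in> A" using v by simp
        show ?thesis
        proof (cases "w = u")
          case True
          then show ?thesis using fg[OF vA] False by (simp add: Int_commute)
        next
          case wu: False
          then have "w \<in> A" using w by simp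
          from g4[rule_format, OF vA this w(2)] show ?thesis using False wu by simp
        qed
      qed
    qed
  qed
  from this[OF order_refl] obtain g where
    "\<forall>u\<in>B. theta_emb ps E V (g u) \<and> g u ` VT \<inter> U0 = {} \<and> g u ` VT \<inter> B \<subseteq> {u}"
    "\<forall>u\<in>B. \<forall>v\<in>B. u \<noteq> v \<longrightarrow> g u ` VT \<inter> g v ` VT = {}"
    by (elim exE conjE)
  then show ?thesis by (intro exI[of _ g]) simp
qed

text \<open>\<open>k\<close> big vertices would give \<open>k\<close> disjoint copies, and so would
  \<open>k - 1\<close> of them together with a copy avoiding them. The threshold allows for removing
  that copy, the big vertices and the copies already found.\<close>

lemma few_big_links:
  assumes V: "finite V" and free: "disjoint_thetas_free ps k E V" and \<tau>: "(h + (h + k + k * h)) * card V \<le> \<tau>"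
  defines "Big \<equiv> {u \<in> V. \<tau> < nc E 2 (nb E V u)}"
  shows "card Big < k" and "Suc (card Big) = k \<Longrightarrow> theta_free ps E (V - Big)"
proof -
  have finB: "finite Big" using V by (simp add: Big_def)
  have big: "(h + (c + card B + card B * h)) * card V < nc E 2 (nb E V u)"
    if "c \<le> h" "card B \<le> k" "B \<subseteq> Big" "u \<in> B" for B c u
  proof -
    have "(h + (c + card B + card B * h)) * card V \<le> (h + (h + k + k * h)) * card V"
      using that by (intro mult_le_mono1 add_mono mult_le_mono) auto
    also have "\<dots> < nc E 2 (nb E V u)" using that \<tau> by (auto simp: Big_def)
    finally show ?thesis .
  qed
  show lt: "card Big < k"
  proof (rule ccontr)
    assume "\<not> ?thesis"
    then obtain B where B: "B \<subseteq> Big" "card B = k" by (meson not_less obtain_subset_with_card_n)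
    have BV: "B \<subseteq> V" using B by (auto simp: Big_def)
    have "\<exists>g. (\<forall>u\<in>B. theta_emb ps E V (g u) \<and> g u ` VT \<inter> {} = {}) \<and>
      (\<forall>u\<in>B. \<forall>v\<in>B. u \<noteq> v \<longrightarrow> g u ` VT \<inter> g v ` VT = {})"
      by (rule embeddings_from_big_links[OF V BV]) (use big[of 0 B] B in auto)
    then obtain g where g: "\<forall>u\<in>B. theta_emb ps E V (g u) \<and> g u ` VT \<inter> {} = {}"
      "\<forall>u\<in>B. \<forall>v\<in>B. u \<noteq> v \<longrightarrow> g u ` VT \<inter> g v ` VT = {}"
      by (elim exE conjE)
    show False
      by (rule disjoint_thetas_freeD[OF free finite_subset[OF B(1) finB], of g]) (use g B in simp_all)
  qed
  show "theta_free ps E (V - Big)" if eq: "Suc (card Big) = k"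
  proof (rule ccontr)
    assume "\<not> ?thesis"
    then obtain f where f: "theta_emb ps E (V - Big) f" by (auto simp: theta_free_def)
    let ?U = "f ` VT"
    have U: "?U \<inter> Big = {}" using f by (auto simp: theta_emb_def)
    have cU: "card ?U \<le> h" by (simp add: h_def card_image_le)
    have BV: "Big \<subseteq> V" by (auto simp: Big_def)
    have "\<exists>g. (\<forall>u\<in>Big. theta_emb ps E V (g u) \<and> g u ` VT \<inter> ?U = {}) \<and>
      (\<forall>u\<in>Big. \<forall>v\<in>Big. u \<noteq> v \<longrightarrow> g u ` VT \<inter> g v ` VT = {})"
      by (rule embeddings_from_big_links[OF V BV _ U]) (use big[OF cU, of Big] lt in auto)
    then obtain g where g: "\<forall>u\<in>Big. theta_emb ps E V (g u) \<and> g u ` VT \<inter> ?U = {}"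
      "\<forall>u\<in>Big. \<forall>v\<in>Big. u \<noteq> v \<longrightarrow> g u ` VT \<inter> g v ` VT = {}"
      by (elim exE conjE)
    \<comment> \<open>\<open>None\<close> indexes the copy outside \<open>Big\<close>,
      \<open>Some u\<close> the copy obtained for \<open>u\<close>.\<close>
    define g' where "g' i = (case i of None \<Rightarrow> f | Some u \<Rightarrow> g u)" for i
    let ?I = "insert None (Some ` Big)"
    have "theta_emb ps E V f" by (rule theta_emb_mono[OF f]) auto
    then have "theta_emb ps E V (g' i)" if "i \<in> ?I" for i using that g by (auto simp: g'_def)
    moreover have "g' i ` VT \<inter> g' j ` VT = {}" if "i \<in> ?I" "j \<in> ?I" "i \<noteq> j" for i j
      using that g by (cases i; cases j; simp add: g'_def Int_commute inj_image_mem_iff)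
    moreover have "k \<le> card ?I" using eq finB by (simp add: card_image)
    ultimately show False
      using disjoint_thetas_freeD[OF free, of ?I g'] finB by blast
  qed
qed

text \<open>Removing the vertices of one copy leaves a graph with room for one copy fewer; the
  removed vertices accumulate to the hitting set.\<close>

lemma hitting_set:
  assumes "finite V" "disjoint_thetas_free ps (Suc k) E V"
  shows "\<exists>U \<subseteq> V. card U \<le> k * h \<and> theta_free ps E (V - U)"
  using assms
proof (induction k arbitrary: V)
  case 0
  have "theta_free ps E V"
    unfolding theta_free_def
  proof
    assume "\<exists>f. theta_emb ps E V f"
    then obtain f where "theta_emb ps E V f" by blast
    then show False using disjoint_thetas_freeD[OF 0(2), of "{()}" "\<lambda>_. f"] by simp
  qed
  then show ?case by (intro exI[of _ "{}"]) simp
next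
  case (Suc k)
  show ?case
  proof (cases "theta_free ps E V")
    case True
    then show ?thesis by (intro exI[of _ "{}"]) simp
  next
    case False
    then obtain f where f: "theta_emb ps E V f" by (auto simp: theta_free_def)
    let ?V = "V - f ` VT"
    have "disjoint_thetas_free ps (Suc k) E ?V"
      unfolding disjoint_thetas_free_def
    proof (rule notI, elim exE conjE)
      fix g assume g: "\<forall>i<Suc k. theta_emb ps E ?V (g i)"
        "\<forall>i<Suc k. \<forall>j<Suc k. i \<noteq> j \<longrightarrow> g i ` VT \<inter> g j ` VT = {}"
      define g' where "g' i = (if i < Suc k then g i else f)" for i
      have "theta_emb ps E V (g' i)" for i
        using g(1) f theta_emb_mono[of ps E ?V "g i" V] by (auto simp: g'_def)
      moreover have gf: "g i ` VT \<inter> f ` VT = {}" if "i < Suc k" for i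
        using g(1) that by (auto simp: theta_emb_def)
      have "g' i ` VT \<inter> g' j ` VT = {}" if "i < Suc (Suc k)" "j < Suc (Suc k)" "i \<noteq> j" for i j
        using that g(2) gf[of i] gf[of j]
        by (cases "i < Suc k"; cases "j < Suc k"; simp add: g'_def Int_commute)
      ultimately show False using disjoint_thetas_freeD[OF Suc.prems(2), of "{..<Suc (Suc k)}" g'] by simp
    qed
    then obtain U where U: "U \<subseteq> ?V" "card U \<le> k * h" "theta_free ps E (?V - U)"
      using Suc.IH[of ?V] Suc.prems by auto
    have "card (U \<union> f ` VT) \<le> card U + card (f ` VT)" by (rule card_Un_le)
    also have "\<dots> \<le> Suc k * h" using U(2) card_image_le[OF finite_VT, of f] by (simp add: h_def)
    finally have "card (U \<union> f ` VT) \<le> Suc k * h" .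
    moreover have "V - (U \<union> f ` VT) = ?V - U" by auto
    moreover have "f ` VT \<subseteq> V" using f by (simp add: theta_emb_def)
    ultimately show ?thesis using U by (intro exI[of _ "U \<union> f ` VT"]) auto
  qed
qed

text \<open>Cliques are sorted by their part \<open>W\<close> in \<open>U\<close>. With three or
  more vertices outside, \<open>cliques_le_triangles\<close> applies. With two, either
  \<open>W\<close> contains a vertex of \<open>U - B\<close>, whose link has few edges, or
  \<open>W\<close> is an \<open>(r - 2)\<close>-subset of \<open>B\<close>, the main term. With one
  or none, the count is at most linear.\<close>

lemma clique_count:
  fixes \<tau> :: nat
  assumes V: "finite V" and U: "U \<subseteq> V" "B \<subseteq> U" and r: "2 \<le> r"
    and link: "\<And>u. u \<in> U - B \<Longrightarrow> nc E 2 (nb E V u) \<le> \<tau>"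
    and tri: "nc E 3 (V - U) \<le> \<tau>" and free: "theta_free ps E (V - U)"
  shows "nc E r V \<le> (card B choose (r - 2)) * nc E 2 (V - U) + 2 ^ card U * (1 + card V + 3 * 2 ^ h * \<tau>)"
proof -
  define T where "T W = {K. K \<subseteq> V - U \<and> card (K \<union> W) = r \<and> clique E (K \<union> W)}" for W
  have finU: "finite U" "finite B" using V U by (meson finite_subset)+
  have finT: "finite (T W)" for W
    by (rule finite_subset[of _ "Pow (V - U)"]) (use V in \<open>auto simp: T_def\<close>)
  have "nc E r V \<le> card (SIGMA W:Pow U. T W)"
    unfolding nc_def
  proof (rule card_inj_on_le[where f = "\<lambda>K. (K \<inter> U, K - U)"])
    show "inj_on (\<lambda>K. (K \<inter> U, K - U)) (cliques E r V)" by (auto simp: inj_on_def)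
    show "(\<lambda>K. (K \<inter> U, K - U)) ` cliques E r V \<subseteq> (SIGMA W:Pow U. T W)"
      by (auto simp: cliques_def T_def Un_Diff_Int Un_commute)
    show "finite (SIGMA W:Pow U. T W)" using finU finT by auto
  qed
  also have "\<dots> = (\<Sum>W\<in>Pow U. card (T W))" using finU finT by (simp add: card_SigmaI)
  also have "\<dots> \<le> (\<Sum>W\<in>Pow U. (if W \<subseteq> B \<and> card W = r - 2 then nc E 2 (V - U) else 0) + (1 + card V + 3 * 2 ^ h * \<tau>))"
  proof (intro sum_mono)
    fix W assume W: "W \<in> Pow U"
    have finW: "finite W" using W finU finite_subset by auto
    have K: "card K + card W = r" "clique E K" "K \<subseteq> V - U" if "K \<in> T W" for K
    proof -
      have "finite K" using that V by (auto simp: T_def intro: finite_subset)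
      moreover have "K \<inter> W = {}" using that W by (auto simp: T_def)
      ultimately show "card K + card W = r" using that finW by (auto simp: T_def card_Un_disjoint)
      show "clique E K" "K \<subseteq> V - U" using that clique_subset by (auto simp: T_def)
    qed
    have sub: "T W \<subseteq> cliques E i (V - U)" if "i + card W = r" for i
      using K that by (fastforce simp: cliques_def)
    have le: "card (T W) \<le> nc E i (V - U)" if "i + card W = r" for i
      unfolding nc_def using sub[OF that] V by (intro card_mono) auto
    have one: "1 \<le> (2::nat) ^ h" by simp
    consider "r < card W" | "0 + card W = r" | "1 + card W = r" | "2 + card W = r" | j where "(j + 3) + card W = r"
    proof -
      consider "r < card W" | i where "i + card W = r" by (metis le_add_diff_inverse2 not_less)
      then show thesis
      proof cases
        case (2 i)
        have "i = 0 \<or> i = 1 \<or> i = 2 \<or> (\<exists>j. i = j + 3)"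
        proof (cases "i < 3")
          case False
          then have "i = (i - 3) + 3" by simp
          then show ?thesis by blast
        qed auto
        then show thesis using 2 that by auto
      qed (use that in blast)
    qed
    then show "card (T W) \<le> (if W \<subseteq> B \<and> card W = r - 2 then nc E 2 (V - U) else 0) + (1 + card V + 3 * 2 ^ h * \<tau>)"
    proof cases
      case 1
      then have "T W = {}" using K(1) by fastforce
      then show ?thesis by simp
    next
      case 2
      then show ?thesis using le[of 0] V by (simp add: nc_0)
    next
      case 3
      have "card (V - U) \<le> card V" using V by (intro card_mono) auto
      then show ?thesis using le[of 1] 3 by (simp add: nc_1)
    next
      case 4
      show ?thesis
      proof (cases "W \<subseteq> B")
        case True
        then show ?thesis using le[OF 4] 4 by auto
      next
        case False
        then obtain u where u: "u \<in> W" "u \<in> U - B" using W by auto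
        have "T W \<subseteq> cliques E 2 (nb E V u)"
        proof
          fix K assume KT: "K \<in> T W"
          have "u \<notin> K" using KT u by (auto simp: T_def)
          have "K \<subseteq> nb E V u"
          proof
            fix x assume x: "x \<in> K"
            have "K \<subseteq> V - U" "clique E (K \<union> W)" using KT by (simp_all add: T_def)
            moreover have "u \<noteq> x" using x \<open>u \<notin> K\<close> by blast
            ultimately show "x \<in> nb E V u" using x u(1) unfolding clique_def by auto
          qed
          then show "K \<in> cliques E 2 (nb E V u)" using sub[OF 4] KT by (auto simp: cliques_def)
        qed
        then have "card (T W) \<le> nc E 2 (nb E V u)" unfolding nc_def using V by (intro card_mono) auto
        also have "\<dots> \<le> \<tau>" by (rule link[OF u(2)])
        also have "\<dots> \<le> 3 * 2 ^ h * \<tau>" using one by simp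
        finally show ?thesis by simp
      qed
    next
      case (5 j)
      have "card (T W) \<le> nc E (j + 3) (V - U)" by (rule le[OF 5])
      also have "\<dots> \<le> 3 * 2 ^ h * nc E 3 (V - U)" using V by (intro cliques_le_triangles free) simp
      also have "\<dots> \<le> 3 * 2 ^ h * \<tau>" using tri by simp
      finally show ?thesis by simp
    qed
  qed
  also have "\<dots> = (\<Sum>W\<in>Pow U. if W \<subseteq> B \<and> card W = r - 2 then nc E 2 (V - U) else 0) + 2 ^ card U * (1 + card V + 3 * 2 ^ h * \<tau>)"
    by (subst sum.distrib) (use finU in \<open>simp add: card_Pow\<close>)
  also have "(\<Sum>W\<in>Pow U. if W \<subseteq> B \<and> card W = r - 2 then nc E 2 (V - U) else 0)
      = card {W \<in> Pow U. W \<subseteq> B \<and> card W = r - 2} * nc E 2 (V - U)"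
    using finU by (simp add: sum.If_cases Int_def)
  also have "{W \<in> Pow U. W \<subseteq> B \<and> card W = r - 2} = {W. W \<subseteq> B \<and> card W = r - 2}" using U by auto
  also have "card {W. W \<subseteq> B \<and> card W = r - 2} = card B choose (r - 2)" using finU by (simp add: n_subsets)
  finally show ?thesis .
qed

end

subsection \<open>Bounds for large graphs\<close>

lemma binomial_le_two_power: "n choose j \<le> 2 ^ n"
proof -
  have "n choose j = card {K. K \<subseteq> {..<n} \<and> card K = j}" by (simp add: n_subsets)
  also have "\<dots> \<le> card (Pow {..<n})" by (intro card_mono) auto
  finally show ?thesis by (simp add: card_Pow)
qed

context critical_theta
begin

lemma rough_bound:
  fixes \<epsilon> :: real
  assumes k: "1 \<le> k" and \<epsilon>: "0 < \<epsilon>"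
  obtains n0 where "\<And>(E :: 'a \<Rightarrow> 'a \<Rightarrow> bool) V. graph_rel E \<Longrightarrow> finite V \<Longrightarrow> disjoint_thetas_free ps k E V \<Longrightarrow>
    n0 \<le> card V \<Longrightarrow> \<exists>B U. B \<subseteq> U \<and> U \<subseteq> V \<and> card B < k \<and> (Suc (card B) = k \<longrightarrow> theta_free ps E (V - B)) \<and>
      theta_free ps E (V - U) \<and> card U \<le> k + k * h \<and>
      (\<forall>r\<ge>2. nc E r V \<le> (card B choose (r - 2)) * real (nc E 2 (V - U)) + \<epsilon> * (real (card V))\<^sup>2)"
proof -
  define q where "q = k + k * h"
  define c where "c = h + (h + k + k * h)"
  \<comment> \<open>\<open>\<epsilon> / 2\<close> is for the at most \<open>2 ^ q\<close> subsets of
    \<open>U\<close>, each with error \<open>3 * 2 ^ h * \<tau>\<close>; the other half absorbs the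
    linear terms.\<close>
  define \<epsilon>1 where "\<epsilon>1 = \<epsilon> / (2 * 2 ^ q * (3 * 2 ^ h))"
  have \<epsilon>1: "0 < \<epsilon>1" "2 ^ q * (3 * 2 ^ h * \<epsilon>1) = \<epsilon> / 2" using \<epsilon> by (simp_all add: \<epsilon>1_def)
  obtain n1 where n1: "\<And>(E :: 'a \<Rightarrow> 'a \<Rightarrow> bool) V. graph_rel E \<Longrightarrow> finite V \<Longrightarrow> theta_free ps E V \<Longrightarrow>
    n1 \<le> card V \<Longrightarrow> nc E 3 V \<le> \<epsilon>1 * (real (card V))\<^sup>2"
    using few_triangles[OF \<epsilon>1(1)] by blast
  obtain n2 :: nat where n2: "1 + c / \<epsilon>1 + 4 * 2 ^ q / \<epsilon> < n2" using reals_Archimedean2 by blast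
  show thesis
  proof (rule that[of "n1 + q + n2"])
    fix E :: "'a \<Rightarrow> 'a \<Rightarrow> bool" and V
    assume E: "graph_rel E" and V: "finite V" and free: "disjoint_thetas_free ps k E V" and n: "n1 + q + n2 \<le> card V"
    interpret graph_rel E by fact
    interpret critical_theta_graph ps i0 E by unfold_locales
    let ?n = "real (card V)"
    have "n2 \<le> ?n" using n by simp
    moreover have "0 \<le> c / \<epsilon>1" "0 \<le> 4 * 2 ^ q / \<epsilon>" using \<epsilon> \<epsilon>1 by auto
    ultimately have "c / \<epsilon>1 \<le> ?n" "4 * 2 ^ q / \<epsilon> \<le> ?n" and n_ge1: "1 \<le> ?n" using n2 by linarith+
    then have nc: "c \<le> \<epsilon>1 * ?n" "4 * 2 ^ q \<le> \<epsilon> * ?n"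
      using \<epsilon>1 \<epsilon> by (simp_all add: pos_divide_le_eq mult.commute)
    \<comment> \<open>One quadratic quantity serves both as the threshold for big vertices, where it
      exceeds the linear \<open>c * n\<close>, and as the bound for triangles outside
      \<open>U\<close>.\<close>
    define \<tau> where "\<tau> = nat \<lfloor>\<epsilon>1 * ?n\<^sup>2\<rfloor>"
    have \<tau>_le: "real \<tau> \<le> \<epsilon>1 * ?n\<^sup>2" using \<epsilon>1 by (simp add: \<tau>_def)
    have "c * ?n \<le> \<epsilon>1 * ?n * ?n" using nc(1) by (intro mult_right_mono) auto
    then have c\<tau>: "c * card V \<le> \<tau>" unfolding \<tau>_def by (intro le_nat_floor) (simp add: power2_eq_square mult.assoc)
    define B where "B = {u \<in> V. \<tau> < nc E 2 (nb E V u)}"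
    have B: "card B < k" "Suc (card B) = k \<longrightarrow> theta_free ps E (V - B)"
      using few_big_links[OF V free c\<tau>[unfolded c_def]] by (simp_all add: B_def)
    obtain k' where k': "k = Suc k'" using k by (cases k) auto
    obtain U0 where U0: "U0 \<subseteq> V" "card U0 \<le> k' * h" "theta_free ps E (V - U0)"
      using hitting_set[OF V free[unfolded k']] by blast
    define U where "U = B \<union> U0"
    have U: "B \<subseteq> U" "U \<subseteq> V" using U0 by (auto simp: U_def B_def)
    have "card U \<le> card B + card U0" unfolding U_def by (rule card_Un_le)
    also have "\<dots> \<le> k + k * h" using B U0(2) k' by (intro add_mono) auto
    finally have cU: "card U \<le> q" by (simp add: q_def)
    have freeU: "theta_free ps E (V - U)" by (rule theta_free_mono[OF U0(3)]) (auto simp: U_def)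
    have "card V - card U \<le> card (V - U)" by (rule diff_card_le_card_Diff) (use U V finite_subset in blast)
    then have big: "n1 \<le> card (V - U)" using n cU by linarith
    have "nc E 3 (V - U) \<le> \<epsilon>1 * (real (card (V - U)))\<^sup>2" using V by (intro n1 E freeU big) simp
    also have "\<dots> \<le> \<epsilon>1 * ?n\<^sup>2" using \<epsilon>1 V by (intro mult_left_mono power_mono) (auto intro: card_mono)
    finally have tri: "nc E 3 (V - U) \<le> \<tau>" unfolding \<tau>_def by (rule le_nat_floor)
    have "nc E r V \<le> (card B choose (r - 2)) * real (nc E 2 (V - U)) + \<epsilon> * ?n\<^sup>2" if r: "2 \<le> r" for r
    proof -
      have "nc E r V \<le> (card B choose (r - 2)) * nc E 2 (V - U) + 2 ^ card U * (1 + card V + 3 * 2 ^ h * \<tau>)"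
        by (rule clique_count[OF V U(2,1) r _ tri freeU]) (use U in \<open>auto simp: B_def not_less\<close>)
      also have "\<dots> \<le> (card B choose (r - 2)) * nc E 2 (V - U) + 2 ^ q * (1 + card V + 3 * 2 ^ h * \<tau>)"
        using cU by (intro add_mono mult_le_mono1 power_increasing order_refl) auto
      finally have "real (nc E r V) \<le> real ((card B choose (r - 2)) * nc E 2 (V - U) + 2 ^ q * (1 + card V + 3 * 2 ^ h * \<tau>))"
        by (rule of_nat_mono)
      also have "\<dots> = (card B choose (r - 2)) * real (nc E 2 (V - U)) + (2 ^ q * (1 + ?n) + 2 ^ q * (3 * 2 ^ h * real \<tau>))"
        by (simp add: algebra_simps)
      also have "2 ^ q * (3 * 2 ^ h * real \<tau>) \<le> 2 ^ q * (3 * 2 ^ h * (\<epsilon>1 * ?n\<^sup>2))"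
        using \<tau>_le by (intro mult_left_mono) auto
      also have "\<dots> = (2 ^ q * (3 * 2 ^ h * \<epsilon>1)) * ?n\<^sup>2" by simp
      also have "\<dots> = \<epsilon> / 2 * ?n\<^sup>2" by (simp only: \<epsilon>1(2))
      also have "2 ^ q * (1 + ?n) \<le> \<epsilon> / 2 * ?n\<^sup>2"
      proof -
        have "2 ^ q * (1 + ?n) \<le> 2 ^ q * (2 * ?n)" using n_ge1 by (intro mult_left_mono) auto
        also have "\<dots> = (4 * 2 ^ q) * ?n / 2" by simp
        also have "\<dots> \<le> (\<epsilon> * ?n) * ?n / 2" using nc(2) by (intro divide_right_mono mult_right_mono) auto
        finally show ?thesis by (simp add: power2_eq_square)
      qed
      finally show ?thesis by simp
    qed
    then show "\<exists>B U. B \<subseteq> U \<and> U \<subseteq> V \<and> card B < k \<and> (Suc (card B) = k \<longrightarrow> theta_free ps E (V - B)) \<and>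
      theta_free ps E (V - U) \<and> card U \<le> k + k * h \<and>
      (\<forall>r\<ge>2. nc E r V \<le> (card B choose (r - 2)) * real (nc E 2 (V - U)) + \<epsilon> * ?n\<^sup>2)"
      using B U freeU cU by (intro exI[of _ B] exI[of _ U]) (simp add: q_def)
  qed
qed

text \<open>There are at most \<open>k - 1\<close> big vertices, too few for \<open>r - 2\<close>
  vertices of a clique, so the main term vanishes.\<close>

lemma cliques_upper_large:
  fixes \<epsilon> :: real
  assumes k: "1 \<le> k" and r: "k + 2 \<le> r" and \<epsilon>: "0 < \<epsilon>"
  obtains n0 where "\<And>(E :: 'a \<Rightarrow> 'a \<Rightarrow> bool) V. graph_rel E \<Longrightarrow> finite V \<Longrightarrow> disjoint_thetas_free ps k E V \<Longrightarrow>
    n0 \<le> card V \<Longrightarrow> nc E r V \<le> \<epsilon> * (real (card V))\<^sup>2"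
proof -
  obtain n0 where n0: "\<And>(E :: 'a \<Rightarrow> 'a \<Rightarrow> bool) V. graph_rel E \<Longrightarrow> finite V \<Longrightarrow> disjoint_thetas_free ps k E V \<Longrightarrow>
    n0 \<le> card V \<Longrightarrow> \<exists>B U. B \<subseteq> U \<and> U \<subseteq> V \<and> card B < k \<and> (Suc (card B) = k \<longrightarrow> theta_free ps E (V - B)) \<and>
      theta_free ps E (V - U) \<and> card U \<le> k + k * h \<and>
      (\<forall>r\<ge>2. nc E r V \<le> (card B choose (r - 2)) * real (nc E 2 (V - U)) + \<epsilon> * (real (card V))\<^sup>2)"
    using rough_bound[OF k \<epsilon>] by blast
  show thesis
  proof (rule that[of n0])
    fix E :: "'a \<Rightarrow> 'a \<Rightarrow> bool" and V
    assume "graph_rel E" "finite V" "disjoint_thetas_free ps k E V" "n0 \<le> card V"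
    from n0[OF this] obtain B U where "B \<subseteq> U" "U \<subseteq> V" and B: "card B < k"
      and "Suc (card B) = k \<longrightarrow> theta_free ps E (V - B)" "theta_free ps E (V - U)" "card U \<le> k + k * h"
      and bound: "\<forall>r\<ge>2. nc E r V \<le> (card B choose (r - 2)) * real (nc E 2 (V - U)) + \<epsilon> * (real (card V))\<^sup>2"
      by (elim exE conjE)
    have zero: "card B choose (r - 2) = 0" using B r by (intro binomial_eq_0) linarith
    have "2 \<le> r" using r by linarith
    from bound[rule_format, OF this, unfolded zero] show "nc E r V \<le> \<epsilon> * (real (card V))\<^sup>2" by simp
  qed
qed

text \<open>Raising the coefficient by one gains about \<open>n\<^sup>2 / 4\<close>. Passing to
  \<open>n - k + 1\<close> and rounding cost at most \<open>n\<^sup>2 / 16\<close>, so an error of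
  \<open>n\<^sup>2 / 16\<close> on the left is affordable.\<close>

lemma turan_gap:
  fixes n k c :: nat
  assumes "c \<le> 2 ^ k" "16 * ((2 ^ k + 1) * (k + 1)) \<le> n"
  shows "c * (real n)\<^sup>2 / 4 + (real n)\<^sup>2 / 16 \<le> (c + 1) * real ((n - k + 1)\<^sup>2 div 4)"
proof -
  have "k + 1 \<le> (2 ^ k + 1) * (k + 1)" by simp
  then have kn: "k \<le> n" "1 \<le> n" using assms(2) by linarith+
  let ?m = "n - k + 1"
  have "?m\<^sup>2 \<le> 4 * (?m\<^sup>2 div 4) + 3" by presburger
  from of_nat_mono[OF this, where ?'a = real]
  have 1: "(real ?m)\<^sup>2 / 4 - 1 \<le> real (?m\<^sup>2 div 4)" by simp
  have m: "real ?m = real n - k + 1" using kn by (simp add: of_nat_diff)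
  have "(real n - k)\<^sup>2 \<le> (real ?m)\<^sup>2" unfolding m using kn by (intro power_mono) auto
  then have "(real n)\<^sup>2 - 2 * k * n \<le> (real ?m)\<^sup>2" by (simp add: power2_eq_square algebra_simps) (smt (verit) mult_nonneg_nonneg of_nat_0_le_iff)
  then have 2: "(real n)\<^sup>2 / 4 - (k * n / 2 + 1) \<le> real (?m\<^sup>2 div 4)" using 1 by simp
  have "(real c + 1) * (k * n / 2 + 1) \<le> (2 ^ k + 1) * ((k + 1) * real n)"
  proof (intro mult_mono)
    show "real c + 1 \<le> 2 ^ k + 1" using of_nat_mono[OF assms(1), where ?'a = real] by simp
    have "0 \<le> real (k * n)" "1 \<le> real n" using kn by auto
    moreover have "real (k + 1) * real n = real (k * n) + real n" by (simp add: algebra_simps)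
    ultimately show "real (k * n) / 2 + 1 \<le> real (k + 1) * real n" by linarith
  qed auto
  also have "\<dots> = real ((2 ^ k + 1) * (k + 1)) * n" by (simp add: algebra_simps)
  also have "\<dots> \<le> (real n / 16) * n"
    using of_nat_mono[OF assms(2), where ?'a = real] by (intro mult_right_mono) auto
  finally have 3: "(real c + 1) * (k * n / 2 + 1) \<le> (real n)\<^sup>2 / 16" by (simp add: power2_eq_square)
  have "(real c + 1) * ((real n)\<^sup>2 / 4 - (k * n / 2 + 1)) \<le> (real c + 1) * real (?m\<^sup>2 div 4)"
    using 2 by (intro mult_left_mono) auto
  then have "c * (real n)\<^sup>2 / 4 + (real n)\<^sup>2 / 4 - (real n)\<^sup>2 / 16 \<le> (real c + 1) * real (?m\<^sup>2 div 4)"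
  proof -
    have expand: "(x + 1) * (N / 4 - y) = x * N / 4 + N / 4 - (x + 1) * y" for x N y :: real
      by (simp add: field_simps)
    assume "(real c + 1) * ((real n)\<^sup>2 / 4 - (k * n / 2 + 1)) \<le> (real c + 1) * real (?m\<^sup>2 div 4)"
    then show ?thesis unfolding expand using 3 by linarith
  qed
  moreover have "0 \<le> (real n)\<^sup>2" by simp
  ultimately have "c * (real n)\<^sup>2 / 4 + (real n)\<^sup>2 / 16 \<le> (real c + 1) * real (?m\<^sup>2 div 4)" by linarith
  moreover have "real (c + 1) = real c + 1" by simp
  ultimately show ?thesis by (simp only:)
qed

text \<open>With \<open>k - 1\<close> big vertices the rest is theta-free, and the join bound with
  \<open>edges_and_triangles_bound\<close> is exact. With fewer, the leading coefficient is smaller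
  and the rough bound suffices by \<open>turan_gap\<close>.\<close>

lemma cliques_upper_small:
  assumes k: "2 \<le> k"
  obtains n0 where "\<And>(E :: 'a \<Rightarrow> 'a \<Rightarrow> bool) V r. graph_rel E \<Longrightarrow> finite V \<Longrightarrow> disjoint_thetas_free ps k E V \<Longrightarrow>
    n0 \<le> card V \<Longrightarrow> 3 \<le> r \<Longrightarrow> r \<le> k + 1 \<Longrightarrow>
    nc E r V \<le> (k - 1 choose r) + (k - 1 choose (r - 1)) * (card V - k + 1)
      + (k - 1 choose (r - 2)) * ((card V - k + 1)\<^sup>2 div 4)"
proof -
  \<comment> \<open>Cliques with at most \<open>r - 3\<close> vertices in \<open>B\<close> have at
    least three outside. There are at most \<open>2 ^ (k - 1)\<close> choices inside
    \<open>B\<close>, and \<open>cliques_le_triangles\<close> contributes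
    \<open>3 * 2 ^ h\<close>.\<close>
  define C :: nat where "C = 2 ^ (k - 1) * (3 * 2 ^ h)"
  obtain n1 where n1: "\<And>(E :: 'a \<Rightarrow> 'a \<Rightarrow> bool) V. graph_rel E \<Longrightarrow> finite V \<Longrightarrow> theta_free ps E V \<Longrightarrow>
    n1 \<le> card V \<Longrightarrow> nc E 2 V + C * nc E 3 V \<le> (card V)\<^sup>2 div 4"
    using edges_and_triangles_bound[of C] by blast
  obtain n2 where n2: "\<And>(E :: 'a \<Rightarrow> 'a \<Rightarrow> bool) V. graph_rel E \<Longrightarrow> finite V \<Longrightarrow> disjoint_thetas_free ps k E V \<Longrightarrow>
    n2 \<le> card V \<Longrightarrow> \<exists>B U. B \<subseteq> U \<and> U \<subseteq> V \<and> card B < k \<and> (Suc (card B) = k \<longrightarrow> theta_free ps E (V - B)) \<and>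
      theta_free ps E (V - U) \<and> card U \<le> k + k * h \<and>
      (\<forall>r\<ge>2. nc E r V \<le> (card B choose (r - 2)) * real (nc E 2 (V - U)) + 1 / 16 * (real (card V))\<^sup>2)"
    using rough_bound[of k "1 / 16"] k by auto
  define n3 where "n3 = 16 * ((2 ^ k + 1) * (k + 1))"
  show thesis
  proof (rule that[of "n1 + (k + k * h) + n2 + n3"])
    fix E :: "'a \<Rightarrow> 'a \<Rightarrow> bool" and V r
    assume E: "graph_rel E" and V: "finite V" and free: "disjoint_thetas_free ps k E V"
      and n: "n1 + (k + k * h) + n2 + n3 \<le> card V" and r: "3 \<le> r" "r \<le> k + 1"
    interpret graph_rel E by fact
    interpret critical_theta_graph ps i0 E by unfold_locales
    have "n2 \<le> card V" using n by simp
    from n2[OF E V free this] obtain B U where B: "B \<subseteq> U" "U \<subseteq> V" "card B < k"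
      and free1: "Suc (card B) = k \<longrightarrow> theta_free ps E (V - B)" and freeU: "theta_free ps E (V - U)"
      and cU: "card U \<le> k + k * h"
      and bound: "\<forall>r\<ge>2. nc E r V \<le> (card B choose (r - 2)) * real (nc E 2 (V - U)) + 1 / 16 * (real (card V))\<^sup>2"
      by (elim exE conjE)
    have fin: "finite U" "finite B" using V B by (meson finite_subset)+
    obtain s where s: "r = Suc (Suc (Suc s))" "s + 2 \<le> k"
      using r by (metis Suc_le_D add_Suc_right add_2_eq_Suc' numeral_3_eq_3 Suc_le_mono add.right_neutral One_nat_def)
    have target: "r - 1 = Suc (Suc s)" "r - 2 = Suc s" using s by auto
    show "nc E r V \<le> (k - 1 choose r) + (k - 1 choose (r - 1)) * (card V - k + 1)
      + (k - 1 choose (r - 2)) * ((card V - k + 1)\<^sup>2 div 4)"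
    proof (cases "Suc (card B) = k")
      case True
      let ?H = "V - B" and ?m = "card V - k + 1"
      have cB: "card B = k - 1" using True by simp
      have "card ?H = card V - card B" using fin B by (intro card_Diff_subset) auto
      then have m: "card ?H = ?m" using cB n k by linarith
      have freeH: "theta_free ps E ?H" using free1 True by simp
      have "nc E 2 ?H + C * nc E 3 ?H \<le> (card ?H)\<^sup>2 div 4"
        by (rule n1[OF E _ freeH]) (use V m n in auto)
      then have main: "nc E 2 ?H + C * nc E 3 ?H \<le> ?m\<^sup>2 div 4" using m by simp
      have "nc E r V = nc E r (B \<union> ?H)" using B by (metis Un_Diff_cancel sup.absorb2 subset_trans)
      also have "\<dots> \<le> (\<Sum>j\<le>r. (card B choose j) * nc E (r - j) ?H)" using fin V by (intro nc_join_le) auto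
      also have "\<dots> = (\<Sum>j\<le>s. (k - 1 choose j) * nc E (r - j) ?H) + (k - 1 choose (r - 2)) * nc E 2 ?H
          + (k - 1 choose (r - 1)) * ?m + (k - 1 choose r)"
      proof -
        have "nc E (Suc 0) ?H = ?m" "nc E 0 ?H = 1" using V by (simp_all add: nc_1 nc_0 m)
        moreover have "r - Suc s = 2" "r - Suc (Suc s) = Suc 0" "r - Suc (Suc (Suc s)) = 0" using s by auto
        ultimately show ?thesis by (simp add: s(1) target cB numeral_2_eq_2)
      qed
      also have "(\<Sum>j\<le>s. (k - 1 choose j) * nc E (r - j) ?H) \<le> (\<Sum>j\<le>s. (k - 1 choose j) * (3 * 2 ^ h * nc E 3 ?H))"
      proof (intro sum_mono mult_le_mono2)
        fix j assume "j \<in> {..s}"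
        then have "r - j = (s - j) + 3" using s by simp
        then show "nc E (r - j) ?H \<le> 3 * 2 ^ h * nc E 3 ?H"
          using cliques_le_triangles[of ?H "s - j"] freeH V by simp
      qed
      also have "\<dots> = (\<Sum>j\<le>s. k - 1 choose j) * (3 * 2 ^ h * nc E 3 ?H)" by (simp add: sum_distrib_right)
      also have "\<dots> \<le> 2 ^ (k - 1) * (3 * 2 ^ h * nc E 3 ?H)"
      proof (intro mult_le_mono1)
        have "(\<Sum>j\<le>s. k - 1 choose j) \<le> (\<Sum>j\<le>k - 1. k - 1 choose j)"
          using s by (intro sum_mono2) auto
        then show "(\<Sum>j\<le>s. k - 1 choose j) \<le> 2 ^ (k - 1)" by (simp add: choose_row_sum)
      qed
      also have "\<dots> = C * nc E 3 ?H" by (simp add: C_def)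
      \<comment> \<open>As \<open>r \<le> k + 1\<close>, the coefficient is at least one; the
        triangles can then share the factor of the edges.\<close>
      also have "\<dots> \<le> (k - 1 choose (r - 2)) * (C * nc E 3 ?H)"
      proof -
        have "0 < (k - 1 choose (r - 2))" using s target by (intro zero_less_binomial) linarith
        then have "1 \<le> (k - 1 choose (r - 2))" by linarith
        from mult_le_mono1[OF this, of "C * nc E 3 ?H"] show ?thesis by simp
      qed
      finally have "nc E r V \<le> (k - 1 choose r) + (k - 1 choose (r - 1)) * ?m
          + (k - 1 choose (r - 2)) * (nc E 2 ?H + C * nc E 3 ?H)"
        by (simp add: algebra_simps)
      also have "\<dots> \<le> (k - 1 choose r) + (k - 1 choose (r - 1)) * ?m + (k - 1 choose (r - 2)) * (?m\<^sup>2 div 4)"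
        using main by (intro add_left_mono mult_le_mono2)
      finally show ?thesis .
    next
      case False
      then have cB: "card B \<le> k - 2" using B(3) by linarith
      define c where "c = (k - 2 choose (r - 2))"
      have ck: "c \<le> 2 ^ k"
      proof -
        have "c \<le> 2 ^ (k - 2)" unfolding c_def by (rule binomial_le_two_power)
        also have "\<dots> \<le> 2 ^ k" by (intro power_increasing) auto
        finally show ?thesis .
      qed
      have "card V - card U \<le> card (V - U)" by (rule diff_card_le_card_Diff) fact
      then have "n1 \<le> card (V - U)" using n cU by linarith
      then have "nc E 2 (V - U) \<le> (card (V - U))\<^sup>2 div 4"
        using n1[OF E _ freeU] V by force
      also have "\<dots> \<le> (card V)\<^sup>2 div 4" using V by (intro div_le_mono power_mono card_mono) auto
      finally have "4 * nc E 2 (V - U) \<le> (card V)\<^sup>2" by linarith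
      from of_nat_mono[OF this, where ?'a = real]
      have e: "real (nc E 2 (V - U)) \<le> (real (card V))\<^sup>2 / 4" by simp
      have cc: "(card B choose (r - 2)) \<le> c" unfolding c_def by (rule binomial_right_mono) fact
      have "real (nc E r V) \<le> (card B choose (r - 2)) * real (nc E 2 (V - U)) + 1 / 16 * (real (card V))\<^sup>2"
        using bound r by simp
      also have "\<dots> \<le> c * ((real (card V))\<^sup>2 / 4) + 1 / 16 * (real (card V))\<^sup>2"
        using e cc by (intro add_mono mult_mono) auto
      also have "\<dots> \<le> (c + 1) * real ((card V - k + 1)\<^sup>2 div 4)"
        using turan_gap[OF ck, of "card V"] n by (simp add: n3_def)
      finally have "real (nc E r V) \<le> real ((c + 1) * ((card V - k + 1)\<^sup>2 div 4))" by (simp only: of_nat_mult)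
      then have "nc E r V \<le> (c + 1) * ((card V - k + 1)\<^sup>2 div 4)" by (simp only: of_nat_le_iff)
      \<comment> \<open>Pascal's rule: the coefficient exceeds \<open>c\<close> by
        \<open>k - 2 choose s\<close>, which is positive because
        \<open>s + 2 \<le> k\<close>.\<close>
      also have "\<dots> \<le> (k - 1 choose (r - 2)) * ((card V - k + 1)\<^sup>2 div 4)"
      proof (intro mult_le_mono1)
        have "k - 1 = Suc (k - 2)" using k by simp
        then have "(k - 1 choose (r - 2)) = (k - 2 choose s) + c" by (simp add: target c_def)
        moreover have "0 < (k - 2 choose s)" using s by (intro zero_less_binomial) linarith
        ultimately show "c + 1 \<le> (k - 1 choose (r - 2))" by linarith
      qed
      finally show ?thesis by simp
    qed
  qed
qed

end

section \<open>The extremal graph\<close>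

context critical_theta
begin

text \<open>The parity of any path decides whether \<open>Source\<close> and \<open>Sink\<close>
  agree in colour, and the path \<open>i0\<close> contradicts every other path.\<close>

lemma not_two_colourable:
  fixes c :: "theta_vertex \<Rightarrow> bool"
  assumes "\<And>u v. {u, v} \<in> ET \<Longrightarrow> c u \<noteq> c v"
  shows False
proof -
  have path: "c (theta_path ps i j) = (c Source \<noteq> odd j)" if i: "i < length ps" and j: "j \<le> ps ! i" for i j
    using j
  proof (induction j)
    case 0
    then show ?case by (simp add: theta_path_def)
  next
    case (Suc j)
    then show ?case using assms[OF edge_in[OF i, of j]] by auto
  qed
  have Sink: "c Sink = (c Source \<noteq> odd (ps ! i))" if "i < length ps" for i
    using path[OF that order_refl] path_pos[OF that] by (simp add: theta_path_def)
  obtain i where i: "i < length ps" "i \<noteq> i0"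
  proof (cases "i0 = 0")
    case True
    then show thesis using that[of 1] two_paths by simp
  next
    case False
    moreover have "0 < length ps" using two_paths by linarith
    ultimately show thesis using that[of 0] by blast
  qed
  show False using Sink[OF i(1)] Sink[OF i0] parity[OF i] by blast
qed

end

text \<open>For \<open>b = k - 1\<close> and a suitable \<open>s\<close> this is the extremal graph: the vertices below \<open>b\<close> are
  joined to everything, the others form a complete bipartite graph with classes split at \<open>s\<close>.\<close>

definition extremal :: "nat \<Rightarrow> nat \<Rightarrow> nat \<Rightarrow> nat \<Rightarrow> bool" where
  "extremal b s x y \<longleftrightarrow> x \<noteq> y \<and> (x < b \<or> y < b \<or> (x < s) \<noteq> (y < s))"

lemma graph_rel_extremal: "graph_rel (extremal b s)"
  by standard (auto simp: extremal_def)

text \<open>Without the vertices below \<open>b\<close> the graph is bipartite, so every copy uses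
  one of them, and disjoint copies use different ones.\<close>

lemma (in critical_theta) extremal_free:
  assumes "b < k"
  shows "disjoint_thetas_free ps k (extremal b s) V"
  unfolding disjoint_thetas_free_def
proof (rule notI, elim exE conjE)
  fix g assume emb: "\<forall>i<k. theta_emb ps (extremal b s) V (g i)"
    and dis: "\<forall>i<k. \<forall>j<k. i \<noteq> j \<longrightarrow> g i ` VT \<inter> g j ` VT = {}"
  have "\<exists>u. u \<in> VT \<and> g i u < b" if i: "i < k" for i
  proof (rule ccontr)
    assume "\<not> ?thesis"
    then have no: "\<not> g i u < b" if "u \<in> VT" for u using that by blast
    show False
    proof (rule not_two_colourable[of "\<lambda>u. g i u < s"])
      fix u v assume uv: "{u, v} \<in> ET"
      have "extremal b s (g i u) (g i v)" using emb i uv by (simp add: theta_emb_def)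
      then show "(g i u < s) \<noteq> (g i v < s)" using no edge_verts[OF uv] by (simp add: extremal_def)
    qed
  qed
  then obtain u where u: "\<And>i. i < k \<Longrightarrow> u i \<in> VT \<and> g i (u i) < b" by metis
  have "inj_on (\<lambda>i. g i (u i)) {..<k}"
  proof (rule inj_onI)
    fix i j assume ij: "i \<in> {..<k}" "j \<in> {..<k}" "g i (u i) = g j (u j)"
    have "g i (u i) \<in> g i ` VT" "g j (u j) \<in> g j ` VT"
      using u[of i] u[of j] ij(1,2) by auto
    then have "g i ` VT \<inter> g j ` VT \<noteq> {}" using ij(3) by (metis IntI empty_iff)
    then show "i = j" using dis ij(1,2) by blast
  qed
  moreover have "(\<lambda>i. g i (u i)) ` {..<k} \<subseteq> {..<b}" using u by auto
  ultimately have "card {..<k} \<le> card {..<b}" by (meson card_inj_on_le finite_lessThan)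
  then show False using assms by simp
qed

lemma square_div_4: "(m div 2) * (m - m div 2) = m\<^sup>2 div (4::nat)"
proof (cases "even m")
  case True
  then obtain q where "m = 2 * q" by blast
  then show ?thesis by (simp add: power2_eq_square)
next
  case False
  then obtain q where q: "m = 2 * q + 1" by (auto elim: oddE)
  have "m\<^sup>2 = 4 * (q * (q + 1)) + 1" by (simp add: q power2_eq_square algebra_simps)
  then have "m\<^sup>2 div 4 = q * (q + 1)" by simp
  then show ?thesis by (simp add: q)
qed

text \<open>Only the terms of the join formula with at most two vertices outside the first
  \<open>b\<close> are kept; a lower bound is enough, since the upper bound matches it.\<close>

lemma extremal_count:
  assumes b: "b < n" and r: "2 \<le> r"
  shows "(b choose r) + (b choose (r - 1)) * (n - b) + (b choose (r - 2)) * ((n - b)\<^sup>2 div 4)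
    \<le> nc (extremal b (b + (n - b) div 2)) r {..<n}"
proof -
  let ?s = "b + (n - b) div 2"
  let ?E = "extremal b ?s" and ?R = "{b..<n}"
  interpret graph_rel ?E by (rule graph_rel_extremal)
  let ?P = "{b..<?s}" and ?Q = "{?s..<n}"
  have R: "?R = ?P \<union> ?Q" by auto
  have "nb ?E ?Q a = ?Q" if "a \<in> ?P" for a using that by (auto simp: extremal_def)
  then have "(\<Sum>a\<in>?P. card (nb ?E ?Q a)) = card ?P * card ?Q" by simp
  also have "\<dots> = ((n - b) div 2) * (n - b - (n - b) div 2)" by simp
  finally have "(\<Sum>a\<in>?P. card (nb ?E ?Q a)) = (n - b)\<^sup>2 div 4" by (simp only: square_div_4)
  then have e: "(n - b)\<^sup>2 div 4 \<le> nc ?E 2 ?R"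
    unfolding R by (subst nc_2_union) auto
  obtain q where q: "r = Suc (Suc q)" using r by (metis Suc_le_D numeral_2_eq_2 Suc_le_mono)
  have "{..<n} = {..<b} \<union> ?R" using b by auto
  then have "nc ?E r {..<n} = nc ?E r ({..<b} \<union> ?R)" by simp
  also have "\<dots> = (\<Sum>j\<le>r. (card {..<b} choose j) * nc ?E (r - j) ?R)"
    by (rule nc_join_eq) (auto simp: extremal_def)
  also have "\<dots> = (\<Sum>j<q. (b choose j) * nc ?E (r - j) ?R) + (b choose q) * nc ?E 2 ?R
      + (b choose Suc q) * (n - b) + (b choose r)"
  proof -
    have "r - q = 2" "r - Suc q = Suc 0" "r - Suc (Suc q) = 0" using q by auto
    then show ?thesis by (simp add: q nc_0 nc_1 lessThan_Suc_atMost[symmetric] numeral_2_eq_2)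
  qed
  also have "\<dots> \<ge> (b choose q) * nc ?E 2 ?R + (b choose Suc q) * (n - b) + (b choose r)" by simp
  finally have "(b choose q) * nc ?E 2 ?R + (b choose Suc q) * (n - b) + (b choose r) \<le> nc ?E r {..<n}" .
  moreover have "(b choose q) * ((n - b)\<^sup>2 div 4) \<le> (b choose q) * nc ?E 2 ?R" using e by (rule mult_le_mono2)
  moreover have "r - 1 = Suc q" "r - 2 = q" using q by auto
  ultimately show ?thesis by (simp only:)
qed

subsection \<open>Transfer to the graphs of the statement\<close>

definition adj :: "'a sgraph \<Rightarrow> 'a \<Rightarrow> 'a \<Rightarrow> bool" where
  "adj G x y \<longleftrightarrow> {x, y} \<in> edges G"

lemma graph_rel_adj:
  assumes "simple_graph G" shows "graph_rel (adj G)"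
proof
  show "adj G x y \<Longrightarrow> adj G y x" for x y by (simp add: adj_def insert_commute)
  show "\<not> adj G x x" for x
  proof
    assume "adj G x x"
    then have "card {x} = 2" using assms by (auto simp: adj_def simple_graph_def)
    then show False by simp
  qed
qed

lemma image_two_subsets:
  assumes "bij_betw f A B"
  shows "(\<lambda>e. f ` e) ` {e. e \<subseteq> A \<and> card e = 2} = {e. e \<subseteq> B \<and> card e = 2}"
proof
  have inj: "inj_on f A" and im: "f ` A = B" using assms by (auto simp: bij_betw_def)
  show "(\<lambda>e. f ` e) ` {e. e \<subseteq> A \<and> card e = 2} \<subseteq> {e. e \<subseteq> B \<and> card e = 2}"
    using inj im by (auto simp: card_image inj_on_subset)
  show "{e. e \<subseteq> B \<and> card e = 2} \<subseteq> (\<lambda>e. f ` e) ` {e. e \<subseteq> A \<and> card e = 2}"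
  proof
    fix e assume e: "e \<in> {e. e \<subseteq> B \<and> card e = 2}"
    then obtain d where d: "d \<subseteq> A" "e = f ` d" using im by (metis (no_types, lifting) mem_Collect_eq subset_imageE)
    have "inj_on f d" using inj d(1) by (rule inj_on_subset)
    then have "card d = 2" using e d(2) by (simp add: card_image)
    then show "e \<in> (\<lambda>e. f ` e) ` {e. e \<subseteq> A \<and> card e = 2}" using d by blast
  qed
qed

text \<open>A complete copy contains all pairs of its vertices as edges, so it is determined by its
  vertex set.\<close>

lemma card_copies_complete_graph:
  assumes G: "simple_graph G"
  shows "card (copies (complete_graph r) G) = nc (adj G) r (verts G)"
proof -
  let ?full = "\<lambda>K. (K, {e. e \<subseteq> K \<and> card e = 2})"
  have fin: "finite (verts G)" using G by (simp add: simple_graph_def)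
  have "copies (complete_graph r) G = ?full ` cliques (adj G) r (verts G)"
  proof
    show "copies (complete_graph r) G \<subseteq> ?full ` cliques (adj G) r (verts G)"
    proof
      fix H assume H: "H \<in> copies (complete_graph r) G"
      then obtain f where f: "bij_betw f {..<r} (verts H)"
        "edges H = (\<lambda>e. f ` e) ` {e. e \<subseteq> {..<r} \<and> card e = 2}"
        by (auto simp: copies_def graph_iso_def complete_graph_def)
      have edges: "edges H = {e. e \<subseteq> verts H \<and> card e = 2}"
        unfolding f(2) by (rule image_two_subsets[OF f(1)])
      have sub: "verts H \<subseteq> verts G" "edges H \<subseteq> edges G" using H by (auto simp: copies_def subgraph_def)
      have "clique (adj G) (verts H)"
        unfolding clique_def adj_def using edges sub by auto
      moreover have "card (verts H) = r" using bij_betw_same_card[OF f(1)] by simp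
      ultimately have "verts H \<in> cliques (adj G) r (verts G)" using sub by (simp add: cliques_def)
      moreover have "H = ?full (verts H)" using edges by (metis prod.collapse)
      ultimately show "H \<in> ?full ` cliques (adj G) r (verts G)" by blast
    qed
    show "?full ` cliques (adj G) r (verts G) \<subseteq> copies (complete_graph r) G"
    proof
      fix H assume "H \<in> ?full ` cliques (adj G) r (verts G)"
      then obtain K where K: "K \<subseteq> verts G" "card K = r" "clique (adj G) K" "H = ?full K"
        by (auto simp: cliques_def)
      have finK: "finite K" using K fin finite_subset by blast
      have "e \<in> edges G" if "e \<subseteq> K" "card e = 2" for e
      proof -
        obtain x y where "e = {x, y}" "x \<noteq> y" using \<open>card e = 2\<close> by (meson card_2_iff)
        then show ?thesis using that K(3) by (auto simp: clique_def adj_def)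
      qed
      then have "subgraph H G" using K finK by (auto simp: subgraph_def simple_graph_def)
      moreover obtain f where f: "bij_betw f {..<r} K"
        using ex_bij_betw_nat_finite[OF finK] K(2) by (auto simp: atLeast0LessThan)
      then have "graph_iso (complete_graph r) H"
        unfolding graph_iso_def complete_graph_def K(4)
        using f image_two_subsets[OF f] by (intro exI[of _ f]) simp
      ultimately show "H \<in> copies (complete_graph r) G" by (simp add: copies_def)
    qed
  qed
  moreover have "inj_on ?full (cliques (adj G) r (verts G))" by (auto simp: inj_on_def)
  ultimately show ?thesis by (simp add: card_image nc_def)
qed

lemma theta_edge_doubleton:
  assumes "e \<in> edges (theta_graph ps)"
  obtains u v where "e = {u, v}"
  using assms by (auto simp: theta_graph_def)

text \<open>In one direction \<open>k\<close> embeddings are glued to a map on pairs, whose image is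
  the copy \<open>H\<close>; in the other such a map is restricted to each first component.\<close>

lemma (in theta) copies_disjoint_copies_iff:
  assumes G: "simple_graph G" and \<phi>: "bij_betw \<phi> VT (verts F)" "edges F = (\<lambda>e. \<phi> ` e) ` ET"
  shows "copies (disjoint_copies k F) G = {} \<longleftrightarrow> disjoint_thetas_free ps k (adj G) (verts G)"
proof (rule iffI)
  assume none: "copies (disjoint_copies k F) G = {}"
  show "disjoint_thetas_free ps k (adj G) (verts G)"
    unfolding disjoint_thetas_free_def
  proof (rule notI, elim exE conjE)
    fix g assume emb: "\<forall>i<k. theta_emb ps (adj G) (verts G) (g i)"
      and dis: "\<forall>i<k. \<forall>j<k. i \<noteq> j \<longrightarrow> g i ` VT \<inter> g j ` VT = {}"
    have inj: "inj_on (g i) VT" and into: "g i ` VT \<subseteq> verts G"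
      and edge: "\<And>u v. {u, v} \<in> ET \<Longrightarrow> {g i u, g i v} \<in> edges G" if "i < k" for i
      using emb that by (auto simp: theta_emb_def adj_def)
    define \<psi> where "\<psi> = inv_into VT \<phi>"
    have \<psi>: "bij_betw \<psi> (verts F) VT" unfolding \<psi>_def by (rule bij_betw_inv_into[OF \<phi>(1)])
    have \<psi>\<phi>: "\<psi> (\<phi> u) = u" if "u \<in> VT" for u
      unfolding \<psi>_def using \<phi>(1) that by (simp add: bij_betw_def)
    have ETsub: "e \<subseteq> VT" if "e \<in> ET" for e
      using that edge_verts by (metis theta_edge_doubleton insert_subset empty_subsetI)
    have \<psi>e: "\<psi> ` \<phi> ` e = e" if "e \<in> ET" for e
    proof -
      have "\<psi> (\<phi> u) = u" if "u \<in> e" for u using \<psi>\<phi> ETsub[OF \<open>e \<in> ET\<close>] that by blast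
      then show ?thesis by (force simp: image_image)
    qed
    define f where "f p = g (fst p) (\<psi> (snd p))" for p
    define H where "H = (f ` ({..<k} \<times> verts F), (\<lambda>e. f ` e) ` edges (disjoint_copies k F))"
    have \<psi>V: "\<psi> v \<in> VT" if "v \<in> verts F" for v using \<psi> that by (auto simp: bij_betw_def)
    have injf: "inj_on f ({..<k} \<times> verts F)"
    proof (rule inj_onI)
      fix p q assume p: "p \<in> {..<k} \<times> verts F" and q: "q \<in> {..<k} \<times> verts F" and eq: "f p = f q"
      have "f p \<in> g (fst p) ` VT" "f q \<in> g (fst q) ` VT" using p q \<psi>V by (auto simp: f_def)
      then have "g (fst p) ` VT \<inter> g (fst q) ` VT \<noteq> {}" using eq by (metis IntI empty_iff)
      then have 1: "fst p = fst q" using dis p q by (metis lessThan_iff mem_Times_iff)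
      then have "\<psi> (snd p) = \<psi> (snd q)"
        using eq inj_onD[OF inj, of "fst p" "\<psi> (snd p)" "\<psi> (snd q)"] p q \<psi>V by (auto simp: f_def)
      then have "snd p = snd q" using \<psi> p q by (auto simp: bij_betw_def dest: inj_onD)
      with 1 show "p = q" by (simp add: prod_eq_iff)
    qed
    have edges: "edges (disjoint_copies k F) = {Pair i ` \<phi> ` e | i e. i < k \<and> e \<in> ET}"
      unfolding disjoint_copies_def using \<phi>(2) by auto
    have fe: "f ` Pair i ` \<phi> ` e = g i ` e" if "e \<in> ET" for i e
    proof -
      have "f ` Pair i ` \<phi> ` e = g i ` (\<psi> ` \<phi> ` e)" by (simp add: f_def image_image)
      then show ?thesis using \<psi>e[OF that] by simp
    qed
    have eH: "\<exists>i<k. \<exists>d\<in>ET. e = g i ` d" if "e \<in> edges H" for e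
    proof -
      from that obtain i d where id: "i < k" "d \<in> ET" "e = f ` Pair i ` \<phi> ` d"
        unfolding H_def snd_conv edges by blast
      then show ?thesis using fe[OF id(2), of i] by auto
    qed
    have sub: "g i ` e \<in> edges G" "g i ` e \<subseteq> f ` ({..<k} \<times> verts F)" if ie: "i < k" "e \<in> ET" for i e
    proof -
      obtain u v where "e = {u, v}" using ie(2) by (rule theta_edge_doubleton)
      then show "g i ` e \<in> edges G" using edge[OF ie(1), of u v] ie(2) by simp
      have "\<phi> ` e \<subseteq> verts F" using ETsub[OF ie(2)] \<phi>(1) by (auto simp: bij_betw_def)
      then have "Pair i ` \<phi> ` e \<subseteq> {..<k} \<times> verts F" using ie by auto
      then have "f ` Pair i ` \<phi> ` e \<subseteq> f ` ({..<k} \<times> verts F)" by (rule image_mono)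
      then show "g i ` e \<subseteq> f ` ({..<k} \<times> verts F)" unfolding fe[OF ie(2)] .
    qed
    have vH: "verts H \<subseteq> verts G"
    proof
      fix x assume "x \<in> verts H"
      then obtain i v where iv: "i < k" "v \<in> verts F" "x = g i (\<psi> v)" by (auto simp: H_def f_def)
      then show "x \<in> verts G" using into[OF iv(1)] \<psi>V[OF iv(2)] by blast
    qed
    have "simple_graph H"
      unfolding simple_graph_def
    proof (intro conjI ballI)
      show "finite (verts H)" using vH G finite_subset by (auto simp: simple_graph_def)
      fix e assume "e \<in> edges H"
      then obtain i d where d: "e = g i ` d" "i < k" "d \<in> ET" using eH by blast
      show "e \<subseteq> verts H" using sub(2)[OF d(2,3)] d(1) by (simp add: H_def)
      show "card e = 2" using sub(1)[OF d(2,3)] d(1) G by (auto simp: simple_graph_def)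
    qed
    moreover have "edges H \<subseteq> edges G" using eH sub(1) by blast
    ultimately have "subgraph H G" using vH by (simp add: subgraph_def)
    moreover have "graph_iso (disjoint_copies k F) H"
      unfolding graph_iso_def using injf by (intro exI[of _ f]) (simp add: H_def bij_betw_def disjoint_copies_def)
    ultimately have "H \<in> copies (disjoint_copies k F) G" by (simp add: copies_def)
    then show False using none by simp
  qed
next
  assume free: "disjoint_thetas_free ps k (adj G) (verts G)"
  show "copies (disjoint_copies k F) G = {}"
  proof (rule ccontr)
    assume "copies (disjoint_copies k F) G \<noteq> {}"
    then obtain H f where H: "subgraph H G" and f: "bij_betw f ({..<k} \<times> verts F) (verts H)"
      "edges H = (\<lambda>e. f ` e) ` edges (disjoint_copies k F)"
      by (auto simp: copies_def graph_iso_def disjoint_copies_def)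
    have sub: "verts H \<subseteq> verts G" "edges H \<subseteq> edges G" using H by (auto simp: subgraph_def)
    define g where "g i u = f (i, \<phi> u)" for i u
    have \<phi>V: "\<phi> u \<in> verts F" if "u \<in> VT" for u using \<phi>(1) that by (auto simp: bij_betw_def)
    have "theta_emb ps (adj G) (verts G) (g i)" if i: "i < k" for i
      unfolding theta_emb_def
    proof (intro conjI allI impI)
      show "inj_on (g i) VT"
      proof (rule inj_onI)
        fix u v assume uv: "u \<in> VT" "v \<in> VT" "g i u = g i v"
        then have "(i, \<phi> u) = (i, \<phi> v)"
          using f(1) i \<phi>V by (auto simp: g_def bij_betw_def dest!: inj_onD)
        then show "u = v" using \<phi>(1) uv by (auto simp: bij_betw_def dest: inj_onD)
      qed
      show "g i ` VT \<subseteq> verts G"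
      proof
        fix x assume "x \<in> g i ` VT"
        then obtain u where u: "u \<in> VT" "x = f (i, \<phi> u)" by (auto simp: g_def)
        have "(i, \<phi> u) \<in> {..<k} \<times> verts F" using i \<phi>V[OF u(1)] by simp
        then show "x \<in> verts G" using u f(1) sub by (auto simp: bij_betw_def)
      qed
      fix u v assume uv: "{u, v} \<in> ET"
      then have "\<phi> ` {u, v} \<in> edges F" using \<phi>(2) by blast
      then have "Pair i ` \<phi> ` {u, v} \<in> edges (disjoint_copies k F)"
        unfolding disjoint_copies_def snd_conv using i by blast
      then have "f ` Pair i ` \<phi> ` {u, v} \<in> edges H" using f(2) by blast
      then show "adj G (g i u) (g i v)" using sub by (auto simp: adj_def g_def)
    qed
    moreover have "g i ` VT \<inter> g j ` VT = {}" if "i < k" "j < k" "i \<noteq> j" for i j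
    proof (rule ccontr)
      assume "g i ` VT \<inter> g j ` VT \<noteq> {}"
      then obtain u v where uv: "u \<in> VT" "v \<in> VT" "f (i, \<phi> u) = f (j, \<phi> v)" by (auto simp: g_def)
      have "(i, \<phi> u) = (j, \<phi> v)"
        by (rule inj_onD[of f "{..<k} \<times> verts F"]) (use f(1) uv that \<phi>V in \<open>auto simp: bij_betw_def\<close>)
      then show False using that by simp
    qed
    ultimately show False
      using disjoint_thetas_freeD[OF free, of "{..<k}" g] by auto
  qed
qed

subsection \<open>Edge-critical theta graphs\<close>

lemma chromatic_number_le: "proper_colouring G n c \<Longrightarrow> chromatic_number G \<le> n"
  unfolding chromatic_number_def by (intro Least_le exI)

lemma chromatic_number_colouring:
  assumes "proper_colouring G n c"
  obtains c' where "proper_colouring G (chromatic_number G) c'"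
proof -
  have "\<exists>c. proper_colouring G (chromatic_number G) c"
    unfolding chromatic_number_def using assms
    by (intro LeastI[of "\<lambda>n. \<exists>c. proper_colouring G n c" n]) blast
  then show thesis using that by blast
qed

lemma Suc_mod_2_neq: "Suc x mod 2 \<noteq> x mod 2"
  by presburger

context theta
begin

lemma proper_colouring_push:
  assumes \<phi>: "bij_betw \<phi> VT (verts F)" "edges F = (\<lambda>e. \<phi> ` e) ` ET"
    and c: "\<And>u. u \<in> VT \<Longrightarrow> c u < n" "\<And>u v. {u, v} \<in> ET \<Longrightarrow> c u \<noteq> c v"
  shows "proper_colouring F n (c \<circ> inv_into VT \<phi>)"
  unfolding proper_colouring_def
proof (intro conjI ballI allI impI)
  let ?\<psi> = "inv_into VT \<phi>"
  have \<psi>: "bij_betw ?\<psi> (verts F) VT" by (rule bij_betw_inv_into[OF \<phi>(1)])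
  show "(c \<circ> ?\<psi>) v < n" if "v \<in> verts F" for v using \<psi> that c(1) by (auto simp: bij_betw_def)
  fix a b assume "{a, b} \<in> edges F"
  then obtain e where e: "e \<in> ET" "{a, b} = \<phi> ` e" using \<phi>(2) by blast
  obtain u v where uv: "e = {u, v}" using e(1) by (rule theta_edge_doubleton)
  have uvV: "u \<in> VT" "v \<in> VT" using edge_verts e(1) uv by auto
  have inv: "?\<psi> (\<phi> u) = u" "?\<psi> (\<phi> v) = v" using uvV \<phi>(1) by (auto simp: bij_betw_def)
  have "(a = \<phi> u \<and> b = \<phi> v) \<or> (a = \<phi> v \<and> b = \<phi> u)" using e(2) uv by (simp add: doubleton_eq_iff)
  moreover have "c u \<noteq> c v" using c(2) e(1) uv by blast
  ultimately show "(c \<circ> ?\<psi>) a \<noteq> (c \<circ> ?\<psi>) b" using inv by auto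
qed

lemma neq_on_edges:
  assumes step: "\<And>i j. i < length ps \<Longrightarrow> j < ps ! i \<Longrightarrow> c (theta_path ps i j) \<noteq> c (theta_path ps i (Suc j))"
    and uv: "{u, v} \<in> ET"
  shows "c u \<noteq> c v"
proof -
  obtain i j where ij: "i < length ps" "j < ps ! i"
    "u = theta_path ps i j \<and> v = theta_path ps i (Suc j) \<or> v = theta_path ps i j \<and> u = theta_path ps i (Suc j)"
    using uv by (rule edge_cases)
  from ij(3) step[OF ij(1,2)] show ?thesis by (elim disjE conjE) simp_all
qed

text \<open>Colours alternate backwards from \<open>Sink\<close> along every path; a conflict is
  possible only at \<open>Source\<close>, which receives the third colour.\<close>

lemma three_colouring:
  obtains c :: "theta_vertex \<Rightarrow> nat" where "\<And>u. u \<in> VT \<Longrightarrow> c u < 3" "\<And>u v. {u, v} \<in> ET \<Longrightarrow> c u \<noteq> c v"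
proof
  define c :: "theta_vertex \<Rightarrow> nat" where
    "c u = (case u of Source \<Rightarrow> 2 | Sink \<Rightarrow> 0 | Inner i j \<Rightarrow> (ps ! i - j) mod 2)" for u
  have less: "(x::nat) mod 2 < 3" for x using mod_less_divisor[of 2 x] by simp
  show "c u < 3" for u by (cases u) (auto simp: c_def less)
  have path: "c (theta_path ps i j) = (ps ! i - j) mod 2" if "j \<noteq> 0" "j \<le> ps ! i" for i j
    using that by (auto simp: c_def theta_path_def)
  have step: "c (theta_path ps i j) \<noteq> c (theta_path ps i (Suc j))" if "i < length ps" "j < ps ! i" for i j
  proof (cases "j = 0")
    case True
    have "c (theta_path ps i j) = 2" using True by (simp add: c_def theta_path_def)
    moreover have "c (theta_path ps i (Suc j)) < 2" using path[of "Suc j" i] that by simp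
    ultimately show ?thesis by simp
  next
    case False
    have eq: "ps ! i - j = Suc (ps ! i - Suc j)" using that by simp
    have 1: "c (theta_path ps i j) = (ps ! i - j) mod 2" using False that by (intro path) auto
    have 2: "c (theta_path ps i (Suc j)) = (ps ! i - Suc j) mod 2" using that by (intro path) auto
    show ?thesis unfolding 1 2 eq by (rule Suc_mod_2_neq)
  qed
  show "c u \<noteq> c v" if "{u, v} \<in> ET" for u v
    using neq_on_edges[OF step that] .
qed

text \<open>A common edge contains no inner vertex, so both paths would be single edges, which
  \<open>theta_lengths\<close> excludes.\<close>

lemma edges_distinct:
  assumes "i < length ps" "i' < length ps" "i \<noteq> i'" "j < ps ! i" "j' < ps ! i'"
  shows "{theta_path ps i j, theta_path ps i (Suc j)} \<noteq> {theta_path ps i' j', theta_path ps i' (Suc j')}"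
proof
  assume eq: "{theta_path ps i j, theta_path ps i (Suc j)} = {theta_path ps i' j', theta_path ps i' (Suc j')}"
  have one: "ps ! i = 1"
  proof (rule ccontr)
    assume "ps ! i \<noteq> 1"
    then have "\<exists>l. Inner i l \<in> {theta_path ps i j, theta_path ps i (Suc j)}"
      using assms(4) by (cases "j = 0") (auto simp: theta_path_def)
    then show False unfolding eq using assms(3) by (auto simp: theta_path_def split: if_splits)
  qed
  have one': "ps ! i' = 1"
  proof (rule ccontr)
    assume "ps ! i' \<noteq> 1"
    then have "\<exists>l. Inner i' l \<in> {theta_path ps i' j', theta_path ps i' (Suc j')}"
      using assms(5) by (cases "j' = 0") (auto simp: theta_path_def)
    then show False unfolding eq[symmetric] using assms(3) by (auto simp: theta_path_def split: if_splits)
  qed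
  have "card {i, i'} \<le> card {l. l < length ps \<and> ps ! l = 1}"
    using assms one one' by (intro card_mono) auto
  also have "\<dots> = count_list ps 1"
    by (simp add: count_list_eq_length_filter length_filter_conv_card eq_commute)
  also have "\<dots> \<le> 1" using lengths by (simp add: theta_lengths_def)
  finally show False using assms(3) by simp
qed

text \<open>The chromatic number is at most 3, so without the critical edge, on a path
  \<open>a\<close>, two colours suffice. Such a colouring forces a common parity on all other paths;
  the path \<open>a\<close> must differ.\<close>

lemma edge_critical_parity:
  assumes \<phi>: "bij_betw \<phi> VT (verts F)" "edges F = (\<lambda>e. \<phi> ` e) ` ET" and crit: "edge_critical F"
  shows "\<exists>i0. critical_theta ps i0"
proof -
  obtain e where e: "e \<in> edges F" "chromatic_number (delete_edge F e) < chromatic_number F"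
    using crit by (auto simp: edge_critical_def)
  obtain d where d: "d \<in> ET" "e = \<phi> ` d" using e(1) \<phi>(2) by blast
  obtain a b where ab: "a < length ps" "b < ps ! a" "d = {theta_path ps a b, theta_path ps a (Suc b)}"
    using d(1) by (auto simp: theta_graph_def)
  obtain c3 where c3: "\<And>u. u \<in> VT \<Longrightarrow> c3 u < 3" "\<And>u v. {u, v} \<in> ET \<Longrightarrow> c3 u \<noteq> (c3 v :: nat)"
    using three_colouring by blast
  have p3: "proper_colouring F 3 (c3 \<circ> inv_into VT \<phi>)" by (rule proper_colouring_push[OF \<phi> c3])
  then have \<chi>3: "chromatic_number F \<le> 3" by (rule chromatic_number_le)
  have "proper_colouring (delete_edge F e) 3 (c3 \<circ> inv_into VT \<phi>)"
    using p3 by (auto simp: proper_colouring_def delete_edge_def)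
  then obtain cc where cc: "proper_colouring (delete_edge F e) (chromatic_number (delete_edge F e)) cc"
    by (rule chromatic_number_colouring)
  define c where "c u = cc (\<phi> u)" for u
  have c_less: "c u < chromatic_number (delete_edge F e)" if "u \<in> VT" for u
    using cc \<phi>(1) that by (auto simp: proper_colouring_def delete_edge_def c_def bij_betw_def)
  have c2: "c u < 2" if "u \<in> VT" for u using c_less[OF that] e(2) \<chi>3 by linarith
  have c_edge: "c (theta_path ps i j) \<noteq> c (theta_path ps i (Suc j))" if ij: "i < length ps" "i \<noteq> a" "j < ps ! i" for i j
  proof -
    let ?d = "{theta_path ps i j, theta_path ps i (Suc j)}"
    have "?d \<noteq> d" unfolding ab(3) by (rule edges_distinct) (use ij ab in auto)
    moreover have "?d \<subseteq> VT" "d \<subseteq> VT" using ij ab path_in by auto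
    ultimately have "\<phi> ` ?d \<noteq> \<phi> ` d" using \<phi>(1) by (metis bij_betw_def inj_on_image_eq_iff)
    moreover have "\<phi> ` ?d \<in> edges F" using edge_in[OF ij(1,3)] \<phi>(2) by blast
    ultimately have "{\<phi> (theta_path ps i j), \<phi> (theta_path ps i (Suc j))} \<in> edges (delete_edge F e)"
      using d by (simp add: delete_edge_def)
    then show ?thesis using cc unfolding proper_colouring_def c_def by blast
  qed
  have c_path: "c (theta_path ps i j) = c Source \<longleftrightarrow> even j" if i: "i < length ps" "i \<noteq> a" and j: "j \<le> ps ! i" for i j
    using j
  proof (induction j)
    case 0
    then show ?case by (simp add: theta_path_def)
  next
    case (Suc j)
    have "c (theta_path ps i j) \<noteq> c (theta_path ps i (Suc j))" using c_edge[OF i] Suc by simp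
    moreover have "c (theta_path ps i j) < 2" "c (theta_path ps i (Suc j)) < 2" "c Source < 2"
      using Suc i by (auto intro!: c2 path_in)
    ultimately show ?case using Suc by auto
  qed
  have Sink: "c Sink = c Source \<longleftrightarrow> even (ps ! i)" if "i < length ps" "i \<noteq> a" for i
    using c_path[OF that order_refl] path_pos[OF that(1)] by (simp add: theta_path_def)
  have "critical_theta ps a"
  proof
    show "a < length ps" by fact
    show "even (ps ! i) \<longleftrightarrow> odd (ps ! a)" if i: "i < length ps" "i \<noteq> a" for i
    proof (rule ccontr)
      assume "\<not> ?thesis"
      then have same: "even (ps ! i') \<longleftrightarrow> even (ps ! a)" if "i' < length ps" for i'
        using Sink[OF i] Sink[of i'] that by (cases "i' = a") auto
      define c' :: "theta_vertex \<Rightarrow> nat" where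
        "c' u = (case u of Source \<Rightarrow> 0 | Sink \<Rightarrow> ps ! a mod 2 | Inner i j \<Rightarrow> j mod 2)" for u
      have c'path: "c' (theta_path ps i' j) = j mod 2" if "i' < length ps" "j \<le> ps ! i'" for i' j
        using that same[OF that(1)] by (auto simp: c'_def theta_path_def even_iff_mod_2_eq_zero)
      have "proper_colouring F 2 (c' \<circ> inv_into VT \<phi>)"
      proof (rule proper_colouring_push[OF \<phi>])
        show "c' u < 2" for u by (cases u) (auto simp: c'_def)
        have step: "c' (theta_path ps i' j) \<noteq> c' (theta_path ps i' (Suc j))" if "i' < length ps" "j < ps ! i'" for i' j
        proof -
          have 1: "c' (theta_path ps i' j) = j mod 2" using that by (intro c'path) auto
          have 2: "c' (theta_path ps i' (Suc j)) = Suc j mod 2" using that by (intro c'path) auto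
          show ?thesis unfolding 1 2 by (rule Suc_mod_2_neq[symmetric])
        qed
        show "c' u \<noteq> c' v" if "{u, v} \<in> ET" for u v
          using neq_on_edges[OF step that] .
      qed
      then have "chromatic_number F \<le> 2" by (rule chromatic_number_le)
      \<comment> \<open>\<open>F\<close> itself would be 2-colourable, so without the critical edge
        one colour would suffice; but the path \<open>i\<close> still has an edge.\<close>
      then have "c u < 1" if "u \<in> VT" for u using c_less[OF that] e(2) by linarith
      moreover have "theta_path ps i 0 \<in> VT" "theta_path ps i (Suc 0) \<in> VT"
        using i path_pos[OF i(1)] by (auto intro!: path_in)
      ultimately have "c (theta_path ps i 0) = c (theta_path ps i (Suc 0))" by (metis less_one)
      then show False using c_edge[OF i, of 0] path_pos[OF i(1)] by simp
    qed
  qed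
  then show ?thesis by blast
qed

end

lemma disjoint_thetas_free_mono_rel:
  assumes "disjoint_thetas_free ps k E V" "\<And>x y. E' x y \<Longrightarrow> E x y"
  shows "disjoint_thetas_free ps k E' V"
  using assms unfolding disjoint_thetas_free_def theta_emb_def by metis

definition extremal_graph :: "nat \<Rightarrow> nat \<Rightarrow> nat sgraph" where
  "extremal_graph b n = ({..<n}, {{x, y} | x y. x < n \<and> y < n \<and> extremal b (b + (n - b) div 2) x y})"

lemma simple_extremal_graph: "simple_graph (extremal_graph b n)"
  by (auto simp: simple_graph_def extremal_graph_def extremal_def)

lemma adj_extremal_graph:
  "adj (extremal_graph b n) x y \<longleftrightarrow> x < n \<and> y < n \<and> extremal b (b + (n - b) div 2) x y"
proof -
  interpret graph_rel "extremal b (b + (n - b) div 2)" by (rule graph_rel_extremal)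
  show ?thesis using sym by (auto simp: adj_def extremal_graph_def doubleton_eq_iff)
qed

lemma cliques_extremal_graph:
  "nc (adj (extremal_graph b n)) r {..<n} = nc (extremal b (b + (n - b) div 2)) r {..<n}"
proof -
  have "cliques (adj (extremal_graph b n)) r {..<n} = cliques (extremal b (b + (n - b) div 2)) r {..<n}"
    unfolding cliques_def clique_def adj_extremal_graph by auto
  then show ?thesis by (simp add: nc_def)
qed

theorem theorem1p2:
  fixes k :: nat and F :: "'a sgraph"
  assumes "k \<ge> 2"
    and "generalized_theta F"
    and "edge_critical F"
  shows "(\<forall>\<^sub>F n in sequentially. \<forall>r. 3 \<le> r \<and> r \<le> k + 1 \<longrightarrow>
            gen_turan n (complete_graph r) (disjoint_copies k F) =
              (k - 1 choose r) + (k - 1 choose (r - 1)) * (n - k + 1)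
                + (k - 1 choose (r - 2)) * ((n - k + 1)\<^sup>2 div 4))
       \<and> (\<forall>r \<ge> k + 2.
            (\<lambda>n. real (gen_turan n (complete_graph r) (disjoint_copies k F)))
              \<in> o(\<lambda>n. (real n)\<^sup>2))"
proof -
  obtain ps \<phi> where ps: "theta_lengths ps"
    and \<phi>: "bij_betw \<phi> (verts (theta_graph ps)) (verts F)" "edges F = (\<lambda>e. \<phi> ` e) ` edges (theta_graph ps)"
    using assms(2) by (auto simp: generalized_theta_def graph_iso_def)
  interpret theta ps by standard (rule ps)
  obtain i0 where "critical_theta ps i0" using edge_critical_parity[OF \<phi> assms(3)] by blast
  then interpret critical_theta ps i0 .
  obtain e where "e \<in> edges F" using assms(3) by (auto simp: edge_critical_def)
  moreover have "0 < k" using assms(1) by simp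
  ultimately have "Pair 0 ` e \<in> edges (disjoint_copies k F)"
    unfolding disjoint_copies_def snd_conv by blast
  then have ne: "edges (disjoint_copies k F) \<noteq> {}" by blast
  let ?S = "\<lambda>n r. {card (copies (complete_graph r) G) | G :: nat sgraph.
            simple_graph G \<and> card (verts G) = n \<and> copies (disjoint_copies k F) G = {}}"
  have S: "\<exists>G :: nat sgraph. y = nc (adj G) r (verts G) \<and> graph_rel (adj G) \<and> finite (verts G) \<and> card (verts G) = n
      \<and> disjoint_thetas_free ps k (adj G) (verts G)" if "y \<in> ?S n r" for y n r
  proof -
    from that obtain G :: "nat sgraph" where G: "y = card (copies (complete_graph r) G)" "simple_graph G"
      "card (verts G) = n" "copies (disjoint_copies k F) G = {}" by blast
    have "y = nc (adj G) r (verts G)" unfolding G(1) by (rule card_copies_complete_graph[OF G(2)])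
    moreover have "finite (verts G)" using G(2) by (simp add: simple_graph_def)
    ultimately show ?thesis
      using graph_rel_adj[OF G(2)] G(3,4) copies_disjoint_copies_iff[OF G(2) \<phi>] by blast
  qed
  show ?thesis
  proof (intro conjI allI impI)
    obtain n0 where n0: "\<And>(E :: nat \<Rightarrow> nat \<Rightarrow> bool) V r. graph_rel E \<Longrightarrow> finite V \<Longrightarrow> disjoint_thetas_free ps k E V \<Longrightarrow>
      n0 \<le> card V \<Longrightarrow> 3 \<le> r \<Longrightarrow> r \<le> k + 1 \<Longrightarrow>
      nc E r V \<le> (k - 1 choose r) + (k - 1 choose (r - 1)) * (card V - k + 1)
        + (k - 1 choose (r - 2)) * ((card V - k + 1)\<^sup>2 div 4)"
      using cliques_upper_small[OF assms(1)] by blast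
    show "\<forall>\<^sub>F n in sequentially. \<forall>r. 3 \<le> r \<and> r \<le> k + 1 \<longrightarrow>
            gen_turan n (complete_graph r) (disjoint_copies k F) =
              (k - 1 choose r) + (k - 1 choose (r - 1)) * (n - k + 1)
                + (k - 1 choose (r - 2)) * ((n - k + 1)\<^sup>2 div 4)"
      unfolding eventually_sequentially
    proof (intro exI[of _ "n0 + k"] allI impI)
      fix n r assume n: "n0 + k \<le> n" and r: "3 \<le> r \<and> r \<le> k + 1"
      let ?f = "(k - 1 choose r) + (k - 1 choose (r - 1)) * (n - k + 1) + (k - 1 choose (r - 2)) * ((n - k + 1)\<^sup>2 div 4)"
      have upper: "y \<le> ?f" if y: "y \<in> ?S n r" for y
      proof -
        obtain G :: "nat sgraph" where G: "y = nc (adj G) r (verts G)" "graph_rel (adj G)" "finite (verts G)"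
          "card (verts G) = n" "disjoint_thetas_free ps k (adj G) (verts G)"
          using S[OF y] by blast
        show ?thesis using n0[OF G(2,3,5), of r] G(1,4) n r by simp
      qed
      let ?G = "extremal_graph (k - 1) n"
      have vG: "verts ?G = {..<n}" by (simp add: extremal_graph_def)
      have "disjoint_thetas_free ps k (adj ?G) (verts ?G)"
      proof (rule disjoint_thetas_free_mono_rel)
        show "disjoint_thetas_free ps k (extremal (k - 1) (k - 1 + (n - (k - 1)) div 2)) (verts ?G)"
          using assms(1) by (intro extremal_free) simp
      qed (simp add: adj_extremal_graph)
      then have mem: "card (copies (complete_graph r) ?G) \<in> ?S n r"
        using copies_disjoint_copies_iff[OF simple_extremal_graph \<phi>] simple_extremal_graph vG
        by (intro CollectI exI[of _ ?G]) simp
      have "?f \<le> card (copies (complete_graph r) ?G)"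
      proof -
        \<comment> \<open>Truncated subtraction: this is where \<open>n \<ge> k\<close> is
          needed.\<close>
        have eq: "n - (k - 1) = n - k + 1" using n assms(1) by linarith
        have cc: "card (copies (complete_graph r) ?G) = nc (extremal (k - 1) (k - 1 + (n - (k - 1)) div 2)) r {..<n}"
          unfolding card_copies_complete_graph[OF simple_extremal_graph] vG by (rule cliques_extremal_graph)
        have "k - 1 < n" "2 \<le> r" using n r assms(1) by linarith+
        from extremal_count[OF this] show ?thesis unfolding cc eq .
      qed
      then have "card (copies (complete_graph r) ?G) = ?f" using upper[OF mem] by linarith
      then have "?f \<in> ?S n r" using mem by simp
      then show "gen_turan n (complete_graph r) (disjoint_copies k F) = ?f"
        unfolding gen_turan_def using upper by (intro Max_eqI gen_turan_set(1)[OF ne]) auto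
    qed
  next
    fix r assume r: "k + 2 \<le> r"
    have k1: "1 \<le> k" using assms(1) by simp
    show "(\<lambda>n. real (gen_turan n (complete_graph r) (disjoint_copies k F))) \<in> o(\<lambda>n. (real n)\<^sup>2)"
    proof (rule landau_o.smallI)
      fix \<epsilon> :: real assume \<epsilon>: "0 < \<epsilon>"
      obtain n0 where n0: "\<And>(E :: nat \<Rightarrow> nat \<Rightarrow> bool) V. graph_rel E \<Longrightarrow> finite V \<Longrightarrow> disjoint_thetas_free ps k E V \<Longrightarrow>
        n0 \<le> card V \<Longrightarrow> nc E r V \<le> \<epsilon> * (real (card V))\<^sup>2"
        using cliques_upper_large[OF k1 r \<epsilon>] by blast
      have "real (gen_turan n (complete_graph r) (disjoint_copies k F)) \<le> \<epsilon> * (real n)\<^sup>2" if n: "n0 \<le> n" for n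
      proof -
        have "gen_turan n (complete_graph r) (disjoint_copies k F) \<in> ?S n r"
          unfolding gen_turan_def by (rule Max_in[OF gen_turan_set[OF ne]])
        from S[OF this] obtain G :: "nat sgraph" where
          G: "gen_turan n (complete_graph r) (disjoint_copies k F) = nc (adj G) r (verts G)" "graph_rel (adj G)"
          "finite (verts G)" "card (verts G) = n" "disjoint_thetas_free ps k (adj G) (verts G)" by blast
        show ?thesis using n0[OF G(2,3,5)] G(1,4) n by simp
      qed
      then show "\<forall>\<^sub>F n in sequentially. norm (real (gen_turan n (complete_graph r) (disjoint_copies k F)))
          \<le> \<epsilon> * norm ((real n)\<^sup>2)"
        unfolding eventually_sequentially by (intro exI[of _ n0]) simp
    qed
  qed
qed

end
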